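(* Let $\mathcal{M}$ be the category of conical refinement monoids with order-unit and unit-preserving homomorphisms. Let $M$ be a conical refinement monoid with order-unit and let $\mathcal{M}'$ be a full subcategory of $\mathcal{M}$ satisfying the following conditions: (i) $\mathcal{M}'$ is closed under finite nonempty products. (ii) Every diagram, indexed by $\omega\times\omega$, of members of $\mathcal{M}'$ with embeddings, has a lifting, with respect to the $V$ functor, by regular rings. (iii) There exists an $\omega$-indexed diagram in $\mathrm{Retr}(\mathcal{M},\mathcal{M}')$, with objects $\langle M_n,N_n,\varepsilon_n,\mu_n\rangle$ and transition morphisms $\langle f_n,g_n\rangle$, where $f_n\colon M_n\to M_{n+1}$ and $g_n\colon N_n\to N_{n+1}$ (for $n<\omega$), with all the $f_n$ and $g_n$ embeddings, such that $\varinjlim_n M_n\cong M$ (the colimit being taken along the $f_n$). Then $M$ is isomorphic to $V(R)$, for some regular ring $R$.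
   Context: **Monoids.** Commutative monoids are written additively. A commutative monoid $M$ is a refinement monoid if $a_0+a_1=b_0+b_1$ in $M$ implies the existence of $c_{i,j}\in M$ ($i,j<2$) with $a_i=c_{i,0}+c_{i,1}$ and $b_i=c_{0,i}+c_{1,i}$ for $i<2$. It is conical if $x+y=0$ implies $x=y=0$. The algebraic quasi-ordering is $x\le y\Leftrightarrow(\exists z)(x+z=y)$. An order-unit of $M$ is $u\in M$ such that for all $x\in M$ there is a positive integer $n$ with $x\le nu$. A monoid homomorphism $f\colon M\to N$ is an embedding if it is one-to-one and, for all $x,y\in M$, $f(x)\le f(y)$ if and only if $x\le y$. Objects of $\mathcal{M}$ carry a distinguished order-unit, preserved by the morphisms. **Rings.** Rings are unital and associative. A ring $R$ is (von Neumann) regular if $(\forall x)(\exists y)(xyx=x)$. $V(R)$ is the commutative monoid of isomorphism classes $[X]$ of finitely generated projective right $R$-modules, with $[X]+[Y]=[X\oplus Y]$, and order-unit $[R]$. For regular $R$, $V(R)$ is a conical refinement monoid. A unital ring homomorphism $f\colon R\to S$ of regular rings induces the unique monoid homomorphism $V(f)\colon V(R)\to V(S)$ with $V(f)([xR])=[f(x)S]$ for all $x\in R$. So $V$ is a functor from the category of regular rings and unital ring homomorphisms to $\mathcal{M}$. **Diagrams and liftings.** The posets $\omega=\{0,1,2,\dots\}$ and $\omega\times\omega$ (componentwise order) are viewed as categories; a diagram is a functor. A lifting of a diagram $\mathbf{D}\colon\mathcal{I}\to\mathcal{M}$ with respect to $V$ by regular rings is a functor $\mathbf{E}$ from $\mathcal{I}$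 to regular rings and unital ring homomorphisms such that $V\mathbf{E}$ is naturally isomorphic to $\mathbf{D}$. **The category $\mathrm{Retr}(\mathcal{M},\mathcal{M}')$.** Objects are quadruples $\langle A,B,\varepsilon,\mu\rangle$ with $A$ an object of $\mathcal{M}$, $B$ an object of $\mathcal{M}'$, $\varepsilon\colon A\to B$ and $\mu\colon B\to A$ in $\mathcal{M}$, and $\mu\circ\varepsilon=\mathrm{id}_A$. A morphism from $\langle A,B,\varepsilon,\mu\rangle$ to $\langle A',B',\varepsilon',\mu'\rangle$ is a pair $\langle f,g\rangle$ with $f\colon A\to A'$ in $\mathcal{M}$, $g\colon B\to B'$ in $\mathcal{M}'$, $g\circ\varepsilon=\varepsilon'\circ f$ and $\mu'\circ g=f\circ\mu$; composition is componentwise. *)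

theory Defs
  imports "HOL-Algebra.Module" "HOL-Algebra.Product_Groups" "HOL-Library.Product_Order"
begin

section \<open>Conical refinement monoids with order-unit\<close>

text \<open>
  Commutative monoids are HOL-Algebra commutative monoids, hence in multiplicative notation:
  \<open>\<otimes>\<close>, \<open>\<one>\<close>, \<open>[^]\<close> stand for the sum, the zero and the multiples \<open>n u\<close>.
  Only the restriction of a homomorphism to the carrier is meaningful, so
  equations between morphisms are stated pointwise on carriers.
\<close>

record 'a ou_monoid = "'a monoid" +
  ounit :: 'a

definition alg_le :: "('a, 'b) monoid_scheme \<Rightarrow> 'a \<Rightarrow> 'a \<Rightarrow> bool" where
  "alg_le M x y \<longleftrightarrow> (\<exists>z\<in>carrier M. x \<otimes>\<^bsub>M\<^esub> z = y)"

definition refinement :: "('a, 'b) monoid_scheme \<Rightarrow> bool" where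
  "refinement M \<longleftrightarrow>
    (\<forall>a0\<in>carrier M. \<forall>a1\<in>carrier M. \<forall>b0\<in>carrier M. \<forall>b1\<in>carrier M.
      a0 \<otimes>\<^bsub>M\<^esub> a1 = b0 \<otimes>\<^bsub>M\<^esub> b1 \<longrightarrow>
      (\<exists>c00\<in>carrier M. \<exists>c01\<in>carrier M. \<exists>c10\<in>carrier M. \<exists>c11\<in>carrier M.
        a0 = c00 \<otimes>\<^bsub>M\<^esub> c01 \<and> a1 = c10 \<otimes>\<^bsub>M\<^esub> c11 \<and>
        b0 = c00 \<otimes>\<^bsub>M\<^esub> c10 \<and> b1 = c01 \<otimes>\<^bsub>M\<^esub> c11))"

definition conical :: "('a, 'b) monoid_scheme \<Rightarrow> bool" where
  "conical M \<longleftrightarrow>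
    (\<forall>x\<in>carrier M. \<forall>y\<in>carrier M. x \<otimes>\<^bsub>M\<^esub> y = \<one>\<^bsub>M\<^esub> \<longrightarrow> x = \<one>\<^bsub>M\<^esub> \<and> y = \<one>\<^bsub>M\<^esub>)"

definition order_unit :: "('a, 'b) monoid_scheme \<Rightarrow> 'a \<Rightarrow> bool" where
  "order_unit M u \<longleftrightarrow>
    u \<in> carrier M \<and> (\<forall>x\<in>carrier M. \<exists>n::nat. n > 0 \<and> alg_le M x (u [^]\<^bsub>M\<^esub> n))"

definition crm_obj :: "'a ou_monoid \<Rightarrow> bool" where
  "crm_obj M \<longleftrightarrow> comm_monoid M \<and> refinement M \<and> conical M \<and> order_unit M (ounit M)"

definition ou_hom :: "'a ou_monoid \<Rightarrow> 'b ou_monoid \<Rightarrow> ('a \<Rightarrow> 'b) set" where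
  "ou_hom A B = {h \<in> hom A B. h \<one>\<^bsub>A\<^esub> = \<one>\<^bsub>B\<^esub> \<and> h (ounit A) = ounit B}"

definition ou_iso :: "'a ou_monoid \<Rightarrow> 'b ou_monoid \<Rightarrow> ('a \<Rightarrow> 'b) set" where
  "ou_iso A B = {h \<in> ou_hom A B. bij_betw h (carrier A) (carrier B)}"

definition ou_isomorphic :: "'a ou_monoid \<Rightarrow> 'b ou_monoid \<Rightarrow> bool" where
  "ou_isomorphic A B \<longleftrightarrow> ou_iso A B \<noteq> {}"

definition ou_embedding :: "'a ou_monoid \<Rightarrow> 'b ou_monoid \<Rightarrow> ('a \<Rightarrow> 'b) \<Rightarrow> bool" where
  "ou_embedding A B h \<longleftrightarrow> h \<in> ou_hom A B \<and> inj_on h (carrier A) \<and>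
    (\<forall>x\<in>carrier A. \<forall>y\<in>carrier A. alg_le B (h x) (h y) \<longleftrightarrow> alg_le A x y)"

definition ou_product :: "'i set \<Rightarrow> ('i \<Rightarrow> 'a ou_monoid) \<Rightarrow> ('i \<Rightarrow> 'a) ou_monoid" where
  "ou_product I A =
    monoid.extend (product_group I A) \<lparr>ounit = (\<lambda>i\<in>I. ounit (A i))\<rparr>"

text \<open>
  A full subcategory is given by its set of objects.  The product of a family of objects over
  \<^typ>\<open>'a\<close> lives over a function type, so closure means that the subcategory
  contains an object isomorphic to it.
\<close>

definition closed_finite_products :: "'a ou_monoid set \<Rightarrow> bool" where
  "closed_finite_products K \<longleftrightarrow>
    (\<forall>(n::nat) A. n > 0 \<and> (\<forall>i<n. A i \<in> K) \<longrightarrow>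
      (\<exists>C\<in>K. ou_isomorphic C (ou_product {..<n} A)))"


section \<open>Diagrams of monoids and colimits of sequences\<close>

text \<open>
  Functors from an ordered set.  Here \<^term>\<open>d i j\<close> is the image of the unique
  arrow from \<^term>\<open>i\<close> to \<^term>\<open>j\<close>, and is only relevant if \<^term>\<open>i \<le> j\<close>.
\<close>

definition ou_diagram ::
  "('i::order \<Rightarrow> 'a ou_monoid) \<Rightarrow> ('i \<Rightarrow> 'i \<Rightarrow> 'a \<Rightarrow> 'a) \<Rightarrow> bool" where
  "ou_diagram D d \<longleftrightarrow>
    (\<forall>i. crm_obj (D i)) \<and>
    (\<forall>i j. i \<le> j \<longrightarrow> d i j \<in> ou_hom (D i) (D j)) \<and>
    (\<forall>i. \<forall>x\<in>carrier (D i). d i i x = x) \<and>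
    (\<forall>i j k. i \<le> j \<and> j \<le> k \<longrightarrow> (\<forall>x\<in>carrier (D i). d j k (d i j x) = d i k x))"

definition colim_rel ::
  "(nat \<Rightarrow> 'a ou_monoid) \<Rightarrow> (nat \<Rightarrow> nat \<Rightarrow> 'a \<Rightarrow> 'a) \<Rightarrow> ((nat \<times> 'a) \<times> (nat \<times> 'a)) set" where
  "colim_rel D d = {((m, x), (n, y)). x \<in> carrier (D m) \<and> y \<in> carrier (D n) \<and>
    (\<exists>k. m \<le> k \<and> n \<le> k \<and> d m k x = d n k y)}"

text \<open>The colimit as the usual quotient of the disjoint union of the objects.\<close>

definition omega_colim ::
  "(nat \<Rightarrow> 'a ou_monoid) \<Rightarrow> (nat \<Rightarrow> nat \<Rightarrow> 'a \<Rightarrow> 'a) \<Rightarrow> (nat \<times> 'a) set ou_monoid" where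
  "omega_colim D d =
    \<lparr>carrier = (SIGMA n:UNIV. carrier (D n)) // colim_rel D d,
     monoid.mult = (\<lambda>X Y. \<Union>(m, x)\<in>X. \<Union>(n, y)\<in>Y.
       colim_rel D d `` {(max m n, d m (max m n) x \<otimes>\<^bsub>D (max m n)\<^esub> d n (max m n) y)}),
     one = colim_rel D d `` {(0, \<one>\<^bsub>D 0\<^esub>)},
     ounit = colim_rel D d `` {(0, ounit (D 0))}\<rparr>"


section \<open>The category Retr\<close>

type_synonym 'a retr = "'a ou_monoid \<times> 'a ou_monoid \<times> ('a \<Rightarrow> 'a) \<times> ('a \<Rightarrow> 'a)"

definition retr_obj :: "'a ou_monoid set \<Rightarrow> 'a retr \<Rightarrow> bool" where
  "retr_obj K = (\<lambda>(A, B, \<epsilon>, \<mu>). crm_obj A \<and> B \<in> K \<and> \<epsilon> \<in> ou_hom A B \<and> \<mu> \<in> ou_hom B A \<and>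
    (\<forall>x\<in>carrier A. \<mu> (\<epsilon> x) = x))"

definition retr_hom :: "'a retr \<Rightarrow> 'a retr \<Rightarrow> (('a \<Rightarrow> 'a) \<times> ('a \<Rightarrow> 'a)) set" where
  "retr_hom = (\<lambda>(A, B, \<epsilon>, \<mu>) (A', B', \<epsilon>', \<mu>').
    {(f, g). f \<in> ou_hom A A' \<and> g \<in> ou_hom B B' \<and>
      (\<forall>x\<in>carrier A. g (\<epsilon> x) = \<epsilon>' (f x)) \<and> (\<forall>y\<in>carrier B. \<mu>' (g y) = f (\<mu> y))})"

text \<open>
  Composition in Retr is componentwise, so functoriality is that of both components.
\<close>

definition retr_diagram ::
  "'a ou_monoid set \<Rightarrow> ('i::order \<Rightarrow> 'a ou_monoid) \<Rightarrow> ('i \<Rightarrow> 'a ou_monoid) \<Rightarrow>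
    ('i \<Rightarrow> 'a \<Rightarrow> 'a) \<Rightarrow> ('i \<Rightarrow> 'a \<Rightarrow> 'a) \<Rightarrow>
    ('i \<Rightarrow> 'i \<Rightarrow> 'a \<Rightarrow> 'a) \<Rightarrow> ('i \<Rightarrow> 'i \<Rightarrow> 'a \<Rightarrow> 'a) \<Rightarrow> bool" where
  "retr_diagram K A B \<epsilon> \<mu> f g \<longleftrightarrow>
    (\<forall>i. retr_obj K (A i, B i, \<epsilon> i, \<mu> i)) \<and>
    (\<forall>i j. i \<le> j \<longrightarrow>
      (f i j, g i j) \<in> retr_hom (A i, B i, \<epsilon> i, \<mu> i) (A j, B j, \<epsilon> j, \<mu> j)) \<and>
    ou_diagram A f \<and> ou_diagram B g"


section \<open>Right modules\<close>

text \<open>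
  The library's locale \<^locale>\<open>module\<close> requires a commutative ring.  Its record type is
  reused with \<open>r \<odot> x\<close> read as the right action \<open>x r\<close>.
  The fields \<open>mult\<close> and \<open>one\<close> inherited from the ring record play no role.
\<close>

locale right_module = R?: ring R + M?: abelian_group M
  for R (structure) and M (structure) +
  assumes smult_closed:
      "\<lbrakk>r \<in> carrier R; x \<in> carrier M\<rbrakk> \<Longrightarrow> r \<odot>\<^bsub>M\<^esub> x \<in> carrier M"
    and smult_distr_ring:
      "\<lbrakk>r \<in> carrier R; s \<in> carrier R; x \<in> carrier M\<rbrakk> \<Longrightarrow>
        (r \<oplus> s) \<odot>\<^bsub>M\<^esub> x = r \<odot>\<^bsub>M\<^esub> x \<oplus>\<^bsub>M\<^esub> s \<odot>\<^bsub>M\<^esub> x"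
    and smult_distr_module:
      "\<lbrakk>r \<in> carrier R; x \<in> carrier M; y \<in> carrier M\<rbrakk> \<Longrightarrow>
        r \<odot>\<^bsub>M\<^esub> (x \<oplus>\<^bsub>M\<^esub> y) = r \<odot>\<^bsub>M\<^esub> x \<oplus>\<^bsub>M\<^esub> r \<odot>\<^bsub>M\<^esub> y"
    and smult_assoc:
      "\<lbrakk>r \<in> carrier R; s \<in> carrier R; x \<in> carrier M\<rbrakk> \<Longrightarrow>
        (r \<otimes> s) \<odot>\<^bsub>M\<^esub> x = s \<odot>\<^bsub>M\<^esub> (r \<odot>\<^bsub>M\<^esub> x)"
    and smult_one:
      "x \<in> carrier M \<Longrightarrow> \<one> \<odot>\<^bsub>M\<^esub> x = x"

definition rmod_hom :: "'r ring \<Rightarrow> ('r, 'a) module \<Rightarrow> ('r, 'b) module \<Rightarrow> ('a \<Rightarrow> 'b) set" where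
  "rmod_hom R X Y = {h \<in> carrier X \<rightarrow> carrier Y.
    (\<forall>x\<in>carrier X. \<forall>y\<in>carrier X. h (x \<oplus>\<^bsub>X\<^esub> y) = h x \<oplus>\<^bsub>Y\<^esub> h y) \<and>
    (\<forall>r\<in>carrier R. \<forall>x\<in>carrier X. h (r \<odot>\<^bsub>X\<^esub> x) = r \<odot>\<^bsub>Y\<^esub> h x)}"

definition rmod_isomorphic :: "'r ring \<Rightarrow> ('r, 'a) module \<Rightarrow> ('r, 'b) module \<Rightarrow> bool" where
  "rmod_isomorphic R X Y \<longleftrightarrow> (\<exists>h\<in>rmod_hom R X Y. bij_betw h (carrier X) (carrier Y))"

definition finitely_generated :: "'r ring \<Rightarrow> ('r, 'a) module \<Rightarrow> bool" where
  "finitely_generated R X \<longleftrightarrow> (\<exists>S. finite S \<and> S \<subseteq> carrier X \<and>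
    (\<forall>x\<in>carrier X. \<exists>c\<in>S \<rightarrow> carrier R. x = (\<Oplus>\<^bsub>X\<^esub>s\<in>S. c s \<odot>\<^bsub>X\<^esub> s)))"

text \<open>The lifting property, tested against the modules over the same type.\<close>

definition projective :: "'r ring \<Rightarrow> ('r, 'a) module \<Rightarrow> bool" where
  "projective R P \<longleftrightarrow>
    (\<forall>(A :: ('r, 'a) module) (B :: ('r, 'a) module). right_module R A \<and> right_module R B \<longrightarrow>
      (\<forall>p\<in>rmod_hom R A B. \<forall>f\<in>rmod_hom R P B. p ` carrier A = carrier B \<longrightarrow>
        (\<exists>h\<in>rmod_hom R P A. \<forall>x\<in>carrier P. p (h x) = f x)))"

definition direct_sum :: "('r, 'a) module \<Rightarrow> ('r, 'b) module \<Rightarrow> ('r, 'a \<times> 'b) module" where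
  "direct_sum X Y =
    \<lparr>carrier = carrier X \<times> carrier Y,
     monoid.mult = undefined, one = undefined,
     zero = (\<zero>\<^bsub>X\<^esub>, \<zero>\<^bsub>Y\<^esub>),
     add = (\<lambda>(x, y) (x', y'). (x \<oplus>\<^bsub>X\<^esub> x', y \<oplus>\<^bsub>Y\<^esub> y')),
     smult = (\<lambda>r (x, y). (r \<odot>\<^bsub>X\<^esub> x, r \<odot>\<^bsub>Y\<^esub> y))\<rparr>"

definition right_ideal_module :: "'r ring \<Rightarrow> 'r set \<Rightarrow> ('r, 'r) module" where
  "right_ideal_module R I =
    \<lparr>carrier = I, monoid.mult = undefined, one = undefined,
     zero = \<zero>\<^bsub>R\<^esub>, add = add R, smult = (\<lambda>r x. x \<otimes>\<^bsub>R\<^esub> r)\<rparr>"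

abbreviation regular_rmod :: "'r ring \<Rightarrow> ('r, 'r) module" where
  "regular_rmod R \<equiv> right_ideal_module R (carrier R)"

abbreviation principal_rmod :: "'r ring \<Rightarrow> 'r \<Rightarrow> ('r, 'r) module" where
  "principal_rmod R x \<equiv> right_ideal_module R ((\<lambda>r. x \<otimes>\<^bsub>R\<^esub> r) ` carrier R)"


section \<open>The functor V on regular rings\<close>

definition regular_ring :: "'r ring \<Rightarrow> bool" where
  "regular_ring R \<longleftrightarrow> ring R \<and>
    (\<forall>x\<in>carrier R. \<exists>y\<in>carrier R. x \<otimes>\<^bsub>R\<^esub> y \<otimes>\<^bsub>R\<^esub> x = x)"

text \<open>
  Every finitely generated projective right \<open>R\<close>-module embeds into some free module \<open>R\<^sup>n\<close>,
  hence has an isomorphic copy over the type \<^typ>\<open>nat \<Rightarrow> 'r\<close>; so representatives of all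
  classes in \<open>V(R)\<close> occur there.  As the modules \<open>R\<^sup>n\<close> occur there as well, a
  finitely generated module having the lifting property for the modules over this type is a
  direct summand of some \<open>R\<^sup>n\<close>, and therefore projective in the unrestricted sense.
\<close>

definition fgp :: "'r ring \<Rightarrow> ('r, nat \<Rightarrow> 'r) module set" where
  "fgp R = {X. right_module R X \<and> finitely_generated R X \<and> projective R X}"

text \<open>\<open>X\<close> may live over any type, so that the class of \<open>xR\<close> makes sense.\<close>

definition iso_class :: "'r ring \<Rightarrow> ('r, 'a) module \<Rightarrow> ('r, nat \<Rightarrow> 'r) module set" where
  "iso_class R X = {Y \<in> fgp R. rmod_isomorphic R Y X}"

definition V :: "'r ring \<Rightarrow> ('r, nat \<Rightarrow> 'r) module set ou_monoid" where
  "V R =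
    \<lparr>carrier = iso_class R ` fgp R,
     monoid.mult = (\<lambda>C D. \<Union>X\<in>C. \<Union>Y\<in>D. iso_class R (direct_sum X Y)),
     one = iso_class R (right_ideal_module R {\<zero>\<^bsub>R\<^esub>}),
     ounit = iso_class R (regular_rmod R)\<rparr>"

definition V_map :: "'r ring \<Rightarrow> 's ring \<Rightarrow> ('r \<Rightarrow> 's) \<Rightarrow>
    ('r, nat \<Rightarrow> 'r) module set \<Rightarrow> ('s, nat \<Rightarrow> 's) module set" where
  "V_map R S f = (THE h. h \<in> extensional (carrier (V R)) \<and>
    h \<in> hom (V R) (V S) \<and> h \<one>\<^bsub>V R\<^esub> = \<one>\<^bsub>V S\<^esub> \<and>
    (\<forall>x\<in>carrier R. h (iso_class R (principal_rmod R x)) = iso_class S (principal_rmod S (f x))))"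

definition regular_ring_diagram ::
  "('i::order \<Rightarrow> 'r ring) \<Rightarrow> ('i \<Rightarrow> 'i \<Rightarrow> 'r \<Rightarrow> 'r) \<Rightarrow> bool" where
  "regular_ring_diagram E e \<longleftrightarrow>
    (\<forall>i. regular_ring (E i)) \<and>
    (\<forall>i j. i \<le> j \<longrightarrow> e i j \<in> ring_hom (E i) (E j)) \<and>
    (\<forall>i. \<forall>x\<in>carrier (E i). e i i x = x) \<and>
    (\<forall>i j k. i \<le> j \<and> j \<le> k \<longrightarrow> (\<forall>x\<in>carrier (E i). e j k (e i j x) = e i k x))"

definition V_lifting ::
  "('i::order \<Rightarrow> 'r ring) \<Rightarrow> ('i \<Rightarrow> 'i \<Rightarrow> 'r \<Rightarrow> 'r) \<Rightarrow>
    ('i \<Rightarrow> 'a ou_monoid) \<Rightarrow> ('i \<Rightarrow> 'i \<Rightarrow> 'a \<Rightarrow> 'a) \<Rightarrow> bool" where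
  "V_lifting E e D d \<longleftrightarrow> regular_ring_diagram E e \<and>
    (\<exists>\<phi>. (\<forall>i. \<phi> i \<in> ou_iso (V (E i)) (D i)) \<and>
      (\<forall>i j. i \<le> j \<longrightarrow>
        (\<forall>a\<in>carrier (V (E i)). \<phi> j (V_map (E i) (E j) (e i j) a) = d i j (\<phi> i a))))"

end

theory Submission
  imports Defs "HOL-Algebra.Ideal"
begin

text \<open>
  Write \<open>\<langle>M\<^sub>n, N\<^sub>n, \<epsilon>\<^sub>n, \<mu>\<^sub>n\<rangle>\<close> for the given diagram of retracts.  The liftable monoids are the
  \<open>N\<^sub>n\<close>, but \<open>M\<close> is only the limit of their retracts, that is, of the \<open>N\<^sub>n\<close> along maps that pass
  through \<open>\<mu>\<^sub>n\<close> and need not be embeddings.  The remedy is to keep the past: on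
  \<open>P\<^sub>n = N\<^sub>0 \<times> \<dots> \<times> N\<^sub>n\<close> the map
  \<open>(x\<^sub>0, \<dots>, x\<^sub>n) \<mapsto> (x\<^sub>0, \<dots>, x\<^sub>n, \<epsilon> (f (\<mu>\<^sub>n x\<^sub>n)))\<close> only adds a coordinate, hence is an embedding, and
  yet its new coordinate lies in the retract.  Objects isomorphic to the \<open>P\<^sub>n\<close> exist in the
  subcategory, so the sequence lifts to regular rings \<open>E\<^sub>0 \<rightarrow> E\<^sub>1 \<rightarrow> \<dots>\<close>.

  The maps from \<open>P\<^sub>n\<close> to \<open>M\<close> taking \<open>x\<close> to the image of \<open>\<mu>\<^sub>n x\<^sub>n\<close> form a cone which is jointly onto, and it is
  injective up to elements sent to \<open>0\<close>: if \<open>x\<close> and \<open>y\<close> have the same image, then at a later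
  stage they have the same last coordinate, and adding to \<open>x\<close> the earlier coordinates of \<open>y\<close>,
  and vice versa, gives equal tuples (\<open>proj_eq\<close>).  So \<open>M\<close> is the limit of the
  \<open>P\<^sub>n \<cong> V(E\<^sub>n)\<close>, divided by the elements of image \<open>0\<close>.  Accordingly, the ring \<open>R\<close> is the limit
  of the quotients \<open>E\<^sub>n / I\<^sub>n\<close>, where \<open>I\<^sub>n\<close> consists of the \<open>x\<close> such that the class of \<open>xE\<^sub>n\<close> has
  image \<open>0\<close>.

  To compute \<open>V(R)\<close> one needs homomorphisms out of it.  For regular \<open>R\<close>, the monoid \<open>V(R)\<close> is
  generated by the classes of principal right ideals (\<open>V_induct\<close>), and any function \<open>w\<close> on \<open>R\<close>
  that takes the value \<open>0\<close> at \<open>0\<close>, depends only on the isomorphism class of \<open>xR\<close> and is additive on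
  orthogonal idempotents extends to a homomorphism on \<open>V(R)\<close> (\<open>class_dim_hom\<close>).  The value of a module
  \<open>X\<close> is the sum of the \<open>w\<close>-values of the factors of a filtration of \<open>X\<close> by successive kernels
  of functionals \<open>X \<rightarrow> R\<close>; that the filtration does not matter is a version of Zassenhaus' butterfly
  lemma.  This universal property yields the defining property of the maps \<open>V(f)\<close>, and it
  yields a homomorphism \<open>V(R) \<rightarrow> M\<close>, once it is known that the image in \<open>M\<close> of the class of
  \<open>xE\<^sub>n\<close> depends only on the image of \<open>x\<close> in \<open>R\<close> and is additive there
  (\<open>dim_cong\<close>, \<open>dim_sim_cong\<close>, \<open>dim_add_cong\<close>).  It is onto and one-to-one because the cone
  is so, in the sense explained above (\<open>V_limit_isomorphic\<close>).

  Finally, \<open>R\<close> has to live over the same type as the \<open>E\<^sub>n\<close>.  If that type is infinite, it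
  absorbs countable unions.  If it is finite, then every finite subset of \<open>R\<close> comes
  from one \<open>E\<^sub>n\<close>, which bounds the size of \<open>R\<close> (\<open>increasing_union_injection\<close>).
\<close>

section \<open>Idempotents in regular rings\<close>

locale vn_regular = ring R for R :: "'r ring" (structure) +
  assumes quasi_inverse: "x \<in> carrier R \<Longrightarrow> \<exists>y\<in>carrier R. x \<otimes> y \<otimes> x = x"

lemma vn_regular_iff: "vn_regular R \<longleftrightarrow> regular_ring R"
  by (auto simp: vn_regular_def vn_regular_axioms_def regular_ring_def)

text \<open>
  The right ideals \<open>xR\<close> and \<open>yR\<close> are isomorphic, by left multiplication with \<open>c\<close> and \<open>d\<close>.  This
  form of the condition is preserved by ring homomorphisms.
\<close>

definition sim :: "('r, 'b) ring_scheme \<Rightarrow> 'r \<Rightarrow> 'r \<Rightarrow> bool" where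
  "sim R x y \<longleftrightarrow> x \<in> carrier R \<and> y \<in> carrier R \<and>
    (\<exists>c\<in>carrier R. \<exists>d\<in>carrier R. \<exists>a\<in>carrier R. \<exists>b\<in>carrier R.
      c \<otimes>\<^bsub>R\<^esub> x = y \<otimes>\<^bsub>R\<^esub> a \<and> d \<otimes>\<^bsub>R\<^esub> y = x \<otimes>\<^bsub>R\<^esub> b \<and>
      d \<otimes>\<^bsub>R\<^esub> (c \<otimes>\<^bsub>R\<^esub> x) = x \<and> c \<otimes>\<^bsub>R\<^esub> (d \<otimes>\<^bsub>R\<^esub> y) = y)"

lemma simE:
  assumes "sim R x y"
  obtains c d a b where "x \<in> carrier R" "y \<in> carrier R"
    "c \<in> carrier R" "d \<in> carrier R" "a \<in> carrier R" "b \<in> carrier R"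
    "c \<otimes>\<^bsub>R\<^esub> x = y \<otimes>\<^bsub>R\<^esub> a" "d \<otimes>\<^bsub>R\<^esub> y = x \<otimes>\<^bsub>R\<^esub> b"
    "d \<otimes>\<^bsub>R\<^esub> (c \<otimes>\<^bsub>R\<^esub> x) = x" "c \<otimes>\<^bsub>R\<^esub> (d \<otimes>\<^bsub>R\<^esub> y) = y"
  using assms unfolding sim_def by (elim conjE bexE) (rule that)

lemma (in abelian_group) minus_eq_zeroD:
  "x \<ominus> y = \<zero> \<Longrightarrow> x \<in> carrier G \<Longrightarrow> y \<in> carrier G \<Longrightarrow> x = y"
  using minus_equality[of x "\<ominus> y"] by (simp add: minus_eq)

context ring begin

lemma sim_same_ideal:
  assumes "x \<in> carrier R" "y \<in> carrier R" "a \<in> carrier R" "b \<in> carrier R" "x = y \<otimes> a" "y = x \<otimes> b"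
  shows "sim R x y"
  unfolding sim_def using assms(1-4)
  by (intro conjI bexI[of _ \<one>] bexI[of _ a] bexI[of _ b])
    (simp_all flip: assms(5,6))

text \<open>
  If \<open>pR \<subseteq> gR\<close>, then \<open>pg\<close> generates the same right ideal as \<open>p\<close>, and \<open>g\<close> is the sum of
  the orthogonal idempotents \<open>pg\<close> and \<open>g - pg\<close>.
\<close>

lemma split_idempotent:
  assumes "g \<in> carrier R" "p \<in> carrier R" "g \<otimes> g = g" "p \<otimes> p = p" "g \<otimes> p = p"
  shows "(p \<otimes> g) \<otimes> (p \<otimes> g) = p \<otimes> g" "(p \<otimes> g) \<otimes> p = p"
    "(g \<ominus> p \<otimes> g) \<otimes> (g \<ominus> p \<otimes> g) = g \<ominus> p \<otimes> g"
    "(p \<otimes> g) \<otimes> (g \<ominus> p \<otimes> g) = \<zero>" "(g \<ominus> p \<otimes> g) \<otimes> (p \<otimes> g) = \<zero>"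
    "p \<otimes> g \<oplus> (g \<ominus> p \<otimes> g) = g" "(g \<ominus> p \<otimes> g) \<otimes> p = \<zero>" "g \<otimes> (g \<ominus> p \<otimes> g) = g \<ominus> p \<otimes> g"
proof -
  have a: "p \<otimes> (p \<otimes> z) = p \<otimes> z" "g \<otimes> (p \<otimes> z) = p \<otimes> z" "g \<otimes> (g \<otimes> z) = g \<otimes> z" if "z \<in> carrier R" for z
    using assms that by (simp_all flip: m_assoc)
  note [simp] = assms a
  show "(p \<otimes> g) \<otimes> (p \<otimes> g) = p \<otimes> g" "(p \<otimes> g) \<otimes> p = p"
    by (simp_all add: m_assoc)
  show "(p \<otimes> g) \<otimes> (g \<ominus> p \<otimes> g) = \<zero>" "(g \<ominus> p \<otimes> g) \<otimes> (p \<otimes> g) = \<zero>"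
    "p \<otimes> g \<oplus> (g \<ominus> p \<otimes> g) = g" "(g \<ominus> p \<otimes> g) \<otimes> p = \<zero>"
    "g \<otimes> (g \<ominus> p \<otimes> g) = g \<ominus> p \<otimes> g"
    by (simp_all add: ring_simprules)
  show "(g \<ominus> p \<otimes> g) \<otimes> (g \<ominus> p \<otimes> g) = g \<ominus> p \<otimes> g"
    by (simp add: ring_simprules)
qed

end

context vn_regular begin

lemma idempotent_generator:
  assumes "x \<in> carrier R"
  obtains g u where "g \<in> carrier R" "u \<in> carrier R" "g \<otimes> g = g" "g = x \<otimes> u" "g \<otimes> x = x"
proof -
  obtain u where u: "u \<in> carrier R" "x \<otimes> u \<otimes> x = x" using quasi_inverse[OF assms] by blast
  show thesis
    by (rule that[of "x \<otimes> u" u]) (use u assms in \<open>auto simp flip: m_assoc\<close>)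
qed

text \<open>
  The right ideal \<open>gR + tR\<close> is the direct sum of \<open>gR\<close> and \<open>(t - gt)R\<close>.  An idempotent
  generator \<open>f\<close> of the second summand satisfies \<open>gf = 0\<close>, and \<open>h = f(1 - g)\<close> also satisfies
  \<open>hg = 0\<close>.
\<close>

lemma orthogonal_complement_idempotent:
  assumes g: "g \<in> carrier R" "g \<otimes> g = g" and t: "t \<in> carrier R"
  obtains h r where "h \<in> carrier R" "r \<in> carrier R" "h \<otimes> h = h" "g \<otimes> h = \<zero>" "h \<otimes> g = \<zero>"
    "h = (t \<ominus> g \<otimes> t) \<otimes> r" "h \<otimes> (t \<ominus> g \<otimes> t) = t \<ominus> g \<otimes> t" "(g \<oplus> h) \<otimes> t = t"
    "(g \<oplus> h) \<otimes> (g \<oplus> h) = g \<oplus> h"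
proof -
  define u where "u = t \<ominus> g \<otimes> t"
  have uc[simp]: "u \<in> carrier R" using g t by (simp add: u_def)
  obtain f v where f: "f \<in> carrier R" "v \<in> carrier R" "f \<otimes> f = f" "f = u \<otimes> v" "f \<otimes> u = u"
    using idempotent_generator[OF uc] by blast
  have gg: "g \<otimes> (g \<otimes> z) = g \<otimes> z" if "z \<in> carrier R" for z using g that by (simp flip: m_assoc)
  have gu: "g \<otimes> u = \<zero>" using g t gg by (simp add: u_def ring_simprules)
  have gf: "g \<otimes> f = \<zero>" using f(4) gu g f(2) uc by (metis l_null m_assoc)
  have gfz: "g \<otimes> (f \<otimes> z) = \<zero>" if "z \<in> carrier R" for z using gf that g f by (simp flip: m_assoc)
  have ff: "f \<otimes> (f \<otimes> z) = f \<otimes> z" if "z \<in> carrier R" for z using f that by (simp flip: m_assoc)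
  \<comment> \<open>This is \<open>f(1 - g)\<close>.\<close>
  define h where "h = f \<ominus> f \<otimes> g"
  note S = g t f(1-3,5) gg gf gfz ff
  have hc[simp]: "h \<in> carrier R" using S by (simp add: h_def)
  have h1: "h \<otimes> h = h" using S by (simp add: h_def ring_simprules)
  have h2: "g \<otimes> h = \<zero>" using S by (simp add: h_def ring_simprules)
  have h3: "h \<otimes> g = \<zero>" using S by (simp add: h_def ring_simprules)
  have h4: "h = u \<otimes> (v \<otimes> (\<one> \<ominus> g))"
  proof -
    have "u \<otimes> (v \<otimes> (\<one> \<ominus> g)) = f \<otimes> (\<one> \<ominus> g)" using f g uc by (simp add: m_assoc)
    then show ?thesis using S by (simp add: h_def ring_simprules)
  qed
  have h5: "h \<otimes> u = u" 
  proof -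
    have "h \<otimes> u = f \<otimes> u \<ominus> f \<otimes> (g \<otimes> u)" using S uc by (simp add: h_def ring_simprules)
    then show ?thesis using gu f uc by (simp add: minus_eq)
  qed
  have t: "t = g \<otimes> t \<oplus> u" using S by (simp add: u_def ring_simprules)
  have "h \<otimes> t = h \<otimes> g \<otimes> t \<oplus> h \<otimes> u"
    using t S(1,3) hc uc by (metis m_assoc m_closed r_distr)
  then have "h \<otimes> t = u" using h3 h5 S by simp
  then have h6: "(g \<oplus> h) \<otimes> t = t" using S t by (simp add: l_distr)
  have h7: "(g \<oplus> h) \<otimes> (g \<oplus> h) = g \<oplus> h" using h1 h2 h3 g by (simp add: l_distr r_distr)
  show thesis
    by (rule that[of h "v \<otimes> (\<one> \<ominus> g)"])
      (use h1 h2 h3 h4 h5 h6 h7 hc f(2) g in \<open>simp_all flip: u_def\<close>)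
qed

end

section \<open>Dimension functions\<close>

text \<open>
  The model is the function taking \<open>x\<close> to the class of \<open>xR\<close> in \<open>V(R)\<close>; by the universal
  property of \<open>V(R)\<close> proved below, every dimension function factors through it.
\<close>

locale dimension = vn_regular R + N: comm_monoid N
  for R :: "'r ring" (structure) and N :: "('n, 'b) monoid_scheme" +
  fixes w :: "'r \<Rightarrow> 'n"
  assumes dim_closed [simp]: "x \<in> carrier R \<Longrightarrow> w x \<in> carrier N"
    and dim_zero [simp]: "w \<zero> = \<one>\<^bsub>N\<^esub>"
    and dim_sim: "sim R x y \<Longrightarrow> w x = w y"
    and dim_add: "\<lbrakk>x \<in> carrier R; y \<in> carrier R; x \<otimes> x = x; y \<otimes> y = y;
      x \<otimes> y = \<zero>; y \<otimes> x = \<zero>\<rbrakk> \<Longrightarrow> w (x \<oplus> y) = w x \<otimes>\<^bsub>N\<^esub> w y"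
begin

lemma dim_same_ideal:
  assumes "x \<in> carrier R" "y \<in> carrier R" "a \<in> carrier R" "b \<in> carrier R" "x = y \<otimes> a" "y = x \<otimes> b"
  shows "w x = w y"
  using dim_sim sim_same_ideal assms by metis

lemma dim_split_idempotent:
  assumes "g \<in> carrier R" "p \<in> carrier R" "g \<otimes> g = g" "p \<otimes> p = p" "g \<otimes> p = p"
  shows "w g = w p \<otimes>\<^bsub>N\<^esub> w (g \<ominus> p \<otimes> g)"
proof -
  note s = split_idempotent[OF assms]
  have "w g = w (p \<otimes> g) \<otimes>\<^bsub>N\<^esub> w (g \<ominus> p \<otimes> g)"
    using dim_add[of "p \<otimes> g" "g \<ominus> p \<otimes> g"] s assms by simp
  moreover have "w (p \<otimes> g) = w p"
    by (rule dim_same_ideal[of _ _ g p]) (use s assms in auto)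
  ultimately show ?thesis by simp
qed

text \<open>
  The right ideal \<open>yaR\<close> is a direct summand of \<open>yR\<close>, with complement \<open>(1 - t)yR\<close> for an
  idempotent generator \<open>t\<close> of \<open>yaR\<close>.
\<close>

lemma dim_right_mult:
  assumes y: "y \<in> carrier R" and a: "a \<in> carrier R"
  obtains t r where "t \<in> carrier R" "r \<in> carrier R" "t \<otimes> t = t" "t \<otimes> (y \<otimes> a) = y \<otimes> a" "t = y \<otimes> a \<otimes> r"
    "w y = w (y \<otimes> a) \<otimes>\<^bsub>N\<^esub> w (y \<ominus> t \<otimes> y)"
proof -
  obtain g u where g: "g \<in> carrier R" "u \<in> carrier R" "g \<otimes> g = g" "g = y \<otimes> u" "g \<otimes> y = y"
    using idempotent_generator[OF y] by blast
  obtain t r where t: "t \<in> carrier R" "r \<in> carrier R" "t \<otimes> t = t" "t = y \<otimes> a \<otimes> r" "t \<otimes> (y \<otimes> a) = y \<otimes> a"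
    using idempotent_generator[of "y \<otimes> a"] y a by auto
  have gt: "g \<otimes> t = t" using t(2,4) g y a by (metis m_assoc m_closed)
  have "w g = w t \<otimes>\<^bsub>N\<^esub> w (g \<ominus> t \<otimes> g)" by (rule dim_split_idempotent) (use g t gt in auto)
  moreover have "w g = w y" by (rule dim_same_ideal[of _ _ u y]) (use g y in auto)
  moreover have "w t = w (y \<otimes> a)"
    by (rule dim_same_ideal[of _ _ r "y \<otimes> a"]) (use t y a in auto)
  moreover have "w (g \<ominus> t \<otimes> g) = w (y \<ominus> t \<otimes> y)"
  proof (rule dim_same_ideal[of _ _ u y])
    have "(y \<ominus> t \<otimes> y) \<otimes> u = y \<otimes> u \<ominus> t \<otimes> (y \<otimes> u)"
      using y t(1) g(2) by (simp add: ring_simprules)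
    then show "g \<ominus> t \<otimes> g = (y \<ominus> t \<otimes> y) \<otimes> u" using g by simp
    have "(g \<ominus> t \<otimes> g) \<otimes> y = g \<otimes> y \<ominus> t \<otimes> (g \<otimes> y)"
      using y t(1) g(1) by (simp add: ring_simprules)
    then show "y \<ominus> t \<otimes> y = (g \<ominus> t \<otimes> g) \<otimes> y" using g by simp
  qed (use g t y in auto)
  ultimately show thesis using that[of t r] t by simp
qed

text \<open>
  Left multiplication by \<open>s\<close> maps \<open>xR\<close> onto \<open>sxR\<close>.  Its kernel \<open>zR\<close> is a direct summand,
  because \<open>sxR\<close> is projective.
\<close>

lemma dim_left_mult:
  assumes x: "x \<in> carrier R" and s: "s \<in> carrier R"
  obtains z r where "z \<in> carrier R" "r \<in> carrier R" "z = x \<otimes> r" "s \<otimes> z = \<zero>"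
    "w x = w (s \<otimes> x) \<otimes>\<^bsub>N\<^esub> w z"
proof -
  obtain g u where g: "g \<in> carrier R" "u \<in> carrier R" "g \<otimes> g = g" "g = x \<otimes> u" "g \<otimes> x = x"
    using idempotent_generator[OF x] by blast
  obtain q where q: "q \<in> carrier R" "s \<otimes> g \<otimes> q \<otimes> (s \<otimes> g) = s \<otimes> g"
    using quasi_inverse[of "s \<otimes> g"] s g by auto
  \<comment> \<open>Projection of \<open>xR = gR\<close> along the kernel of \<open>s\<close>: first \<open>s\<close>, then its quasi-inverse.\<close>
  define p where "p = g \<otimes> q \<otimes> s \<otimes> g"
  have gg: "g \<otimes> (g \<otimes> y) = g \<otimes> y" if "y \<in> carrier R" for y using g that by (simp flip: m_assoc)
  have q2: "s \<otimes> (g \<otimes> (q \<otimes> (s \<otimes> g))) = s \<otimes> g" using q s g by (simp add: m_assoc)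
  have pc[simp]: "p \<in> carrier R" using q s g by (simp add: p_def)
  have sp: "s \<otimes> p = s \<otimes> g" using q2 q s g by (simp add: p_def m_assoc)
  have pp: "p \<otimes> p = p"
  proof -
    have "p \<otimes> p = g \<otimes> q \<otimes> (s \<otimes> (g \<otimes> (g \<otimes> (q \<otimes> (s \<otimes> g)))))" using q s g by (simp add: p_def m_assoc)
    also have "\<dots> = g \<otimes> q \<otimes> (s \<otimes> g)" using gg q s g q2 by simp
    finally show ?thesis using q s g by (simp add: p_def m_assoc)
  qed
  have gp: "g \<otimes> p = p" using gg q s g by (simp add: p_def m_assoc)
  have pg: "p \<otimes> g = p" using g q s by (simp add: p_def m_assoc)
  have "w g = w p \<otimes>\<^bsub>N\<^esub> w (g \<ominus> p)" using dim_split_idempotent[of g p] g pp gp pg by simp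
  moreover have "w g = w x" by (rule dim_same_ideal[of _ _ u x]) (use g x in auto)
  moreover have "w p = w (s \<otimes> g)"
  proof (rule dim_sim, unfold sim_def, intro conjI bexI)
    show "s \<otimes> p = s \<otimes> g \<otimes> \<one>" using sp s g by simp
    show "(g \<otimes> q) \<otimes> (s \<otimes> g) = p \<otimes> \<one>" using q s g by (simp add: p_def m_assoc)
    show "(g \<otimes> q) \<otimes> (s \<otimes> p) = p" using sp q s g by (simp add: p_def m_assoc)
    show "s \<otimes> ((g \<otimes> q) \<otimes> (s \<otimes> g)) = s \<otimes> g" using q2 q s g by (simp add: m_assoc)
  qed (use q s g in auto)
  moreover have "w (s \<otimes> g) = w (s \<otimes> x)"
    by (rule dim_same_ideal[of _ _ u x]) (use g x s in \<open>auto simp: m_assoc\<close>)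
  ultimately have wx: "w x = w (s \<otimes> x) \<otimes>\<^bsub>N\<^esub> w (g \<ominus> p)" by simp
  have s0: "s \<otimes> (g \<ominus> p) = \<zero>" using sp s g by (simp add: minus_eq r_distr r_minus r_neg)
  have gx: "g \<ominus> p = x \<otimes> (u \<ominus> u \<otimes> p)"
  proof -
    have "x \<otimes> (u \<ominus> u \<otimes> p) = x \<otimes> u \<ominus> x \<otimes> u \<otimes> p" using x g(2) pc by (simp add: ring_simprules)
    then show ?thesis using g gp by simp
  qed
  show thesis by (rule that[of "g \<ominus> p" "u \<ominus> u \<otimes> p"]) (fact | use g in simp)+
qed

end

text \<open>
  Left and right multiples have smaller values, so that in the conical case the elements of
  value \<open>0\<close> absorb products; they form a two-sided ideal.
\<close>

locale conical_dimension = dimension R N w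
  for R :: "'r ring" (structure) and N :: "('n, 'b) monoid_scheme" and w :: "'r \<Rightarrow> 'n" +
  assumes conical: "conical N"
begin

definition ker :: "'r set" where
  "ker = {x \<in> carrier R. w x = \<one>\<^bsub>N\<^esub>}"

lemma ker_closed: "x \<in> ker \<Longrightarrow> x \<in> carrier R"
  by (simp add: ker_def)

lemma conicalD:
  "a \<in> carrier N \<Longrightarrow> b \<in> carrier N \<Longrightarrow> a \<otimes>\<^bsub>N\<^esub> b = \<one>\<^bsub>N\<^esub> \<Longrightarrow> a = \<one>\<^bsub>N\<^esub>"
  using conical unfolding conical_def by blast

lemma ker_zero: "\<zero> \<in> ker"
  by (simp add: ker_def)

lemma ker_right_mult:
  assumes "x \<in> ker" "a \<in> carrier R"
  shows "x \<otimes> a \<in> ker"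
proof -
  have x: "x \<in> carrier R" "w x = \<one>\<^bsub>N\<^esub>" using assms by (auto simp: ker_def)
  obtain t where "t \<in> carrier R" "w x = w (x \<otimes> a) \<otimes>\<^bsub>N\<^esub> w (x \<ominus> t \<otimes> x)"
    using dim_right_mult[OF x(1) assms(2)] by metis
  then show ?thesis using conicalD[of "w (x \<otimes> a)" "w (x \<ominus> t \<otimes> x)"] x assms
    by (auto simp: ker_def)
qed

lemma ker_left_mult:
  assumes "x \<in> ker" "a \<in> carrier R"
  shows "a \<otimes> x \<in> ker"
proof -
  have x: "x \<in> carrier R" "w x = \<one>\<^bsub>N\<^esub>" using assms by (auto simp: ker_def)
  obtain t where "t \<in> carrier R" "w x = w (a \<otimes> x) \<otimes>\<^bsub>N\<^esub> w t"
    using dim_left_mult[OF x(1) assms(2)] by metis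
  then show ?thesis using conicalD[of "w (a \<otimes> x)" "w t"] x assms
    by (auto simp: ker_def)
qed

lemma ker_minus: "x \<in> ker \<Longrightarrow> \<ominus> x \<in> ker"
  using ker_left_mult[of x "\<ominus> \<one>"] ker_closed[of x] by (simp add: l_minus)

text \<open>
  With \<open>gR = xR\<close> and \<open>gR \<oplus> hR = xR + yR\<close>, the element \<open>h\<close> is obtained from
  \<open>(1 - g)y\<close> by a right multiplication, so \<open>g\<close> and \<open>h\<close> have value \<open>0\<close>, and \<open>x + y\<close> is a right
  multiple of \<open>g + h\<close>.
\<close>

lemma ker_add:
  assumes "x \<in> ker" "y \<in> ker"
  shows "x \<oplus> y \<in> ker"
proof -
  have xy: "x \<in> carrier R" "y \<in> carrier R" using assms ker_closed by auto
  obtain g u where g: "g \<in> carrier R" "u \<in> carrier R" "g \<otimes> g = g" "g = x \<otimes> u" "g \<otimes> x = x"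
    using idempotent_generator[OF xy(1)] by blast
  obtain h r where h: "h \<in> carrier R" "r \<in> carrier R" "h \<otimes> h = h" "g \<otimes> h = \<zero>" "h \<otimes> g = \<zero>"
    "h = (y \<ominus> g \<otimes> y) \<otimes> r" "(g \<oplus> h) \<otimes> y = y"
    using orthogonal_complement_idempotent[OF g(1,3) xy(2)] by metis
  have "g \<in> ker" using ker_right_mult[OF assms(1) g(2)] g by simp
  have "(\<one> \<ominus> g) \<otimes> y \<in> ker" using ker_left_mult[OF assms(2)] g by simp
  moreover have "(\<one> \<ominus> g) \<otimes> y = y \<ominus> g \<otimes> y" using xy g(1) by (simp add: ring_simprules)
  ultimately have "h \<in> ker" using ker_right_mult[of "y \<ominus> g \<otimes> y" r] h by simp
  have "w (g \<oplus> h) = w g \<otimes>\<^bsub>N\<^esub> w h" by (rule dim_add) (use g h in auto)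
  then have "g \<oplus> h \<in> ker" using \<open>g \<in> ker\<close> \<open>h \<in> ker\<close> by (simp add: ker_def)
  moreover have "(g \<oplus> h) \<otimes> x = x"
  proof -
    have "(g \<oplus> h) \<otimes> x = g \<otimes> x \<oplus> h \<otimes> (g \<otimes> x)" using g(1,5) h(1) xy by (simp add: l_distr)
    also have "h \<otimes> (g \<otimes> x) = \<zero>" using g(1) h(1,5) xy by (simp flip: m_assoc)
    finally show ?thesis using g(5) xy by simp
  qed
  ultimately show ?thesis
    using ker_right_mult[of "g \<oplus> h" "x \<oplus> y"] xy g(1) h(1,7) by (simp add: r_distr)
qed

definition cong_ker :: "'r \<Rightarrow> 'r \<Rightarrow> bool" (infix "\<doteq>" 50) where
  "x \<doteq> y \<longleftrightarrow> x \<in> carrier R \<and> y \<in> carrier R \<and> x \<ominus> y \<in> ker"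

lemma cong_refl: "x \<in> carrier R \<Longrightarrow> x \<doteq> x"
  by (simp add: cong_ker_def minus_eq r_neg ker_zero)

lemma cong_sym: "x \<doteq> y \<Longrightarrow> y \<doteq> x"
  using ker_minus[of "x \<ominus> y"] by (auto simp: cong_ker_def minus_eq minus_add a_comm)

lemma cong_trans [trans]: assumes "x \<doteq> y" "y \<doteq> z" shows "x \<doteq> z"
proof -
  have "x \<ominus> z = (x \<ominus> y) \<oplus> (y \<ominus> z)" using assms by (auto simp: cong_ker_def ring_simprules)
  then show ?thesis using assms ker_add by (auto simp: cong_ker_def)
qed

lemma cong_add: assumes "x \<doteq> y" "x' \<doteq> y'" shows "x \<oplus> x' \<doteq> y \<oplus> y'"
proof -
  have "(x \<oplus> x') \<ominus> (y \<oplus> y') = (x \<ominus> y) \<oplus> (x' \<ominus> y')"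
    using assms by (auto simp: cong_ker_def ring_simprules)
  then show ?thesis using assms ker_add by (auto simp: cong_ker_def)
qed

lemma cong_mult: assumes "x \<doteq> y" "x' \<doteq> y'" shows "x \<otimes> x' \<doteq> y \<otimes> y'"
proof -
  have "(x \<otimes> x') \<ominus> (y \<otimes> y') = (x \<ominus> y) \<otimes> x' \<oplus> y \<otimes> (x' \<ominus> y')"
    using assms by (auto simp: cong_ker_def ring_simprules)
  then show ?thesis using assms ker_add ker_left_mult ker_right_mult by (auto simp: cong_ker_def)
qed

lemma cong_zero_iff: "x \<in> carrier R \<Longrightarrow> x \<doteq> \<zero> \<longleftrightarrow> x \<in> ker"
  by (simp add: cong_ker_def minus_eq)

lemmas cong_lmult = cong_mult[OF cong_refl]
lemmas cong_rmult = cong_mult[OF _ cong_refl]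

lemma dim_left_mult_ker:
  assumes "x \<in> carrier R" "s \<in> carrier R"
    and "\<And>r. r \<in> carrier R \<Longrightarrow> s \<otimes> (x \<otimes> r) = \<zero> \<Longrightarrow> x \<otimes> r \<in> ker"
  shows "w x = w (s \<otimes> x)"
proof -
  obtain z r where z: "z \<in> carrier R" "r \<in> carrier R" "z = x \<otimes> r" "s \<otimes> z = \<zero>"
      "w x = w (s \<otimes> x) \<otimes>\<^bsub>N\<^esub> w z"
    using dim_left_mult[OF assms(1,2)] by metis
  then have "z \<in> ker" using assms(3) by auto
  then show ?thesis using z(5) assms by (simp add: ker_def)
qed

lemma dim_right_mult_ker:
  assumes "y \<in> carrier R" "a \<in> carrier R"
    and "\<And>t. t \<in> carrier R \<Longrightarrow> t \<otimes> (y \<otimes> a) = y \<otimes> a \<Longrightarrow> t \<otimes> y \<doteq> y"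
  shows "w y = w (y \<otimes> a)"
proof -
  obtain t where t: "t \<in> carrier R" "t \<otimes> (y \<otimes> a) = y \<otimes> a"
      "w y = w (y \<otimes> a) \<otimes>\<^bsub>N\<^esub> w (y \<ominus> t \<otimes> y)"
    using dim_right_mult[OF assms(1,2)] by metis
  then have "y \<ominus> t \<otimes> y \<in> ker" using assms(3) cong_sym unfolding cong_ker_def by blast
  then show ?thesis using t(3) assms by (simp add: ker_def)
qed

lemma dim_left_mult_cong:
  assumes "x \<in> carrier R" "c \<in> carrier R" "d \<in> carrier R" "d \<otimes> (c \<otimes> x) \<doteq> x"
  shows "w x = w (c \<otimes> x)"
proof (rule dim_left_mult_ker)
  fix r assume r: "r \<in> carrier R" "c \<otimes> (x \<otimes> r) = \<zero>"
  have "d \<otimes> (c \<otimes> x) \<otimes> r = \<zero>" using r assms(1-3) by (simp add: m_assoc)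
  then show "x \<otimes> r \<in> ker" using cong_rmult[OF assms(4) r(1)] cong_sym cong_zero_iff r assms(1) by force
qed fact+

lemma dim_right_mult_cong:
  assumes "y \<in> carrier R" "a \<in> carrier R" "b \<in> carrier R" "y \<otimes> a \<otimes> b \<doteq> y"
  shows "w y = w (y \<otimes> a)"
proof (rule dim_right_mult_ker)
  fix t assume t: "t \<in> carrier R" "t \<otimes> (y \<otimes> a) = y \<otimes> a"
  have "t \<otimes> y \<doteq> t \<otimes> (y \<otimes> a \<otimes> b)" by (rule cong_lmult[OF t(1) cong_sym[OF assms(4)]])
  also have "t \<otimes> (y \<otimes> a \<otimes> b) = y \<otimes> a \<otimes> b" using t assms(1-3) by (metis m_assoc m_closed)
  also have "\<dots> \<doteq> y" by fact
  finally show "t \<otimes> y \<doteq> y" .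
qed fact+

text \<open>
  The algebraic quasi-ordering need not be antisymmetric, so it is not enough to bound the two
  values by each other.  Instead, both are equal to the value of \<open>yux\<close>, where \<open>u\<close> is a
  quasi-inverse of \<open>x\<close>: left multiplication by \<open>yu\<close> on \<open>xR\<close> and right multiplication by \<open>ux\<close> on
  \<open>y\<close> are invertible modulo the kernel.
\<close>

lemma dim_cong:
  assumes "x \<doteq> y"
  shows "w x = w y"
proof -
  have xy: "x \<in> carrier R" "y \<in> carrier R" using assms by (auto simp: cong_ker_def)
  obtain u where u: "u \<in> carrier R" "x \<otimes> u \<otimes> x = x" using quasi_inverse[OF xy(1)] by blast
  have yx: "y \<otimes> u \<otimes> x \<doteq> x"
    using cong_rmult[OF cong_rmult[OF cong_sym[OF assms] u(1)] xy(1)] u xy by simp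
  have "w x = w (y \<otimes> u \<otimes> x)"
  proof (rule dim_left_mult_cong[of _ _ "x \<otimes> u"])
    show "x \<otimes> u \<otimes> (y \<otimes> u \<otimes> x) \<doteq> x"
      using cong_lmult[OF _ yx, of "x \<otimes> u"] u xy by simp
  qed (use u xy in auto)
  moreover have "w y = w (y \<otimes> (u \<otimes> x))"
  proof (rule dim_right_mult_cong[of _ _ "u \<otimes> y"])
    have "y \<otimes> (u \<otimes> x) \<otimes> (u \<otimes> y) = (y \<otimes> u \<otimes> x) \<otimes> u \<otimes> y" using u(1) xy by (simp add: m_assoc)
    also have "\<dots> \<doteq> x \<otimes> u \<otimes> y" by (intro cong_rmult yx u xy)
    also have "\<dots> \<doteq> x \<otimes> u \<otimes> x" by (intro cong_lmult cong_sym[OF assms] m_closed u xy)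
    also have "x \<otimes> u \<otimes> x \<doteq> y" using u assms by simp
    finally show "y \<otimes> (u \<otimes> x) \<otimes> (u \<otimes> y) \<doteq> y" .
  qed (use u xy in auto)
  ultimately show ?thesis using u xy by (simp add: m_assoc)
qed

text \<open>
  An isomorphism of principal right ideals of the quotient by the kernel need not lift to an
  isomorphism, but it lifts to left multiplications that are inverse up to elements of value \<open>0\<close>.
\<close>

lemma dim_sim_cong:
  assumes "x \<in> carrier R" "y \<in> carrier R" "c \<in> carrier R" "d \<in> carrier R" "a \<in> carrier R" "b \<in> carrier R"
    and "c \<otimes> x \<doteq> y \<otimes> a" "d \<otimes> y \<doteq> x \<otimes> b" "d \<otimes> (c \<otimes> x) \<doteq> x" "c \<otimes> (d \<otimes> y) \<doteq> y"
  shows "w x = w y"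
proof -
  have "w x = w (c \<otimes> x)" by (rule dim_left_mult_cong) fact+
  also have "\<dots> = w (y \<otimes> a)" by (rule dim_cong) fact
  also have "\<dots> = w y"
  proof (rule dim_right_mult_cong[symmetric])
    have "y \<otimes> a \<otimes> b \<doteq> c \<otimes> x \<otimes> b" by (rule cong_rmult[OF cong_sym[OF assms(7)] assms(6)])
    also have "c \<otimes> x \<otimes> b = c \<otimes> (x \<otimes> b)" using assms(1-6) by (simp add: m_assoc)
    also have "\<dots> \<doteq> c \<otimes> (d \<otimes> y)" by (rule cong_lmult[OF assms(3) cong_sym[OF assms(8)]])
    also have "\<dots> \<doteq> y" by fact
    finally show "y \<otimes> a \<otimes> b \<doteq> y" .
  qed fact+
  finally show ?thesis .
qed

text \<open>
  Idempotents that are orthogonal modulo the kernel are replaced by honest orthogonal idempotents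
  \<open>g\<close> and \<open>h\<close>, where \<open>gR = xR\<close> and \<open>gR \<oplus> hR = xR + yR\<close>.  Modulo the kernel, \<open>hR\<close> is \<open>yR\<close> and
  \<open>(x + y)R\<close> is all of \<open>xR + yR\<close>.
\<close>

lemma dim_add_cong:
  assumes x: "x \<in> carrier R" and y: "y \<in> carrier R"
    and xx: "x \<otimes> x \<doteq> x" and yy: "y \<otimes> y \<doteq> y" and xy: "x \<otimes> y \<doteq> \<zero>" and yx: "y \<otimes> x \<doteq> \<zero>"
  shows "w (x \<oplus> y) = w x \<otimes>\<^bsub>N\<^esub> w y"
proof -
  obtain g u where g: "g \<in> carrier R" "u \<in> carrier R" "g \<otimes> g = g" "g = x \<otimes> u" "g \<otimes> x = x"
    using idempotent_generator[OF x] by blast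
  define v where "v = y \<ominus> g \<otimes> y"
  have v: "v \<in> carrier R" "v = (\<one> \<ominus> g) \<otimes> y" using y g(1) by (simp_all add: v_def ring_simprules)
  obtain h r where h: "h \<in> carrier R" "r \<in> carrier R" "h \<otimes> h = h" "g \<otimes> h = \<zero>" "h \<otimes> g = \<zero>"
    "h = v \<otimes> r" "h \<otimes> v = v" "(g \<oplus> h) \<otimes> y = y"
    using orthogonal_complement_idempotent[OF g(1,3) y] unfolding v_def by metis
  have wg: "w g = w x" by (rule dim_same_ideal[of _ _ u x]) (use g x in auto)
  have "w h = w v" by (rule dim_same_ideal[of _ _ r v]) (use h v in auto)
  also have "\<dots> = w y" unfolding v(2)
  proof (rule sym, rule dim_left_mult_ker)
    fix s assume s: "s \<in> carrier R" "(\<one> \<ominus> g) \<otimes> (y \<otimes> s) = \<zero>"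
    have "(\<one> \<ominus> g) \<otimes> (y \<otimes> s) = y \<otimes> s \<ominus> g \<otimes> (y \<otimes> s)" using s(1) g(1) y by (simp add: ring_simprules)
    then have ys: "y \<otimes> s = g \<otimes> (y \<otimes> s)" using s y g(1) by (metis m_closed minus_eq_zeroD)
    have "g \<otimes> (y \<otimes> s) = x \<otimes> (u \<otimes> (y \<otimes> s))" using g(2,4) s(1) x y by (simp add: m_assoc)
    also have "\<dots> \<doteq> x \<otimes> x \<otimes> (u \<otimes> (y \<otimes> s))"
      by (rule cong_rmult[OF cong_sym[OF xx]]) (use g s y in auto)
    also have "x \<otimes> x \<otimes> (u \<otimes> (y \<otimes> s)) = x \<otimes> (g \<otimes> (y \<otimes> s))"
      using g(2,4) s(1) x y by (simp add: m_assoc)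
    also have "\<dots> = x \<otimes> y \<otimes> s" using ys x y s(1) by (simp add: m_assoc)
    also have "\<dots> \<doteq> \<zero> \<otimes> s" by (rule cong_rmult) fact+
    finally have "y \<otimes> s \<doteq> \<zero>" using ys s by simp
    then show "y \<otimes> s \<in> ker" using cong_zero_iff y s by simp
  qed (use g y in auto)
  finally have wh: "w h = w y" .
  have "w (x \<oplus> y) = w (g \<oplus> h)"
  proof -
    have ghx: "(g \<oplus> h) \<otimes> x = x"
    proof -
      have "(g \<oplus> h) \<otimes> x = g \<otimes> x \<oplus> h \<otimes> (g \<otimes> x)" using g(1,5) h(1) x by (simp add: l_distr)
      also have "h \<otimes> (g \<otimes> x) = \<zero>" using g(1) h(1,5) x by (simp flip: m_assoc)
      finally show ?thesis using g(5) x by simp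
    qed
    have gh: "(g \<oplus> h) \<otimes> (x \<oplus> y) = x \<oplus> y" using ghx g(1) h(1,8) x y by (simp add: r_distr)
    have "w (g \<oplus> h) = w ((g \<oplus> h) \<otimes> (x \<oplus> y))"
    proof (rule dim_right_mult_ker)
      fix t assume t: "t \<in> carrier R" "t \<otimes> ((g \<oplus> h) \<otimes> (x \<oplus> y)) = (g \<oplus> h) \<otimes> (x \<oplus> y)"
      have tz: "t \<otimes> z \<doteq> z" if "z \<in> carrier R" "(x \<oplus> y) \<otimes> z \<doteq> z" for z
      proof -
        have "t \<otimes> z \<doteq> t \<otimes> ((x \<oplus> y) \<otimes> z)" by (rule cong_lmult[OF t(1) cong_sym[OF that(2)]])
        also have "t \<otimes> ((x \<oplus> y) \<otimes> z) = (x \<oplus> y) \<otimes> z" using t that(1) x y gh by (metis m_assoc a_closed)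
        also note that(2)
        finally show ?thesis .
      qed
      have "(x \<oplus> y) \<otimes> x \<doteq> x" using cong_add[OF xx yx] x y by (simp add: l_distr)
      then have tx: "t \<otimes> x \<doteq> x" using tz x by simp
      have "(x \<oplus> y) \<otimes> y \<doteq> y" using cong_add[OF xy yy] x y by (simp add: l_distr)
      then have ty: "t \<otimes> y \<doteq> y" using tz y by simp
      have tg: "t \<otimes> g \<doteq> g" using cong_rmult[OF tx g(2)] g(4) t x g(2) by (simp add: m_assoc)
      have hy: "h = y \<otimes> r \<ominus> g \<otimes> (y \<otimes> r)" using h(1,2,6) y g(1) by (simp add: v_def ring_simprules)
      have yr: "t \<otimes> (y \<otimes> r) \<doteq> y \<otimes> r" using cong_rmult[OF ty h(2)] t y h(2) by (simp add: m_assoc)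
      have gyr: "t \<otimes> (g \<otimes> (\<ominus> (y \<otimes> r))) \<doteq> g \<otimes> (\<ominus> (y \<otimes> r))"
        using cong_rmult[OF tg, of "\<ominus> (y \<otimes> r)"] t y h(2) g(1) by (simp add: m_assoc)
      have hy': "h = y \<otimes> r \<oplus> g \<otimes> (\<ominus> (y \<otimes> r))"
        using h(2) y g(1) by (subst hy) (simp add: minus_eq r_minus)
      have "t \<otimes> h \<doteq> h" 
        using cong_add[OF yr gyr] t h(2) y g(1) by (subst (1 2) hy') (simp add: r_distr)
      then show "t \<otimes> (g \<oplus> h) \<doteq> g \<oplus> h" using cong_add[OF tg] t h(1) g(1) by (simp add: r_distr)
    qed (use g h x y in auto)
    then show ?thesis using gh by simp
  qed
  also have "\<dots> = w g \<otimes>\<^bsub>N\<^esub> w h" by (rule dim_add) (use g h in auto)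
  finally show ?thesis using wg wh by simp
qed

end

section \<open>Right modules\<close>

definition submod :: "'r ring \<Rightarrow> ('r, 'a) module \<Rightarrow> 'a set \<Rightarrow> bool" where
  "submod R X K \<longleftrightarrow> K \<subseteq> carrier X \<and> \<zero>\<^bsub>X\<^esub> \<in> K \<and> (\<forall>x\<in>K. \<forall>y\<in>K. x \<oplus>\<^bsub>X\<^esub> y \<in> K) \<and>
    (\<forall>r\<in>carrier R. \<forall>x\<in>K. r \<odot>\<^bsub>X\<^esub> x \<in> K)"

lemma right_moduleI:
  fixes X :: "('r, 'a) module"
  assumes "ring R"
    and "\<And>x y. x \<in> carrier X \<Longrightarrow> y \<in> carrier X \<Longrightarrow> x \<oplus>\<^bsub>X\<^esub> y \<in> carrier X"
    and "\<zero>\<^bsub>X\<^esub> \<in> carrier X"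
    and "\<And>x y z. x \<in> carrier X \<Longrightarrow> y \<in> carrier X \<Longrightarrow> z \<in> carrier X \<Longrightarrow>
      (x \<oplus>\<^bsub>X\<^esub> y) \<oplus>\<^bsub>X\<^esub> z = x \<oplus>\<^bsub>X\<^esub> (y \<oplus>\<^bsub>X\<^esub> z)"
    and "\<And>x y. x \<in> carrier X \<Longrightarrow> y \<in> carrier X \<Longrightarrow> x \<oplus>\<^bsub>X\<^esub> y = y \<oplus>\<^bsub>X\<^esub> x"
    and "\<And>x. x \<in> carrier X \<Longrightarrow> \<zero>\<^bsub>X\<^esub> \<oplus>\<^bsub>X\<^esub> x = x"
    and "\<And>x. x \<in> carrier X \<Longrightarrow> \<exists>y\<in>carrier X. y \<oplus>\<^bsub>X\<^esub> x = \<zero>\<^bsub>X\<^esub>"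
    and "\<And>r x. r \<in> carrier R \<Longrightarrow> x \<in> carrier X \<Longrightarrow> r \<odot>\<^bsub>X\<^esub> x \<in> carrier X"
    and "\<And>r s x. r \<in> carrier R \<Longrightarrow> s \<in> carrier R \<Longrightarrow> x \<in> carrier X \<Longrightarrow>
        (r \<oplus>\<^bsub>R\<^esub> s) \<odot>\<^bsub>X\<^esub> x = r \<odot>\<^bsub>X\<^esub> x \<oplus>\<^bsub>X\<^esub> s \<odot>\<^bsub>X\<^esub> x"
    and "\<And>r x y. r \<in> carrier R \<Longrightarrow> x \<in> carrier X \<Longrightarrow> y \<in> carrier X \<Longrightarrow>
        r \<odot>\<^bsub>X\<^esub> (x \<oplus>\<^bsub>X\<^esub> y) = r \<odot>\<^bsub>X\<^esub> x \<oplus>\<^bsub>X\<^esub> r \<odot>\<^bsub>X\<^esub> y"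
    and "\<And>r s x. r \<in> carrier R \<Longrightarrow> s \<in> carrier R \<Longrightarrow> x \<in> carrier X \<Longrightarrow>
        (r \<otimes>\<^bsub>R\<^esub> s) \<odot>\<^bsub>X\<^esub> x = s \<odot>\<^bsub>X\<^esub> (r \<odot>\<^bsub>X\<^esub> x)"
    and "\<And>x. x \<in> carrier X \<Longrightarrow> \<one>\<^bsub>R\<^esub> \<odot>\<^bsub>X\<^esub> x = x"
  shows "right_module R X"
  by (intro right_module.intro right_module_axioms.intro abelian_groupI assms)

context right_module begin

lemma smult_r_zero [simp]: "r \<in> carrier R \<Longrightarrow> r \<odot>\<^bsub>M\<^esub> \<zero>\<^bsub>M\<^esub> = \<zero>\<^bsub>M\<^esub>"
  using smult_distr_module[of r "\<zero>\<^bsub>M\<^esub>" "\<zero>\<^bsub>M\<^esub>"] smult_closed[of r "\<zero>\<^bsub>M\<^esub>"] M.add.l_cancel_one'[of "r \<odot>\<^bsub>M\<^esub> \<zero>\<^bsub>M\<^esub>" "r \<odot>\<^bsub>M\<^esub> \<zero>\<^bsub>M\<^esub>"]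
  by simp

lemma smult_l_zero [simp]: "x \<in> carrier M \<Longrightarrow> \<zero>\<^bsub>R\<^esub> \<odot>\<^bsub>M\<^esub> x = \<zero>\<^bsub>M\<^esub>"
  using smult_distr_ring[of "\<zero>" "\<zero>" x] smult_closed[of "\<zero>" x] M.add.l_cancel_one'[of "\<zero> \<odot>\<^bsub>M\<^esub> x" "\<zero> \<odot>\<^bsub>M\<^esub> x"]
  by simp

lemma smult_minus_one: "x \<in> carrier M \<Longrightarrow> (\<ominus> \<one>) \<odot>\<^bsub>M\<^esub> x = \<ominus>\<^bsub>M\<^esub> x"
proof -
  assume x: "x \<in> carrier M"
  have "(\<ominus> \<one>) \<odot>\<^bsub>M\<^esub> x \<oplus>\<^bsub>M\<^esub> \<one> \<odot>\<^bsub>M\<^esub> x = \<zero>\<^bsub>M\<^esub>"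
    using smult_distr_ring[of "\<ominus> \<one>" \<one> x] x by (simp add: R.l_neg)
  then show ?thesis using x smult_one smult_closed M.minus_equality[of "(\<ominus> \<one>) \<odot>\<^bsub>M\<^esub> x" x] by simp
qed

end

lemma submod_minus:
  assumes "right_module R X" "submod R X K" "x \<in> K"
  shows "\<ominus>\<^bsub>X\<^esub> x \<in> K"
proof -
  interpret right_module R X by fact
  show ?thesis using assms(2,3) smult_minus_one[of x] unfolding submod_def
    by (metis R.add.inv_closed R.one_closed subsetD)
qed

lemma right_module_submod:
  assumes "right_module R X" "submod R X K"
  shows "right_module R (X\<lparr>carrier := K\<rparr>)"
proof -
  interpret right_module R X by fact
  have K: "\<And>x. x \<in> K \<Longrightarrow> x \<in> carrier X" using assms(2) by (auto simp: submod_def)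
  show ?thesis
  proof (rule right_moduleI)
    show "\<exists>y\<in>carrier (X\<lparr>carrier := K\<rparr>). y \<oplus>\<^bsub>X\<lparr>carrier := K\<rparr>\<^esub> x = \<zero>\<^bsub>X\<lparr>carrier := K\<rparr>\<^esub>"
      if "x \<in> carrier (X\<lparr>carrier := K\<rparr>)" for x
      using submod_minus[OF assms, of x] that K M.l_neg by auto
  qed (use assms(2) K in \<open>auto simp: submod_def M.a_ac smult_distr_ring smult_distr_module
      smult_assoc smult_one intro: R.ring_axioms\<close>)
qed

section \<open>Homomorphisms of right modules\<close>

lemma rmod_homI:
  assumes "\<And>x. x \<in> carrier X \<Longrightarrow> h x \<in> carrier Y"
    and "\<And>x y. x \<in> carrier X \<Longrightarrow> y \<in> carrier X \<Longrightarrow> h (x \<oplus>\<^bsub>X\<^esub> y) = h x \<oplus>\<^bsub>Y\<^esub> h y"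
    and "\<And>r x. r \<in> carrier R \<Longrightarrow> x \<in> carrier X \<Longrightarrow> h (r \<odot>\<^bsub>X\<^esub> x) = r \<odot>\<^bsub>Y\<^esub> h x"
  shows "h \<in> rmod_hom R X Y"
  using assms by (auto simp: rmod_hom_def)

lemma rmod_homD:
  assumes "h \<in> rmod_hom R X Y"
  shows "x \<in> carrier X \<Longrightarrow> h x \<in> carrier Y"
    and "x \<in> carrier X \<Longrightarrow> y \<in> carrier X \<Longrightarrow> h (x \<oplus>\<^bsub>X\<^esub> y) = h x \<oplus>\<^bsub>Y\<^esub> h y"
    and "r \<in> carrier R \<Longrightarrow> x \<in> carrier X \<Longrightarrow> h (r \<odot>\<^bsub>X\<^esub> x) = r \<odot>\<^bsub>Y\<^esub> h x"
  using assms by (auto simp: rmod_hom_def)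

lemma rmod_hom_id: "(\<lambda>x. x) \<in> rmod_hom R X X"
  by (auto simp: rmod_hom_def)

lemma rmod_hom_comp:
  "h \<in> rmod_hom R X Y \<Longrightarrow> k \<in> rmod_hom R Y Z \<Longrightarrow> (\<lambda>x. k (h x)) \<in> rmod_hom R X Z"
  by (rule rmod_homI) (simp_all add: rmod_homD)

lemma rmod_hom_zero:
  assumes "right_module R X" "right_module R Y" "h \<in> rmod_hom R X Y"
  shows "h \<zero>\<^bsub>X\<^esub> = \<zero>\<^bsub>Y\<^esub>"
proof -
  interpret X: right_module R X by fact
  interpret Y: right_module R Y by fact
  have "h (\<zero>\<^bsub>R\<^esub> \<odot>\<^bsub>X\<^esub> \<zero>\<^bsub>X\<^esub>) = \<zero>\<^bsub>R\<^esub> \<odot>\<^bsub>Y\<^esub> h \<zero>\<^bsub>X\<^esub>" by (rule rmod_homD(3)[OF assms(3)]) auto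
  then show ?thesis using rmod_homD(1)[OF assms(3)] by simp
qed

lemma submod_preimage:
  assumes "right_module R X" "right_module R Y" "h \<in> rmod_hom R X Y" "submod R Y K"
  shows "submod R X {x \<in> carrier X. h x \<in> K}"
proof -
  interpret X: right_module R X by fact
  show ?thesis using rmod_hom_zero[OF assms(1-3)] rmod_homD[OF assms(3)] assms(4) X.smult_closed
    by (auto simp: submod_def)
qed

lemma submod_zero: "right_module R X \<Longrightarrow> submod R X {\<zero>\<^bsub>X\<^esub>}"
proof -
  assume "right_module R X"
  then interpret right_module R X .
  show ?thesis by (auto simp: submod_def)
qed

lemma submod_kernel:
  assumes "right_module R X" "right_module R Y" "h \<in> rmod_hom R X Y"
  shows "submod R X {x \<in> carrier X. h x = \<zero>\<^bsub>Y\<^esub>}"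
  using submod_preimage[OF assms submod_zero[OF assms(2)]] by simp

lemma submod_image:
  assumes "right_module R X" "right_module R Y" "h \<in> rmod_hom R X Y"
  shows "submod R Y (h ` carrier X)"
proof -
  interpret X: right_module R X by fact
  have "\<zero>\<^bsub>Y\<^esub> \<in> h ` carrier X" using rmod_hom_zero[OF assms] by (metis X.M.zero_closed imageI)
  moreover have "h x \<oplus>\<^bsub>Y\<^esub> h y \<in> h ` carrier X" if "x \<in> carrier X" "y \<in> carrier X" for x y
    using that rmod_homD(2)[OF assms(3)] by (metis X.M.a_closed imageI)
  moreover have "r \<odot>\<^bsub>Y\<^esub> h x \<in> h ` carrier X" if "x \<in> carrier X" "r \<in> carrier R" for x r
    using that rmod_homD(3)[OF assms(3)] by (metis X.smult_closed imageI)
  ultimately show ?thesis using rmod_homD(1)[OF assms(3)] unfolding submod_def by auto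
qed

lemma rmod_isomorphic_refl: "rmod_isomorphic R X X"
  unfolding rmod_isomorphic_def by (rule bexI[OF _ rmod_hom_id]) (simp add: bij_betw_def)

lemma rmod_hom_inverse:
  assumes "right_module R X" "h \<in> rmod_hom R X Y" "bij_betw h (carrier X) (carrier Y)"
  shows "inv_into (carrier X) h \<in> rmod_hom R Y X"
proof -
  interpret X: right_module R X by fact
  have inj: "inj_on h (carrier X)" and im: "h ` carrier X = carrier Y"
    using assms(3) by (auto simp: bij_betw_def)
  let ?k = "inv_into (carrier X) h"
  have k: "?k y \<in> carrier X" "h (?k y) = y" if "y \<in> carrier Y" for y
    using that im by (auto simp: inv_into_into f_inv_into_f)
  have kk: "?k (h x) = x" if "x \<in> carrier X" for x using that inj by simp
  show ?thesis
  proof (rule rmod_homI)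
    show "?k (x \<oplus>\<^bsub>Y\<^esub> y) = ?k x \<oplus>\<^bsub>X\<^esub> ?k y" if "x \<in> carrier Y" "y \<in> carrier Y" for x y
      using kk[of "?k x \<oplus>\<^bsub>X\<^esub> ?k y"] rmod_homD(2)[OF assms(2), of "?k x" "?k y"] that k by simp
    show "?k (r \<odot>\<^bsub>Y\<^esub> y) = r \<odot>\<^bsub>X\<^esub> ?k y" if "r \<in> carrier R" "y \<in> carrier Y" for r y
      using kk[of "r \<odot>\<^bsub>X\<^esub> ?k y"] rmod_homD(3)[OF assms(2), of r "?k y"] that k X.smult_closed by simp
  qed (use k in auto)
qed

lemma rmod_isomorphic_sym:
  assumes "right_module R X" "rmod_isomorphic R X Y"
  shows "rmod_isomorphic R Y X"
  using assms rmod_hom_inverse bij_betw_inv_into unfolding rmod_isomorphic_def by blast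

lemma rmod_isomorphic_trans:
  assumes "rmod_isomorphic R X Y" "rmod_isomorphic R Y Z"
  shows "rmod_isomorphic R X Z"
proof -
  obtain h k where "h \<in> rmod_hom R X Y" "bij_betw h (carrier X) (carrier Y)"
    "k \<in> rmod_hom R Y Z" "bij_betw k (carrier Y) (carrier Z)"
    using assms by (auto simp: rmod_isomorphic_def)
  then have "k \<circ> h \<in> rmod_hom R X Z" "bij_betw (k \<circ> h) (carrier X) (carrier Z)"
    using rmod_hom_comp[of h R X Y k Z] bij_betw_trans by (auto simp: o_def)
  then show ?thesis unfolding rmod_isomorphic_def by blast
qed

lemma rmod_isomorphicI:
  assumes "h \<in> rmod_hom R X Y" "k \<in> rmod_hom R Y X"
    and "\<And>x. x \<in> carrier X \<Longrightarrow> k (h x) = x" "\<And>y. y \<in> carrier Y \<Longrightarrow> h (k y) = y"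
  shows "rmod_isomorphic R X Y"
  unfolding rmod_isomorphic_def
  by (rule bexI[OF _ assms(1)], rule bij_betwI[of _ _ _ k])
    (use assms rmod_homD(1)[OF assms(1)] rmod_homD(1)[OF assms(2)] in auto)

lemma rmod_isomorphicE:
  assumes "right_module R X" "rmod_isomorphic R X Y"
  obtains h k where "h \<in> rmod_hom R X Y" "k \<in> rmod_hom R Y X"
    "\<And>x. x \<in> carrier X \<Longrightarrow> k (h x) = x" "\<And>y. y \<in> carrier Y \<Longrightarrow> h (k y) = y"
proof -
  obtain h where h: "h \<in> rmod_hom R X Y" "bij_betw h (carrier X) (carrier Y)"
    using assms(2) by (auto simp: rmod_isomorphic_def)
  show thesis
    by (rule that[OF h(1) rmod_hom_inverse[OF assms(1) h]])
      (use h in \<open>auto simp: bij_betw_def f_inv_into_f\<close>)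
qed

section \<open>Direct sums and ideals\<close>

lemma carrier_direct_sum [simp]: "carrier (direct_sum X Y) = carrier X \<times> carrier Y"
  and zero_direct_sum [simp]: "\<zero>\<^bsub>direct_sum X Y\<^esub> = (\<zero>\<^bsub>X\<^esub>, \<zero>\<^bsub>Y\<^esub>)"
  and add_direct_sum [simp]: "(x, y) \<oplus>\<^bsub>direct_sum X Y\<^esub> (x', y') = (x \<oplus>\<^bsub>X\<^esub> x', y \<oplus>\<^bsub>Y\<^esub> y')"
  and smult_direct_sum [simp]: "r \<odot>\<^bsub>direct_sum X Y\<^esub> (x, y) = (r \<odot>\<^bsub>X\<^esub> x, r \<odot>\<^bsub>Y\<^esub> y)"
  by (simp_all add: direct_sum_def)

lemma right_module_direct_sum:
  assumes "right_module R X" "right_module R Y"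
  shows "right_module R (direct_sum X Y)"
proof -
  interpret X: right_module R X by fact
  interpret Y: right_module R Y by fact
  show ?thesis
  proof (rule right_moduleI)
    show "\<exists>y\<in>carrier (direct_sum X Y). y \<oplus>\<^bsub>direct_sum X Y\<^esub> x = \<zero>\<^bsub>direct_sum X Y\<^esub>"
      if "x \<in> carrier (direct_sum X Y)" for x
      using that by (intro bexI[of _ "(\<ominus>\<^bsub>X\<^esub> fst x, \<ominus>\<^bsub>Y\<^esub> snd x)"]) (auto simp: X.M.l_neg Y.M.l_neg)
  qed (auto simp: X.M.a_ac X.smult_distr_ring X.smult_distr_module X.smult_assoc X.smult_one X.smult_closed
        Y.M.a_ac Y.smult_distr_ring Y.smult_distr_module Y.smult_assoc Y.smult_one Y.smult_closed
        intro: X.R.ring_axioms)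
qed

lemma rmod_hom_fst: "fst \<in> rmod_hom R (direct_sum X Y) X"
  and rmod_hom_snd: "snd \<in> rmod_hom R (direct_sum X Y) Y"
  by (rule rmod_homI; auto)+

lemma rmod_hom_Pair1:
  assumes "right_module R X" "right_module R Y"
  shows "(\<lambda>x. (x, \<zero>\<^bsub>Y\<^esub>)) \<in> rmod_hom R X (direct_sum X Y)"
proof -
  interpret Y: right_module R Y by fact
  show ?thesis by (rule rmod_homI) auto
qed

lemma rmod_hom_Pair2:
  assumes "right_module R X" "right_module R Y"
  shows "(\<lambda>y. (\<zero>\<^bsub>X\<^esub>, y)) \<in> rmod_hom R Y (direct_sum X Y)"
proof -
  interpret X: right_module R X by fact
  show ?thesis by (rule rmod_homI) auto
qed

lemma rmod_hom_into_direct_sum: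
  "h \<in> rmod_hom R Z X \<Longrightarrow> k \<in> rmod_hom R Z Y \<Longrightarrow> (\<lambda>z. (h z, k z)) \<in> rmod_hom R Z (direct_sum X Y)"
  by (rule rmod_homI) (simp_all add: rmod_homD)

lemma direct_sum_iso_mono:
  assumes "right_module R X" "right_module R Y" "rmod_isomorphic R X X'" "rmod_isomorphic R Y Y'"
  shows "rmod_isomorphic R (direct_sum X Y) (direct_sum X' Y')"
proof -
  obtain h k where h: "h \<in> rmod_hom R X X'" "k \<in> rmod_hom R X' X"
    "\<And>x. x \<in> carrier X \<Longrightarrow> k (h x) = x" "\<And>y. y \<in> carrier X' \<Longrightarrow> h (k y) = y"
    by (rule rmod_isomorphicE[OF assms(1,3)]) blast
  obtain h' k' where h': "h' \<in> rmod_hom R Y Y'" "k' \<in> rmod_hom R Y' Y"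
    "\<And>x. x \<in> carrier Y \<Longrightarrow> k' (h' x) = x" "\<And>y. y \<in> carrier Y' \<Longrightarrow> h' (k' y) = y"
    by (rule rmod_isomorphicE[OF assms(2,4)]) blast
  show ?thesis
    by (rule rmod_isomorphicI[of "\<lambda>z. (h (fst z), h' (snd z))" _ _ _ "\<lambda>z. (k (fst z), k' (snd z))"])
      (use h h' in \<open>auto intro!: rmod_hom_into_direct_sum rmod_hom_comp[OF rmod_hom_fst] rmod_hom_comp[OF rmod_hom_snd]\<close>)
qed

lemma direct_sum_comm: "rmod_isomorphic R (direct_sum X Y) (direct_sum Y X)"
  by (rule rmod_isomorphicI[of "\<lambda>z. (snd z, fst z)" _ _ _ "\<lambda>z. (snd z, fst z)"])
    (auto intro!: rmod_hom_into_direct_sum rmod_hom_fst rmod_hom_snd)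

lemma direct_sum_assoc:
  "rmod_isomorphic R (direct_sum (direct_sum X Y) Z) (direct_sum X (direct_sum Y Z))"
  by (rule rmod_isomorphicI[of "\<lambda>z. (fst (fst z), snd (fst z), snd z)" _ _ _ "\<lambda>z. ((fst z, fst (snd z)), snd (snd z))"])
    (auto intro!: rmod_hom_into_direct_sum rmod_hom_comp[OF rmod_hom_fst] rmod_hom_comp[OF rmod_hom_snd]
        rmod_hom_fst rmod_hom_snd)

lemma carrier_right_ideal [simp]: "carrier (right_ideal_module R I) = I"
  and zero_right_ideal [simp]: "\<zero>\<^bsub>right_ideal_module R I\<^esub> = \<zero>\<^bsub>R\<^esub>"
  and add_right_ideal [simp]: "x \<oplus>\<^bsub>right_ideal_module R I\<^esub> y = x \<oplus>\<^bsub>R\<^esub> y"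
  and smult_right_ideal [simp]: "r \<odot>\<^bsub>right_ideal_module R I\<^esub> x = x \<otimes>\<^bsub>R\<^esub> r"
  by (simp_all add: right_ideal_module_def)

lemma carrier_update_right_ideal [simp]:
  "(right_ideal_module R I)\<lparr>carrier := J\<rparr> = right_ideal_module R J"
  by (simp add: right_ideal_module_def)

abbreviation (input) pideal :: "'r ring \<Rightarrow> 'r \<Rightarrow> 'r set" where
  "pideal R x \<equiv> (\<lambda>r. x \<otimes>\<^bsub>R\<^esub> r) ` carrier R"

context vn_regular begin

lemma right_module_regular: "right_module R (regular_rmod R)"
proof (rule right_moduleI)
  show "\<exists>y\<in>carrier (regular_rmod R). y \<oplus>\<^bsub>regular_rmod R\<^esub> x = \<zero>\<^bsub>regular_rmod R\<^esub>"
    if "x \<in> carrier (regular_rmod R)" for x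
    using that l_neg by (intro bexI[of _ "\<ominus> x"]) auto
qed (auto simp: a_ac l_distr r_distr m_assoc intro: ring_axioms)

lemma submod_pideal: "x \<in> carrier R \<Longrightarrow> submod R (regular_rmod R) (pideal R x)"
  by (auto simp: submod_def m_assoc simp flip: r_distr intro: image_eqI[of _ _ "\<zero>"])

lemma right_module_principal: "x \<in> carrier R \<Longrightarrow> right_module R (principal_rmod R x)"
  using right_module_submod[OF right_module_regular submod_pideal] by simp

lemma rmod_hom_left_mult: 
  assumes "c \<in> carrier R" "I \<subseteq> carrier R" "\<And>x. x \<in> I \<Longrightarrow> c \<otimes> x \<in> J"
  shows "(\<lambda>x. c \<otimes> x) \<in> rmod_hom R (right_ideal_module R I) (right_ideal_module R J)"
  by (rule rmod_homI) (use assms in \<open>auto simp: r_distr subset_eq m_assoc\<close>)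

end

section \<open>Finite generation\<close>

lemma finsum_submod:
  assumes "right_module R M" "submod R M K" "finite S" "\<And>s. s \<in> S \<Longrightarrow> f s \<in> K"
  shows "finsum M f S \<in> K"
proof -
  interpret right_module R M by fact
  show ?thesis
  using assms(3,4)
proof (induction S)
  case empty
  then show ?case using assms(2) by (simp add: submod_def)
next
  case (insert a S)
  have "K \<subseteq> carrier M" using assms(2) by (simp add: submod_def)
  then have "finsum M f (insert a S) = f a \<oplus>\<^bsub>M\<^esub> finsum M f S"
    using insert by (intro M.finsum_insert) auto
  then show ?case using insert assms(2) by (simp add: submod_def)
qed
qed

lemma (in right_module) smult_finsum:
  assumes "finite S" "f \<in> S \<rightarrow> carrier M" "r \<in> carrier R"
  shows "r \<odot>\<^bsub>M\<^esub> finsum M f S = (\<Oplus>\<^bsub>M\<^esub>s\<in>S. r \<odot>\<^bsub>M\<^esub> f s)"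
  using assms(1,2)
proof (induction S)
  case (insert a S)
  then show ?case using assms(3) smult_closed
    by (subst (1 2) M.finsum_insert) (auto simp: smult_distr_module Pi_iff)
qed (simp add: assms)

text \<open>
  In this form finite generation involves no sums, and passes to images and direct sums by taking
  preimages of submodules.
\<close>

lemma finitely_generated_iff:
  fixes X :: "('r, 'a) module"
  assumes "right_module R X"
  shows "finitely_generated R X \<longleftrightarrow>
    (\<exists>S. finite S \<and> S \<subseteq> carrier X \<and> (\<forall>K. submod R X K \<longrightarrow> S \<subseteq> K \<longrightarrow> carrier X \<subseteq> K))"
    (is "_ \<longleftrightarrow> ?rhs")
proof
  interpret right_module R X by fact
  assume "finitely_generated R X"
  then obtain S where S: "finite S" "S \<subseteq> carrier X"
    "\<And>x. x \<in> carrier X \<Longrightarrow> \<exists>c\<in>S \<rightarrow> carrier R. x = (\<Oplus>\<^bsub>X\<^esub>s\<in>S. c s \<odot>\<^bsub>X\<^esub> s)"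
    unfolding finitely_generated_def by blast
  have "carrier X \<subseteq> K" if "submod R X K" "S \<subseteq> K" for K
  proof
    fix x assume "x \<in> carrier X"
    then obtain c where "c \<in> S \<rightarrow> carrier R" "x = (\<Oplus>\<^bsub>X\<^esub>s\<in>S. c s \<odot>\<^bsub>X\<^esub> s)" using S(3) by blast
    moreover have "c s \<odot>\<^bsub>X\<^esub> s \<in> K" if "s \<in> S" for s
      using calculation(1) that \<open>S \<subseteq> K\<close> \<open>submod R X K\<close> unfolding submod_def by blast
    ultimately show "x \<in> K" using finsum_submod[OF assms that(1) S(1)] by auto
  qed
  then show ?rhs using S(1,2) by blast
next
  interpret right_module R X by fact
  assume ?rhs
  then obtain S where S: "finite S" "S \<subseteq> carrier X"
    and gen: "\<And>K. submod R X K \<Longrightarrow> S \<subseteq> K \<Longrightarrow> carrier X \<subseteq> K" by blast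
  let ?l = "\<lambda>c. \<Oplus>\<^bsub>X\<^esub>s\<in>S. c s \<odot>\<^bsub>X\<^esub> s"
  let ?C = "?l ` (S \<rightarrow> carrier R)"
  have cl: "(\<lambda>s. c s \<odot>\<^bsub>X\<^esub> s) \<in> S \<rightarrow> carrier X" if "c \<in> S \<rightarrow> carrier R" for c
    using that S(2) smult_closed by auto
  have "submod R X ?C"
    unfolding submod_def
  proof (intro conjI ballI)
    show "?C \<subseteq> carrier X" using cl by (auto intro!: M.finsum_closed)
    have "?l (\<lambda>_. \<zero>\<^bsub>R\<^esub>) = (\<Oplus>\<^bsub>X\<^esub>s\<in>S. \<zero>\<^bsub>X\<^esub>)"
      by (rule M.finsum_cong') (use S(2) in auto)
    then show "\<zero>\<^bsub>X\<^esub> \<in> ?C" by (intro image_eqI[of _ _ "\<lambda>_. \<zero>\<^bsub>R\<^esub>"]) auto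
  next
    fix x y assume "x \<in> ?C" "y \<in> ?C"
    then obtain c d where c: "c \<in> S \<rightarrow> carrier R" "x = ?l c" and d: "d \<in> S \<rightarrow> carrier R" "y = ?l d"
      by blast
    have "?l (\<lambda>s. c s \<oplus>\<^bsub>R\<^esub> d s) = (\<Oplus>\<^bsub>X\<^esub>s\<in>S. c s \<odot>\<^bsub>X\<^esub> s \<oplus>\<^bsub>X\<^esub> d s \<odot>\<^bsub>X\<^esub> s)"
      by (rule M.finsum_cong') (use S(2) c d smult_closed in \<open>auto simp: smult_distr_ring Pi_iff subset_iff\<close>)
    also have "\<dots> = x \<oplus>\<^bsub>X\<^esub> y" using cl[OF c(1)] cl[OF d(1)] c d by (simp add: M.finsum_addf)
    finally show "x \<oplus>\<^bsub>X\<^esub> y \<in> ?C" using c d by (intro image_eqI[of _ _ "\<lambda>s. c s \<oplus>\<^bsub>R\<^esub> d s"]) auto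
  next
    fix r x assume r: "r \<in> carrier R" and "x \<in> ?C"
    then obtain c where c: "c \<in> S \<rightarrow> carrier R" "x = ?l c" by blast
    have "?l (\<lambda>s. c s \<otimes>\<^bsub>R\<^esub> r) = (\<Oplus>\<^bsub>X\<^esub>s\<in>S. r \<odot>\<^bsub>X\<^esub> (c s \<odot>\<^bsub>X\<^esub> s))"
      by (rule M.finsum_cong') (use S(2) c r smult_closed in \<open>auto simp: smult_assoc Pi_iff subset_iff\<close>)
    also have "\<dots> = r \<odot>\<^bsub>X\<^esub> x" using cl[OF c(1)] c r S(1) by (simp add: smult_finsum)
    finally show "r \<odot>\<^bsub>X\<^esub> x \<in> ?C" using c r by (intro image_eqI[of _ _ "\<lambda>s. c s \<otimes>\<^bsub>R\<^esub> r"]) auto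
  qed
  moreover have "S \<subseteq> ?C"
  proof
    fix s assume s: "s \<in> S"
    let ?c = "\<lambda>t. if s = t then \<one>\<^bsub>R\<^esub> else \<zero>\<^bsub>R\<^esub>"
    have "?l ?c = (\<Oplus>\<^bsub>X\<^esub>t\<in>S. if s = t then t else \<zero>\<^bsub>X\<^esub>)"
      by (rule M.finsum_cong') (use S(2) s smult_one in auto)
    also have "\<dots> = s" by (rule M.finsum_singleton) (use S s in auto)
    finally show "s \<in> ?C" by (intro image_eqI[of _ _ ?c]) auto
  qed
  ultimately have "carrier X \<subseteq> ?C" by (rule gen)
  then show "finitely_generated R X" unfolding finitely_generated_def using S by blast
qed

lemma finitely_generated_image:
  assumes "right_module R X" "right_module R Y" "h \<in> rmod_hom R X Y" "h ` carrier X = carrier Y"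
    and "finitely_generated R X"
  shows "finitely_generated R Y"
proof -
  obtain S where S: "finite S" "S \<subseteq> carrier X" and
    gen: "\<And>K. submod R X K \<Longrightarrow> S \<subseteq> K \<Longrightarrow> carrier X \<subseteq> K"
    using assms(5) finitely_generated_iff[OF assms(1)] by blast
  have "carrier Y \<subseteq> K" if "submod R Y K" "h ` S \<subseteq> K" for K
  proof -
    have "S \<subseteq> {x \<in> carrier X. h x \<in> K}" using that(2) S(2) by auto
    then have "carrier X \<subseteq> {x \<in> carrier X. h x \<in> K}"
      by (rule gen[OF submod_preimage[OF assms(1-3) that(1)]])
    then show ?thesis unfolding assms(4)[symmetric] by auto
  qed
  then show ?thesis unfolding finitely_generated_iff[OF assms(2)]
    using S rmod_homD(1)[OF assms(3)] by (intro exI[of _ "h ` S"]) auto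
qed

lemma finitely_generated_direct_sum:
  assumes X: "right_module R X" and Y: "right_module R Y"
    and "finitely_generated R X" "finitely_generated R Y"
  shows "finitely_generated R (direct_sum X Y)"
proof -
  interpret X: right_module R X by fact
  interpret Y: right_module R Y by fact
  obtain S where S: "finite S" "S \<subseteq> carrier X" and
    gS: "\<And>K. submod R X K \<Longrightarrow> S \<subseteq> K \<Longrightarrow> carrier X \<subseteq> K"
    using assms(3) finitely_generated_iff[OF X] by blast
  obtain T where T: "finite T" "T \<subseteq> carrier Y" and
    gT: "\<And>K. submod R Y K \<Longrightarrow> T \<subseteq> K \<Longrightarrow> carrier Y \<subseteq> K"
    using assms(4) finitely_generated_iff[OF Y] by blast
  let ?S = "(\<lambda>x. (x, \<zero>\<^bsub>Y\<^esub>)) ` S \<union> (\<lambda>y. (\<zero>\<^bsub>X\<^esub>, y)) ` T"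
  have "carrier (direct_sum X Y) \<subseteq> K" if K: "submod R (direct_sum X Y) K" "?S \<subseteq> K" for K
  proof -
    have 1: "carrier X \<subseteq> {x \<in> carrier X. (x, \<zero>\<^bsub>Y\<^esub>) \<in> K}"
      using K S(2) by (intro gS submod_preimage[OF X right_module_direct_sum rmod_hom_Pair1] X Y) auto
    have 2: "carrier Y \<subseteq> {y \<in> carrier Y. (\<zero>\<^bsub>X\<^esub>, y) \<in> K}"
      using K T(2) by (intro gT submod_preimage[OF Y right_module_direct_sum rmod_hom_Pair2] X Y) auto
    have "(x, y) \<in> K" if "x \<in> carrier X" "y \<in> carrier Y" for x y
    proof -
      have "(x, \<zero>\<^bsub>Y\<^esub>) \<oplus>\<^bsub>direct_sum X Y\<^esub> (\<zero>\<^bsub>X\<^esub>, y) \<in> K"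
        using 1 2 that K(1) unfolding submod_def by blast
      then show ?thesis using that by simp
    qed
    then show ?thesis by auto
  qed
  then show ?thesis unfolding finitely_generated_iff[OF right_module_direct_sum[OF X Y]]
    using S T by (intro exI[of _ ?S]) auto
qed

section \<open>Functionals and their kernels\<close>

abbreviation functionals :: "'r ring \<Rightarrow> ('r, 'a) module \<Rightarrow> ('a \<Rightarrow> 'r) set" where
  "functionals R X \<equiv> rmod_hom R X (regular_rmod R)"

text \<open>
  Kernels keep the type of the module, so that taking kernels can be iterated.
\<close>

definition kernel :: "'r ring \<Rightarrow> ('r, 'a) module \<Rightarrow> ('a \<Rightarrow> 'r) \<Rightarrow> ('r, 'a) module" where
  "kernel R X l = X\<lparr>carrier := {x \<in> carrier X. l x = \<zero>\<^bsub>R\<^esub>}\<rparr>"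

lemma kernel_simps [simp]:
  "carrier (kernel R X l) = {x \<in> carrier X. l x = \<zero>\<^bsub>R\<^esub>}"
  "\<zero>\<^bsub>kernel R X l\<^esub> = \<zero>\<^bsub>X\<^esub>" "x \<oplus>\<^bsub>kernel R X l\<^esub> y = x \<oplus>\<^bsub>X\<^esub> y" "r \<odot>\<^bsub>kernel R X l\<^esub> x = r \<odot>\<^bsub>X\<^esub> x"
  by (simp_all add: kernel_def)

lemma functionals_kernel: "k \<in> functionals R X \<Longrightarrow> k \<in> functionals R (kernel R X l)"
  by (auto simp: rmod_hom_def)

context vn_regular begin

lemma finitely_generated_principal:
  assumes x: "x \<in> carrier R"
  shows "finitely_generated R (principal_rmod R x)"
proof -
  have "pideal R x \<subseteq> K" if "submod R (principal_rmod R x) K" "x \<in> K" for K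
    using that by (auto simp: submod_def)
  then show ?thesis unfolding finitely_generated_iff[OF right_module_principal[OF x]]
    using x by (intro exI[of _ "{x}"]) (auto intro: image_eqI[of _ _ \<one>])
qed

text \<open>
  Each new element \<open>t\<close> enlarges the idempotent \<open>g\<close> by an orthogonal idempotent generating
  \<open>(t - gt)R\<close>.
\<close>

lemma finite_subset_ideal_idempotent:
  assumes J: "submod R (regular_rmod R) J" and T: "finite T" "T \<subseteq> J"
  shows "\<exists>g\<in>J. g \<otimes> g = g \<and> (\<forall>t\<in>T. g \<otimes> t = t)"
  using T
proof (induction T)
  case empty
  then show ?case using J by (intro bexI[of _ \<zero>]) (auto simp: submod_def)
next
  case (insert t T)
  then obtain g where g: "g \<in> J" "g \<otimes> g = g" "\<And>t. t \<in> T \<Longrightarrow> g \<otimes> t = t" by auto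
  have JR: "\<And>z. z \<in> J \<Longrightarrow> z \<in> carrier R" using J by (auto simp: submod_def)
  have t: "t \<in> J" using insert by simp
  have gc: "g \<in> carrier R" and tc: "t \<in> carrier R" using g t JR by auto
  obtain h r where h: "h \<in> carrier R" "r \<in> carrier R" "h \<otimes> g = \<zero>"
    "h = (t \<ominus> g \<otimes> t) \<otimes> r" "(g \<oplus> h) \<otimes> t = t" "(g \<oplus> h) \<otimes> (g \<oplus> h) = g \<oplus> h"
    using orthogonal_complement_idempotent[OF gc g(2) tc] by metis
  have mJ: "z \<otimes> r \<in> J" if "z \<in> J" "r \<in> carrier R" for z r using J that by (auto simp: submod_def)
  have aJ: "z \<oplus> z' \<in> J" if "z \<in> J" "z' \<in> J" for z z' using J that by (auto simp: submod_def)
  have "t \<ominus> g \<otimes> t = t \<oplus> g \<otimes> (\<ominus> t)" using gc tc by (simp add: minus_eq r_minus)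
  then have "g \<oplus> h \<in> J" using g t tc h(2,4) by (auto intro!: mJ aJ)
  moreover have "(g \<oplus> h) \<otimes> s = s" if s: "s \<in> T" for s
  proof -
    have sc: "s \<in> carrier R" using s insert JR by auto
    have "h \<otimes> (g \<otimes> s) = \<zero>" using h gc sc by (simp flip: m_assoc)
    then show ?thesis using g(3)[OF s] gc sc h(1) by (simp add: l_distr)
  qed
  ultimately show ?case using h(5,6) by auto
qed

text \<open>
  The values of a functional on generators of \<open>X\<close> lie in \<open>gR\<close> for some idempotent \<open>g\<close> in the image.
  The element \<open>y\<close> provides a section of the functional over \<open>gR\<close>, namely \<open>r \<mapsto> yr\<close>.
\<close>

lemma functional_image_principal:
  assumes X: "right_module R X" and fg: "finitely_generated R X" and l: "l \<in> functionals R X"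
  obtains g y where "g \<in> carrier R" "g \<otimes> g = g" "l ` carrier X = pideal R g"
    "y \<in> carrier X" "l y = g" "g \<odot>\<^bsub>X\<^esub> y = y"
proof -
  interpret X: right_module R X by fact
  let ?J = "l ` carrier X"
  have J: "submod R (regular_rmod R) ?J" by (rule submod_image[OF X right_module_regular l])
  obtain S where S: "finite S" "S \<subseteq> carrier X" and
    gen: "\<And>K. submod R X K \<Longrightarrow> S \<subseteq> K \<Longrightarrow> carrier X \<subseteq> K"
    using fg finitely_generated_iff[OF X] by blast
  obtain g where g: "g \<in> ?J" "g \<otimes> g = g" "\<And>s. s \<in> S \<Longrightarrow> g \<otimes> l s = l s"
    using finite_subset_ideal_idempotent[OF J, of "l ` S"] S by auto
  have gc: "g \<in> carrier R" using g J by (auto simp: submod_def)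
  have lc: "l s \<in> carrier R" if "s \<in> carrier X" for s using rmod_homD(1)[OF l that] by simp
  have "carrier X \<subseteq> {x \<in> carrier X. l x \<in> pideal R g}"
  proof (rule gen[OF submod_preimage[OF X right_module_regular l submod_pideal[OF gc]]])
    show "S \<subseteq> {x \<in> carrier X. l x \<in> pideal R g}" 
    proof
      fix s assume s: "s \<in> S"
      then have "l s = g \<otimes> l s" "l s \<in> carrier R" "s \<in> carrier X" using S(2) g(3) lc by auto
      then show "s \<in> {x \<in> carrier X. l x \<in> pideal R g}" by blast
    qed
  qed
  then have "?J \<subseteq> pideal R g" by auto
  moreover have "pideal R g \<subseteq> ?J" using J g(1) by (auto simp: submod_def)
  ultimately have im: "?J = pideal R g" by blast
  obtain y where y: "y \<in> carrier X" "l y = g" using g(1) by auto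
  show thesis
  proof (rule that[OF gc g(2) im])
    show "l (g \<odot>\<^bsub>X\<^esub> y) = g" using rmod_homD(3)[OF l gc y(1)] y g by simp
    show "g \<odot>\<^bsub>X\<^esub> (g \<odot>\<^bsub>X\<^esub> y) = g \<odot>\<^bsub>X\<^esub> y" using X.smult_assoc[OF gc gc y(1)] g by simp
    show "g \<odot>\<^bsub>X\<^esub> y \<in> carrier X" using X.smult_closed gc y by simp
  qed
qed

lemma right_module_kernel:
  "right_module R X \<Longrightarrow> l \<in> functionals R X \<Longrightarrow> right_module R (kernel R X l)"
  unfolding kernel_def using right_module_submod submod_kernel[OF _ right_module_regular] by fastforce

text \<open>
  The map \<open>v \<mapsto> v - y l(v)\<close> is the projection onto the kernel along \<open>yR\<close>.
\<close>

lemma kernel_splitting: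
  assumes X: "right_module R X" and l: "l \<in> functionals R X"
    and y: "y \<in> carrier X" "l y \<odot>\<^bsub>X\<^esub> y = y" "l ` carrier X = pideal R (l y)"
  shows "(\<lambda>v. v \<ominus>\<^bsub>X\<^esub> l v \<odot>\<^bsub>X\<^esub> y) \<in> rmod_hom R X (kernel R X l)"
    and "v \<in> carrier (kernel R X l) \<Longrightarrow> v \<ominus>\<^bsub>X\<^esub> l v \<odot>\<^bsub>X\<^esub> y = v"
    and "rmod_isomorphic R X (direct_sum (principal_rmod R (l y)) (kernel R X l))"
proof -
  interpret X: right_module R X by fact
  have lX: "l v \<in> carrier R" if "v \<in> carrier X" for v using rmod_homD(1)[OF l that] by simp
  note [simp] = lX X.smult_closed
  have la: "l (v \<oplus>\<^bsub>X\<^esub> v') = l v \<oplus> l v'" if "v \<in> carrier X" "v' \<in> carrier X" for v v'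
    using rmod_homD(2)[OF l] that by simp
  have ls: "l (r \<odot>\<^bsub>X\<^esub> v) = l v \<otimes> r" if "v \<in> carrier X" "r \<in> carrier R" for v r
    using rmod_homD(3)[OF l] that by simp
  have lm: "l (\<ominus>\<^bsub>X\<^esub> v) = \<ominus> l v" if "v \<in> carrier X" for v
    using ls[OF that, of "\<ominus> \<one>"] X.smult_minus_one that by (simp add: r_minus)
  have gl: "l y \<otimes> l v = l v" if "v \<in> carrier X" for v
  proof -
    have "l y \<otimes> l y = l y" using ls[of y "l y"] y by simp
    moreover obtain r where "r \<in> carrier R" "l v = l y \<otimes> r" using y(3) \<open>v \<in> carrier X\<close> by auto
    ultimately show ?thesis using y by (simp flip: m_assoc)
  qed
  let ?q = "\<lambda>v. v \<ominus>\<^bsub>X\<^esub> l v \<odot>\<^bsub>X\<^esub> y"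
  show q: "?q \<in> rmod_hom R X (kernel R X l)"
  proof (rule rmod_homI)
    show "?q v \<in> carrier (kernel R X l)" if "v \<in> carrier X" for v
      using that y gl by (simp add: X.M.minus_eq la lm ls r_neg)
    show "?q (v \<oplus>\<^bsub>X\<^esub> v') = ?q v \<oplus>\<^bsub>kernel R X l\<^esub> ?q v'" if "v \<in> carrier X" "v' \<in> carrier X" for v v'
      using that y by (simp add: la X.smult_distr_ring X.M.minus_eq X.M.minus_add X.M.a_ac)
    show "?q (r \<odot>\<^bsub>X\<^esub> v) = r \<odot>\<^bsub>kernel R X l\<^esub> ?q v" if "r \<in> carrier R" "v \<in> carrier X" for r v
    proof -
      have "r \<odot>\<^bsub>X\<^esub> (\<ominus>\<^bsub>X\<^esub> u) = \<ominus>\<^bsub>X\<^esub> (r \<odot>\<^bsub>X\<^esub> u)" if u: "u \<in> carrier X" for u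
        using X.M.minus_equality[of "r \<odot>\<^bsub>X\<^esub> (\<ominus>\<^bsub>X\<^esub> u)" "r \<odot>\<^bsub>X\<^esub> u"] u \<open>r \<in> carrier R\<close>
        by (simp add: X.M.l_neg flip: X.smult_distr_module)
      then show ?thesis using that y
        by (simp add: ls X.M.minus_eq X.smult_distr_module X.smult_assoc)
    qed
  qed
  show qk: "?q v = v" if "v \<in> carrier (kernel R X l)" for v
    using that y by (simp add: X.M.minus_eq)
  let ?D = "direct_sum (principal_rmod R (l y)) (kernel R X l)"
  show "rmod_isomorphic R X ?D"
  proof (rule rmod_isomorphicI)
    show "(\<lambda>v. (l v, ?q v)) \<in> rmod_hom R X ?D"
    proof (rule rmod_hom_into_direct_sum[OF _ q], rule rmod_homI)
      show "l v \<in> carrier (principal_rmod R (l y))" if "v \<in> carrier X" for v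
        using y(3) that by auto
    qed (simp_all add: la ls)
    show "(\<lambda>z. fst z \<odot>\<^bsub>X\<^esub> y \<oplus>\<^bsub>X\<^esub> snd z) \<in> rmod_hom R ?D X"
    proof (rule rmod_homI)
    qed (use y in \<open>auto simp: X.smult_distr_ring X.smult_distr_module X.smult_assoc X.M.a_ac\<close>)
    show "fst (l v, ?q v) \<odot>\<^bsub>X\<^esub> y \<oplus>\<^bsub>X\<^esub> snd (l v, ?q v) = v" if "v \<in> carrier X" for v
      using that y by (simp add: X.M.minus_eq X.M.a_lcomm X.M.r_neg)
    show "(l (fst z \<odot>\<^bsub>X\<^esub> y \<oplus>\<^bsub>X\<^esub> snd z), ?q (fst z \<odot>\<^bsub>X\<^esub> y \<oplus>\<^bsub>X\<^esub> snd z)) = z" if z: "z \<in> carrier ?D" for z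
    proof -
      obtain r k where z: "z = (l y \<otimes> r, k)" "r \<in> carrier R" "k \<in> carrier X" "l k = \<zero>" using z by auto
      have 1: "l ((l y \<otimes> r) \<odot>\<^bsub>X\<^esub> y \<oplus>\<^bsub>X\<^esub> k) = l y \<otimes> r"
        using z y gl[of y] by (simp add: la ls flip: m_assoc)
      show ?thesis unfolding z fst_conv snd_conv 1
        using z y by (simp add: X.M.minus_eq X.M.a_ac X.M.r_neg)
    qed
  qed
qed

end

section \<open>Finitely generated projective modules\<close>

text \<open>
  Membership in \<^const>\<open>fgp\<close>, for modules over any type: the lifting property is always
  tested against the modules over \<^typ>\<open>nat \<Rightarrow> 'r\<close>, which makes it invariant under isomorphisms
  between modules over different types.
\<close>

definition fgproj :: "'r ring \<Rightarrow> ('r, 'a) module \<Rightarrow> bool" where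
  "fgproj R P \<longleftrightarrow> right_module R P \<and> finitely_generated R P \<and>
    (\<forall>(A :: ('r, nat \<Rightarrow> 'r) module) (B :: ('r, nat \<Rightarrow> 'r) module).
      right_module R A \<and> right_module R B \<longrightarrow>
      (\<forall>p\<in>rmod_hom R A B. \<forall>f\<in>rmod_hom R P B. p ` carrier A = carrier B \<longrightarrow>
        (\<exists>h\<in>rmod_hom R P A. \<forall>x\<in>carrier P. p (h x) = f x)))"

lemma fgp_iff: "X \<in> fgp R \<longleftrightarrow> fgproj R X"
  by (simp add: fgp_def fgproj_def projective_def)

lemma fgprojD:
  assumes "fgproj R X"
  shows "right_module R X" "finitely_generated R X"
  using assms by (auto simp: fgproj_def)

lemma fgprojI:
  fixes P :: "('r, 'a) module"
  assumes "right_module R P" "finitely_generated R P"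
    and "\<And>(A :: ('r, nat \<Rightarrow> 'r) module) (B :: ('r, nat \<Rightarrow> 'r) module) p f.
      right_module R A \<Longrightarrow> right_module R B \<Longrightarrow> p \<in> rmod_hom R A B \<Longrightarrow> f \<in> rmod_hom R P B \<Longrightarrow>
      p ` carrier A = carrier B \<Longrightarrow> \<exists>h\<in>rmod_hom R P A. \<forall>x\<in>carrier P. p (h x) = f x"
  shows "fgproj R P"
  unfolding fgproj_def by (intro conjI allI ballI impI assms) auto

lemma fgproj_lift:
  fixes A B :: "('r, nat \<Rightarrow> 'r) module"
  assumes "fgproj R P" "right_module R A" "right_module R B" "p \<in> rmod_hom R A B"
    "f \<in> rmod_hom R P B" "p ` carrier A = carrier B"
  obtains h where "h \<in> rmod_hom R P A" "\<And>x. x \<in> carrier P \<Longrightarrow> p (h x) = f x"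
  using assms(1)[unfolded fgproj_def, THEN conjunct2, THEN conjunct2, rule_format,
      OF conjI[OF assms(2,3)] assms(4-6)] by blast

lemma fgproj_retract:
  fixes X :: "('r, 'a) module"
  assumes X: "fgproj R X" and Y: "right_module R Y"
    and p: "p \<in> rmod_hom R X Y" and i: "i \<in> rmod_hom R Y X"
    and pi: "\<And>y. y \<in> carrier Y \<Longrightarrow> p (i y) = y"
  shows "fgproj R Y"
proof -
  have "p ` carrier X = carrier Y"
    using pi rmod_homD(1)[OF p] rmod_homD(1)[OF i] by (metis image_eqI image_subsetI subsetI subset_antisym)
  then have "finitely_generated R Y"
    using finitely_generated_image[OF fgprojD(1)[OF X] Y p] fgprojD(2)[OF X] by blast
  moreover have "\<exists>h\<in>rmod_hom R Y A. \<forall>x\<in>carrier Y. q (h x) = f x"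
    if prem: "right_module R A" "right_module R B" "q \<in> rmod_hom R A B" "f \<in> rmod_hom R Y B"
      "q ` carrier A = carrier B" for A B :: "('r, nat \<Rightarrow> 'r) module" and q f
  proof -
    obtain h where "h \<in> rmod_hom R X A" "\<And>x. x \<in> carrier X \<Longrightarrow> q (h x) = f (p x)"
      using fgproj_lift[OF X prem(1-3) rmod_hom_comp[OF p prem(4)] prem(5)] by blast
    then show ?thesis using pi rmod_homD(1)[OF i] rmod_hom_comp[OF i]
      by (intro bexI[of _ "\<lambda>y. h (i y)"]) auto
  qed
  ultimately show ?thesis by (intro fgprojI Y)
qed

lemma fgproj_iso:
  assumes "fgproj R X" "right_module R Y" "rmod_isomorphic R X Y"
  shows "fgproj R Y"
  using rmod_isomorphicE[OF fgprojD(1)[OF assms(1)] assms(3)] fgproj_retract[OF assms(1,2)] by metis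

lemma rmod_hom_add:
  assumes "right_module R Y" "h \<in> rmod_hom R X Y" "k \<in> rmod_hom R X Y"
  shows "(\<lambda>x. h x \<oplus>\<^bsub>Y\<^esub> k x) \<in> rmod_hom R X Y"
proof -
  interpret Y: right_module R Y by fact
  show ?thesis
    by (rule rmod_homI)
      (simp_all add: rmod_homD[OF assms(2)] rmod_homD[OF assms(3)] Y.smult_distr_module Y.M.a_ac)
qed

lemma fgproj_direct_sum:
  fixes X :: "('r, 'a) module"
  assumes X: "fgproj R X" and Y: "fgproj R Y"
  shows "fgproj R (direct_sum X Y)"
proof -
  note mX = fgprojD(1)[OF X] and mY = fgprojD(1)[OF Y]
  interpret X: right_module R X by fact
  interpret Y: right_module R Y by fact
  have "\<exists>h\<in>rmod_hom R (direct_sum X Y) A. \<forall>x\<in>carrier (direct_sum X Y). q (h x) = f x"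
    if prem: "right_module R A" "right_module R B" "q \<in> rmod_hom R A B" "f \<in> rmod_hom R (direct_sum X Y) B"
      "q ` carrier A = carrier B" for A B :: "('r, nat \<Rightarrow> 'r) module" and q f
  proof -
    obtain h where h: "h \<in> rmod_hom R X A" "\<And>x. x \<in> carrier X \<Longrightarrow> q (h x) = f (x, \<zero>\<^bsub>Y\<^esub>)"
      using fgproj_lift[OF X prem(1-3) rmod_hom_comp[OF rmod_hom_Pair1[OF mX mY] prem(4)] prem(5)] by blast
    obtain k where k: "k \<in> rmod_hom R Y A" "\<And>y. y \<in> carrier Y \<Longrightarrow> q (k y) = f (\<zero>\<^bsub>X\<^esub>, y)"
      using fgproj_lift[OF Y prem(1-3) rmod_hom_comp[OF rmod_hom_Pair2[OF mX mY] prem(4)] prem(5)] by blast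
    have "(\<lambda>z. h (fst z) \<oplus>\<^bsub>A\<^esub> k (snd z)) \<in> rmod_hom R (direct_sum X Y) A"
      by (intro rmod_hom_add[OF prem(1)] rmod_hom_comp[OF rmod_hom_fst h(1)] rmod_hom_comp[OF rmod_hom_snd k(1)])
    moreover have "q (h x \<oplus>\<^bsub>A\<^esub> k y) = f (x, y)" if "x \<in> carrier X" "y \<in> carrier Y" for x y
    proof -
      have "q (h x \<oplus>\<^bsub>A\<^esub> k y) = f (x, \<zero>\<^bsub>Y\<^esub>) \<oplus>\<^bsub>B\<^esub> f (\<zero>\<^bsub>X\<^esub>, y)"
        using rmod_homD(2)[OF \<open>q \<in> _\<close>] h k that rmod_homD(1)[OF h(1)] rmod_homD(1)[OF k(1)] by simp
      also have "\<dots> = f ((x, \<zero>\<^bsub>Y\<^esub>) \<oplus>\<^bsub>direct_sum X Y\<^esub> (\<zero>\<^bsub>X\<^esub>, y))"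
        using that by (intro rmod_homD(2)[OF \<open>f \<in> _\<close>, symmetric]) auto
      finally show ?thesis using that by simp
    qed
    ultimately show ?thesis by (intro bexI[of _ "\<lambda>z. h (fst z) \<oplus>\<^bsub>A\<^esub> k (snd z)"]) auto
  qed
  then show ?thesis
    by (intro fgprojI right_module_direct_sum finitely_generated_direct_sum mX mY fgprojD(2)[OF X] fgprojD(2)[OF Y])
qed

lemma (in vn_regular) fgproj_principal:
  assumes x: "x \<in> carrier R"
  shows "fgproj R (principal_rmod R x)"
proof -
  obtain u where u: "u \<in> carrier R" "x \<otimes> u \<otimes> x = x" using quasi_inverse[OF x] by blast
  have "\<exists>h\<in>rmod_hom R (principal_rmod R x) A. \<forall>v\<in>carrier (principal_rmod R x). q (h v) = f v"
    if A: "right_module R A" and B: "right_module R B" and q: "q \<in> rmod_hom R A B"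
      and f: "f \<in> rmod_hom R (principal_rmod R x) B"
      and qs: "q ` carrier A = carrier B" for A B :: "('r, nat \<Rightarrow> 'r) module" and q f
  proof -
    interpret A: right_module R A by fact
    have xx: "x \<in> pideal R x" using x by (auto intro: image_eqI[of _ _ \<one>])
    have "f x \<in> carrier B" using rmod_homD(1)[OF f] xx by simp
    then obtain a where a: "a \<in> carrier A" "q a = f x" unfolding qs[symmetric] by auto
    have "(\<lambda>v. (u \<otimes> v) \<odot>\<^bsub>A\<^esub> a) \<in> rmod_hom R (principal_rmod R x) A"
      by (rule rmod_homI) (use u x a in \<open>auto simp: r_distr m_assoc A.smult_closed simp flip: A.smult_distr_ring A.smult_assoc\<close>)
    moreover have "q ((u \<otimes> v) \<odot>\<^bsub>A\<^esub> a) = f v" if v: "v \<in> pideal R x" for v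
    proof -
      obtain r where r: "r \<in> carrier R" "v = x \<otimes> r" using v by auto
      have "q ((u \<otimes> v) \<odot>\<^bsub>A\<^esub> a) = (u \<otimes> v) \<odot>\<^bsub>B\<^esub> f x" using rmod_homD(3)[OF q] u r x a by simp
      also have "\<dots> = f (x \<otimes> (u \<otimes> v))" using rmod_homD(3)[OF f, of "u \<otimes> v" x] xx u r x by simp
      also have "x \<otimes> (u \<otimes> v) = v" using r u x by (simp flip: m_assoc)
      finally show ?thesis .
    qed
    ultimately show ?thesis by (intro bexI[of _ "\<lambda>v. (u \<otimes> v) \<odot>\<^bsub>A\<^esub> a"]) auto
  qed
  then show ?thesis by (intro fgprojI right_module_principal finitely_generated_principal x)
qed

section \<open>Separating functionals\<close>

definition separating :: "'r ring \<Rightarrow> ('r, 'a) module \<Rightarrow> ('a \<Rightarrow> 'r) list \<Rightarrow> bool" where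
  "separating R X ls \<longleftrightarrow> set ls \<subseteq> functionals R X \<and>
    (\<forall>x\<in>carrier X. (\<forall>l\<in>set ls. l x = \<zero>\<^bsub>R\<^esub>) \<longrightarrow> x = \<zero>\<^bsub>X\<^esub>)"

definition seq_module :: "'r ring \<Rightarrow> ('r, nat \<Rightarrow> 'r) module" where
  "seq_module R = \<lparr>carrier = {f. \<forall>i. f i \<in> carrier R}, monoid.mult = undefined, one = undefined,
    zero = \<lambda>i. \<zero>\<^bsub>R\<^esub>, add = \<lambda>f g i. f i \<oplus>\<^bsub>R\<^esub> g i, smult = \<lambda>r f i. f i \<otimes>\<^bsub>R\<^esub> r\<rparr>"

lemma right_module_seq: 
  assumes "ring R" shows "right_module R (seq_module R)"
proof -
  interpret ring R by fact
  show ?thesis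
  proof (rule right_moduleI)
    show "\<exists>y\<in>carrier (seq_module R). y \<oplus>\<^bsub>seq_module R\<^esub> x = \<zero>\<^bsub>seq_module R\<^esub>"
      if "x \<in> carrier (seq_module R)" for x
      using that by (intro bexI[of _ "\<lambda>i. \<ominus>\<^bsub>R\<^esub> x i"]) (auto simp: seq_module_def l_neg)
  qed (auto simp: seq_module_def a_ac l_distr r_distr m_assoc intro: ring_axioms)
qed

primrec lincomb :: "('r, 'a) module \<Rightarrow> (nat \<Rightarrow> 'a) \<Rightarrow> nat \<Rightarrow> (nat \<Rightarrow> 'r) \<Rightarrow> 'a" where
  "lincomb X s 0 f = \<zero>\<^bsub>X\<^esub>"
| "lincomb X s (Suc n) f = lincomb X s n f \<oplus>\<^bsub>X\<^esub> f n \<odot>\<^bsub>X\<^esub> s n"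

lemma lincomb_hom:
  assumes "right_module R X" "\<And>i. i < n \<Longrightarrow> s i \<in> carrier X"
  shows "lincomb X s n \<in> rmod_hom R (seq_module R) X"
  using assms(2)
proof (induction n)
  interpret right_module R X by fact
  case 0
  show ?case by (rule rmod_homI) auto
next
  interpret right_module R X by fact
  case (Suc n)
  have "(\<lambda>f. f n \<odot>\<^bsub>X\<^esub> s n) \<in> rmod_hom R (seq_module R) X"
    by (rule rmod_homI) (use Suc.prems in \<open>auto simp: seq_module_def smult_closed smult_distr_ring smult_assoc\<close>)
  then have "(\<lambda>f. lincomb X s n f \<oplus>\<^bsub>X\<^esub> f n \<odot>\<^bsub>X\<^esub> s n) \<in> rmod_hom R (seq_module R) X"
    using Suc by (intro rmod_hom_add[OF assms(1)]) auto
  then show ?case by simp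
qed

text \<open>
  Lifting the identity of \<open>X\<close> along a linear combination map onto \<open>X\<close> gives coordinates on \<open>X\<close>,
  that is, half of a dual basis.  The module of all sequences may serve as
  the source, because a linear combination involves only finitely many of the entries.
\<close>

lemma fgproj_separating:
  fixes X :: "('r, nat \<Rightarrow> 'r) module"
  assumes "fgproj R X"
  obtains ls where "separating R X ls"
proof -
  note X = fgprojD[OF assms]
  interpret right_module R X by (rule X)
  obtain S where S: "finite S" "S \<subseteq> carrier X" and
    gen: "\<And>K. submod R X K \<Longrightarrow> S \<subseteq> K \<Longrightarrow> carrier X \<subseteq> K"
    using X(2) finitely_generated_iff[OF X(1)] by blast
  obtain xs where xs: "set xs = S" using finite_list[OF S(1)] by blast
  define n where "n = length xs"
  define s where "s = nth xs"
  have s: "\<And>i. i < n \<Longrightarrow> s i \<in> carrier X" using xs S(2) by (auto simp: n_def s_def)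
  note F = right_module_seq[OF R.ring_axioms]
  have p: "lincomb X s n \<in> rmod_hom R (seq_module R) X" by (rule lincomb_hom[OF X(1) s])
  have unit: "lincomb X s m (\<lambda>j. if j = i then \<one>\<^bsub>R\<^esub> else \<zero>\<^bsub>R\<^esub>) = (if i < m then s i else \<zero>\<^bsub>X\<^esub>)"
    if "m \<le> n" for i m
    using that
  proof (induction m)
    case (Suc m)
    then show ?case using s[of m] s[of i] smult_one by (auto simp: less_Suc_eq)
  qed simp
  have "S \<subseteq> lincomb X s n ` carrier (seq_module R)"
  proof
    fix x assume "x \<in> S"
    then obtain i where "i < n" "x = s i" unfolding xs[symmetric] in_set_conv_nth n_def s_def by blast
    then have "x = lincomb X s n (\<lambda>j. if j = i then \<one>\<^bsub>R\<^esub> else \<zero>\<^bsub>R\<^esub>)" using unit[of n i] by simp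
    then show "x \<in> lincomb X s n ` carrier (seq_module R)" by (auto simp: seq_module_def)
  qed
  then have "carrier X \<subseteq> lincomb X s n ` carrier (seq_module R)"
    by (rule gen[OF submod_image[OF F X(1) p]])
  then have onto: "lincomb X s n ` carrier (seq_module R) = carrier X"
    using rmod_homD(1)[OF p] by auto
  obtain h where h: "h \<in> rmod_hom R X (seq_module R)" "\<And>x. x \<in> carrier X \<Longrightarrow> lincomb X s n (h x) = x"
    using fgproj_lift[OF assms F X(1) p rmod_hom_id onto] by blast
  have hi: "(\<lambda>x. h x i) \<in> functionals R X" for i
    using rmod_homD[OF h(1)] by (intro rmod_homI) (auto simp: seq_module_def)
  have zero: "lincomb X s m f = \<zero>\<^bsub>X\<^esub>" if "m \<le> n" "\<And>i. i < m \<Longrightarrow> f i = \<zero>\<^bsub>R\<^esub>" for f m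
    using that by (induction m) (auto simp: s)
  show thesis
  proof (rule that[of "map (\<lambda>i x. h x i) [0..<n]"], unfold separating_def, intro conjI ballI impI)
    fix x assume "x \<in> carrier X" "\<forall>l\<in>set (map (\<lambda>i x. h x i) [0..<n]). l x = \<zero>\<^bsub>R\<^esub>"
    then show "x = \<zero>\<^bsub>X\<^esub>" using zero[of n "h x"] h(2)[of x] by simp
  qed (use hi in auto)
qed

section \<open>The monoid of isomorphism classes\<close>

text \<open>
  The modules that have a nonempty \<^const>\<open>iso_class\<close>, so that this is their class in \<open>V(R)\<close>.
\<close>

definition represented :: "'r ring \<Rightarrow> ('r, 'a) module \<Rightarrow> bool" where
  "represented R X \<longleftrightarrow> right_module R X \<and> (\<exists>Y\<in>fgp R. rmod_isomorphic R Y X)"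

lemma represented_fgp: "X \<in> fgp R \<Longrightarrow> represented R X"
  unfolding represented_def using rmod_isomorphic_refl by (auto simp: fgp_def)

lemma represented_iso:
  "represented R X \<Longrightarrow> right_module R Y \<Longrightarrow> rmod_isomorphic R X Y \<Longrightarrow> represented R Y"
  unfolding represented_def using rmod_isomorphic_trans by blast

lemma represented_transport:
  fixes X :: "('r, 'a) module" and j :: "'a \<Rightarrow> nat \<Rightarrow> 'r"
  assumes X: "fgproj R X" and inj: "inj_on j (carrier X)"
  shows "represented R X"
proof -
  note mX = fgprojD(1)[OF X]
  interpret right_module R X by (rule mX)
  let ?i = "inv_into (carrier X) j"
  define Y :: "('r, nat \<Rightarrow> 'r) module" where "Y = \<lparr>carrier = j ` carrier X, monoid.mult = undefined, one = undefined,
    zero = j \<zero>\<^bsub>X\<^esub>, add = (\<lambda>a b. j (?i a \<oplus>\<^bsub>X\<^esub> ?i b)), smult = (\<lambda>r a. j (r \<odot>\<^bsub>X\<^esub> ?i a))\<rparr>"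
  have ij[simp]: "?i (j x) = x" if "x \<in> carrier X" for x using inj that by simp
  have Y: "right_module R Y"
  proof (rule right_moduleI)
    show "\<exists>y\<in>carrier Y. y \<oplus>\<^bsub>Y\<^esub> x = \<zero>\<^bsub>Y\<^esub>" if x: "x \<in> carrier Y" for x
    proof -
      obtain x' where "x' \<in> carrier X" "x = j x'" using x by (auto simp: Y_def)
      then show ?thesis by (intro bexI[of _ "j (\<ominus>\<^bsub>X\<^esub> x')"]) (auto simp: Y_def M.l_neg)
    qed
  qed (auto simp: Y_def M.a_ac smult_closed smult_distr_ring smult_distr_module smult_assoc smult_one R.ring_axioms)
  have iso: "rmod_isomorphic R X Y"
    unfolding rmod_isomorphic_def
  proof (rule bexI)
    show "bij_betw j (carrier X) (carrier Y)" using inj by (simp add: Y_def bij_betw_def)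
    show "j \<in> rmod_hom R X Y" by (rule rmod_homI) (auto simp: Y_def)
  qed
  then have "Y \<in> fgp R" using fgproj_iso[OF X Y] by (simp add: fgp_iff)
  then show ?thesis using rmod_isomorphic_sym[OF mX iso] mX unfolding represented_def by blast
qed

text \<open>
  Interleaving identifies pairs of sequences with sequences.
\<close>

lemma represented_direct_sum:
  assumes "represented R X" "represented R Y"
  shows "represented R (direct_sum X Y)"
proof -
  obtain X' Y' where X': "X' \<in> fgp R" "rmod_isomorphic R X' X" and Y': "Y' \<in> fgp R" "rmod_isomorphic R Y' Y"
    using assms by (auto simp: represented_def)
  let ?j = "\<lambda>(f, g) k. if even k then f (k div 2) else g (k div 2) :: 'a"
  have inj: "inj_on ?j (carrier (direct_sum X' Y'))"
  proof (rule inj_onI)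
    fix p q :: "(nat \<Rightarrow> 'a) \<times> (nat \<Rightarrow> 'a)"
    assume *: "?j p = ?j q"
    have "fst p i = fst q i" for i using fun_cong[OF *, of "2 * i"] by (simp add: split_beta)
    moreover have "snd p i = snd q i" for i using fun_cong[OF *, of "2 * i + 1"] by (simp add: split_beta)
    ultimately show "p = q" by (simp add: prod_eq_iff fun_eq_iff)
  qed
  have "fgproj R (direct_sum X' Y')" using X' Y' fgproj_direct_sum by (auto simp: fgp_iff)
  then have "represented R (direct_sum X' Y')" using inj by (rule represented_transport)
  moreover have "rmod_isomorphic R (direct_sum X' Y') (direct_sum X Y)"
    using X' Y' by (intro direct_sum_iso_mono) (auto simp: fgp_def)
  ultimately show ?thesis
    using represented_iso right_module_direct_sum assms unfolding represented_def by blast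
qed

lemma iso_class_eqI:
  assumes "right_module R X" "rmod_isomorphic R X Y"
  shows "iso_class R X = iso_class R Y"
proof -
  have "rmod_isomorphic R Z X \<longleftrightarrow> rmod_isomorphic R Z Y" for Z :: "('a, nat \<Rightarrow> 'a) module"
    using rmod_isomorphic_trans[of R Z X Y] rmod_isomorphic_trans[of R Z Y X]
      rmod_isomorphic_sym[OF assms] assms(2) by blast
  then show ?thesis by (simp add: iso_class_def)
qed

lemma representedE:
  assumes "represented R X"
  obtains Y where "Y \<in> fgp R" "rmod_isomorphic R Y X" "iso_class R X = iso_class R Y"
proof -
  obtain Y where "Y \<in> fgp R" "rmod_isomorphic R Y X" using assms by (auto simp: represented_def)
  then show thesis using that iso_class_eqI[of R Y X] by (simp add: fgp_def)
qed

lemma represented_in_V: "represented R X \<Longrightarrow> iso_class R X \<in> carrier (V R)"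
  by (erule representedE) (simp add: V_def)

lemma V_elem:
  assumes "C \<in> carrier (V R)"
  obtains X where "X \<in> fgp R" "C = iso_class R X"
  using assms by (auto simp: V_def)

lemma iso_class_mult:
  assumes X: "represented R X" and Y: "represented R Y"
  shows "iso_class R X \<otimes>\<^bsub>V R\<^esub> iso_class R Y = iso_class R (direct_sum X Y)"
proof -
  have "iso_class R (direct_sum X' Y') = iso_class R (direct_sum X Y)"
    if "X' \<in> iso_class R X" "Y' \<in> iso_class R Y" for X' Y'
    using that
    by (intro iso_class_eqI right_module_direct_sum direct_sum_iso_mono) (auto simp: iso_class_def fgp_def)
  moreover have "iso_class R X \<noteq> {}" "iso_class R Y \<noteq> {}"
    using X Y by (auto simp: represented_def iso_class_def)
  ultimately show ?thesis by (auto simp: V_def)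
qed

definition pclass :: "'r ring \<Rightarrow> 'r \<Rightarrow> ('r, nat \<Rightarrow> 'r) module set" where
  "pclass R x = iso_class R (principal_rmod R x)"

context vn_regular begin

lemma represented_principal: "x \<in> carrier R \<Longrightarrow> represented R (principal_rmod R x)"
  using fgproj_principal by (rule represented_transport[where j = "\<lambda>r _. r"]) (auto simp: inj_on_def fun_eq_iff)

lemma pclass_closed [simp]: "x \<in> carrier R \<Longrightarrow> pclass R x \<in> carrier (V R)"
  unfolding pclass_def by (intro represented_in_V represented_principal)

lemma principal_zero: "principal_rmod R \<zero> = right_ideal_module R {\<zero>}"
proof -
  have "pideal R \<zero> = {\<zero>}" by (auto intro: image_eqI[of _ _ \<zero>])
  then show ?thesis by simp
qed

lemma principal_one: "principal_rmod R \<one> = regular_rmod R"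
proof -
  have "pideal R \<one> = carrier R" by (auto intro: image_eqI)
  then show ?thesis by simp
qed

lemma V_one: "\<one>\<^bsub>V R\<^esub> = pclass R \<zero>"
  unfolding pclass_def principal_zero by (simp add: V_def)

lemma V_ounit: "ounit (V R) = pclass R \<one>"
  unfolding pclass_def principal_one by (simp add: V_def)

lemma comm_monoid_V: "comm_monoid (V R)"
proof (rule comm_monoidI)
  fix C D assume CD: "C \<in> carrier (V R)" "D \<in> carrier (V R)"
  obtain X where X: "X \<in> fgp R" "C = iso_class R X" using V_elem CD by blast
  obtain Y where Y: "Y \<in> fgp R" "D = iso_class R Y" using V_elem CD by blast
  note r = represented_fgp[OF X(1)] represented_fgp[OF Y(1)]
  show "C \<otimes>\<^bsub>V R\<^esub> D \<in> carrier (V R)"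
    unfolding X Y iso_class_mult[OF r] by (intro represented_in_V represented_direct_sum r)
  show "C \<otimes>\<^bsub>V R\<^esub> D = D \<otimes>\<^bsub>V R\<^esub> C"
    unfolding X Y iso_class_mult[OF r] iso_class_mult[OF r(2,1)]
    using X Y by (intro iso_class_eqI right_module_direct_sum direct_sum_comm) (auto simp: fgp_def)
  fix E assume "E \<in> carrier (V R)"
  then obtain Z where Z: "Z \<in> fgp R" "E = iso_class R Z" using V_elem by blast
  note s = r represented_fgp[OF Z(1)]
  show "C \<otimes>\<^bsub>V R\<^esub> D \<otimes>\<^bsub>V R\<^esub> E = C \<otimes>\<^bsub>V R\<^esub> (D \<otimes>\<^bsub>V R\<^esub> E)"
    unfolding X Y Z using s X Y Z
    by (simp add: iso_class_mult represented_direct_sum)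
      (intro iso_class_eqI right_module_direct_sum direct_sum_assoc; simp add: fgp_def)
next
  show "\<one>\<^bsub>V R\<^esub> \<in> carrier (V R)" by (simp add: V_one)
  fix C assume "C \<in> carrier (V R)"
  then obtain X where X: "X \<in> fgp R" "C = iso_class R X" using V_elem by blast
  have mX: "right_module R X" using X by (simp add: fgp_def)
  interpret X: right_module R X by fact
  have "rmod_isomorphic R (direct_sum (principal_rmod R \<zero>) X) X"
    by (rule rmod_isomorphicI[OF rmod_hom_snd rmod_hom_Pair2[OF right_module_principal[OF zero_closed] mX]])
      auto
  then show "\<one>\<^bsub>V R\<^esub> \<otimes>\<^bsub>V R\<^esub> C = C"
    unfolding V_one X pclass_def
    using iso_class_mult[OF represented_principal represented_fgp[OF X(1)], of \<zero>]
      iso_class_eqI[OF right_module_direct_sum[OF right_module_principal[OF zero_closed] mX]] by simp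
qed

text \<open>
  Each functional splits off a principal right ideal.  Iterating this along a separating
  list of functionals writes every class as a sum of classes of principal right ideals.
\<close>

lemma V_split:
  fixes X :: "('r, nat \<Rightarrow> 'r) module"
  assumes X: "X \<in> fgp R" and l: "l \<in> functionals R X"
  obtains g where "g \<in> carrier R" "g \<otimes> g = g" "l ` carrier X = pideal R g" "kernel R X l \<in> fgp R"
    "iso_class R X = pclass R g \<otimes>\<^bsub>V R\<^esub> iso_class R (kernel R X l)"
proof -
  have mX: "right_module R X" and fX: "finitely_generated R X" and pX: "fgproj R X"
    using X by (auto simp: fgp_iff fgproj_def)
  obtain g y where g: "g \<in> carrier R" "g \<otimes> g = g" "l ` carrier X = pideal R g"
    "y \<in> carrier X" "l y = g" "g \<odot>\<^bsub>X\<^esub> y = y"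
    using functional_image_principal[OF mX fX l] by metis
  note ks = kernel_splitting[OF mX l, of y]
  note mK = right_module_kernel[OF mX l]
  have "fgproj R (kernel R X l)"
  proof (rule fgproj_retract[OF pX mK])
    show "(\<lambda>v. v \<ominus>\<^bsub>X\<^esub> l v \<odot>\<^bsub>X\<^esub> y) \<in> rmod_hom R X (kernel R X l)" using ks(1) g by simp
    show "(\<lambda>v. v) \<in> rmod_hom R (kernel R X l) X" by (rule rmod_homI) auto
    show "v \<ominus>\<^bsub>X\<^esub> l v \<odot>\<^bsub>X\<^esub> y = v" if "v \<in> carrier (kernel R X l)" for v using ks(2)[OF _ _ _ that] g by simp
  qed
  then have K: "kernel R X l \<in> fgp R" by (simp add: fgp_iff)
  have "iso_class R X = iso_class R (direct_sum (principal_rmod R g) (kernel R X l))"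
    using ks(3) g by (intro iso_class_eqI mX) simp
  also have "\<dots> = pclass R g \<otimes>\<^bsub>V R\<^esub> iso_class R (kernel R X l)"
    unfolding pclass_def using iso_class_mult[OF represented_principal[OF g(1)] represented_fgp[OF K]] by simp
  finally show thesis using that g K by blast
qed

lemma separating_kernel:
  assumes "separating R X (l # ls)"
  shows "separating R (kernel R X l) ls"
  using assms functionals_kernel unfolding separating_def by force

lemma V_induct [consumes 1, case_names one principal mult]:
  assumes C: "C \<in> carrier (V R)"
    and one: "P \<one>\<^bsub>V R\<^esub>"
    and principal: "\<And>x. x \<in> carrier R \<Longrightarrow> P (pclass R x)"
    and mult: "\<And>A B. A \<in> carrier (V R) \<Longrightarrow> B \<in> carrier (V R) \<Longrightarrow> P A \<Longrightarrow> P B \<Longrightarrow> P (A \<otimes>\<^bsub>V R\<^esub> B)"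
  shows "P C"
proof -
  have "P (iso_class R X)" if "X \<in> fgp R" "separating R X ls" for X ls
    using that
  proof (induction ls arbitrary: X)
    case Nil
    have mX: "right_module R X" using Nil by (simp add: fgp_def)
    interpret X: right_module R X by fact
    have X0: "carrier X = {\<zero>\<^bsub>X\<^esub>}" using Nil(2) X.M.zero_closed by (auto simp: separating_def)
    have "rmod_isomorphic R X (principal_rmod R \<zero>)" unfolding principal_zero
      by (rule rmod_isomorphicI[of "\<lambda>_. \<zero>" _ _ _ "\<lambda>_. \<zero>\<^bsub>X\<^esub>"]; (rule rmod_homI)?) (auto simp: X0)
    then have "iso_class R X = pclass R \<zero>" unfolding pclass_def by (rule iso_class_eqI[OF mX])
    then show ?case using principal by simp
  next
    case (Cons l ls)
    have "l \<in> functionals R X" using Cons by (simp add: separating_def)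
    from V_split[OF Cons(2) this] obtain g where g: "g \<in> carrier R" "kernel R X l \<in> fgp R"
      "iso_class R X = pclass R g \<otimes>\<^bsub>V R\<^esub> iso_class R (kernel R X l)" by metis
    show ?case unfolding g(3)
      using g Cons separating_kernel[OF Cons(3)] by (intro mult principal) (auto intro: represented_in_V represented_fgp)
  qed
  moreover obtain X where X: "X \<in> fgp R" "C = iso_class R X" using V_elem C by blast
  moreover obtain ls where "separating R X ls" using fgproj_separating X fgp_iff by metis
  ultimately show ?thesis by blast
qed

lemma V_hom_eqI:
  assumes "comm_monoid N" "h \<in> hom (V R) N" "k \<in> hom (V R) N" "h \<one>\<^bsub>V R\<^esub> = k \<one>\<^bsub>V R\<^esub>"
    and "\<And>x. x \<in> carrier R \<Longrightarrow> h (pclass R x) = k (pclass R x)" and "C \<in> carrier (V R)"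
  shows "h C = k C"
  using assms(6) by (induction rule: V_induct) (use assms in \<open>auto simp: hom_mult\<close>)

lemma pclass_sim:
  assumes "sim R x y"
  shows "pclass R x = pclass R y"
proof -
  obtain c d a b where s: "x \<in> carrier R" "y \<in> carrier R"
    "c \<in> carrier R" "d \<in> carrier R" "a \<in> carrier R" "b \<in> carrier R"
    "c \<otimes> x = y \<otimes> a" "d \<otimes> y = x \<otimes> b" "d \<otimes> (c \<otimes> x) = x" "c \<otimes> (d \<otimes> y) = y"
    using assms by (rule simE)
  have e: "e \<otimes> (x' \<otimes> r) = y' \<otimes> (a' \<otimes> r)" if "e \<otimes> x' = y' \<otimes> a'" "e \<in> carrier R" "x' \<in> carrier R"
      "y' \<in> carrier R" "a' \<in> carrier R" "r \<in> carrier R" for e x' y' a' r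
    using that by (simp flip: m_assoc)
  have f: "e' \<otimes> (e \<otimes> (x' \<otimes> r)) = x' \<otimes> r" if "e' \<otimes> (e \<otimes> x') = x'" "e' \<in> carrier R" "e \<in> carrier R" "x' \<in> carrier R"
      "r \<in> carrier R" for e e' x' r
  proof -
    have "e' \<otimes> (e \<otimes> (x' \<otimes> r)) = e' \<otimes> (e \<otimes> x') \<otimes> r" using that(2-5) by (simp add: m_assoc)
    then show ?thesis using that(1) by simp
  qed
  have "rmod_isomorphic R (principal_rmod R x) (principal_rmod R y)"
  proof (rule rmod_isomorphicI)
    show "(\<lambda>z. c \<otimes> z) \<in> rmod_hom R (principal_rmod R x) (principal_rmod R y)"
      using s(1-6) e[OF s(7)] by (intro rmod_hom_left_mult) auto
    show "(\<lambda>z. d \<otimes> z) \<in> rmod_hom R (principal_rmod R y) (principal_rmod R x)"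
      using s(1-6) e[OF s(8)] by (intro rmod_hom_left_mult) auto
  qed (use s f in auto)
  then show ?thesis unfolding pclass_def by (intro iso_class_eqI right_module_principal s(1))
qed

lemma pclass_add:
  assumes "x \<in> carrier R" "y \<in> carrier R" "x \<otimes> x = x" "y \<otimes> y = y" "x \<otimes> y = \<zero>" "y \<otimes> x = \<zero>"
  shows "pclass R (x \<oplus> y) = pclass R x \<otimes>\<^bsub>V R\<^esub> pclass R y"
proof -
  let ?D = "direct_sum (principal_rmod R x) (principal_rmod R y)"
  note [simp] = assms
  have a: "x \<otimes> (x \<otimes> r) = x \<otimes> r" "y \<otimes> (y \<otimes> r) = y \<otimes> r" "x \<otimes> (y \<otimes> r) = \<zero>" "y \<otimes> (x \<otimes> r) = \<zero>"
    if "r \<in> carrier R" for r using that by (simp_all flip: m_assoc)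
  have "rmod_isomorphic R (principal_rmod R (x \<oplus> y)) ?D"
  proof (rule rmod_isomorphicI[of "\<lambda>z. (x \<otimes> z, y \<otimes> z)" _ _ _ "\<lambda>z. fst z \<oplus> snd z"])
    show "(\<lambda>z. (x \<otimes> z, y \<otimes> z)) \<in> rmod_hom R (principal_rmod R (x \<oplus> y)) ?D"
      by (intro rmod_hom_into_direct_sum rmod_hom_left_mult) auto
    show "(\<lambda>z. fst z \<oplus> snd z) \<in> rmod_hom R ?D (principal_rmod R (x \<oplus> y))"
    proof (rule rmod_homI)
      fix z assume "z \<in> carrier ?D"
      then obtain r s where z: "r \<in> carrier R" "s \<in> carrier R" "z = (x \<otimes> r, y \<otimes> s)" by auto
      have "x \<otimes> r \<oplus> y \<otimes> s = (x \<oplus> y) \<otimes> (x \<otimes> r \<oplus> y \<otimes> s)"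
        using z(1,2) by (simp add: l_distr r_distr a)
      then show "fst z \<oplus> snd z \<in> carrier (principal_rmod R (x \<oplus> y))" using z by auto
    qed (auto simp: a_ac l_distr)
    show "fst (x \<otimes> z, y \<otimes> z) \<oplus> snd (x \<otimes> z, y \<otimes> z) = z" if "z \<in> carrier (principal_rmod R (x \<oplus> y))" for z
      using that by (auto simp: l_distr r_distr a)
  qed (auto simp: r_distr a)
  then have "pclass R (x \<oplus> y) = iso_class R ?D" unfolding pclass_def
    by (intro iso_class_eqI right_module_principal) auto
  then show ?thesis unfolding pclass_def by (simp add: iso_class_mult represented_principal)
qed

end

section \<open>The universal property of V\<close>

lemma (in vn_regular) finitely_generated_kernel:
  assumes "right_module R X" "finitely_generated R X" "l \<in> functionals R X"
  shows "finitely_generated R (kernel R X l)"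
proof -
  obtain g y where g: "l ` carrier X = pideal R g" "y \<in> carrier X" "l y = g" "g \<odot>\<^bsub>X\<^esub> y = y"
    using functional_image_principal[OF assms] by metis
  let ?q = "\<lambda>v. v \<ominus>\<^bsub>X\<^esub> l v \<odot>\<^bsub>X\<^esub> y"
  note ks = kernel_splitting[OF assms(1,3), of y]
  have q: "?q \<in> rmod_hom R X (kernel R X l)" using ks(1) g by simp
  have "?q ` carrier X = carrier (kernel R X l)"
  proof
    show "?q ` carrier X \<subseteq> carrier (kernel R X l)" using rmod_homD(1)[OF q] by blast
    show "carrier (kernel R X l) \<subseteq> ?q ` carrier X"
    proof
      fix v assume v: "v \<in> carrier (kernel R X l)"
      have "?q v = v" using ks(2)[OF _ _ _ v] g by simp
      then show "v \<in> ?q ` carrier X" using v by (auto intro!: image_eqI[of v ?q v])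
    qed
  qed
  then show ?thesis
    by (rule finitely_generated_image[OF assms(1) right_module_kernel[OF assms(1,3)] q _ assms(2)])
qed

context vn_regular begin

lemma generator_in_pideal: "x \<in> carrier R \<Longrightarrow> x \<in> pideal R x"
  by (auto intro: image_eqI[of _ _ \<one>])

text \<open>
  For two functionals \<open>l\<close> and \<open>k\<close>, the complement \<open>hR\<close> of \<open>l(ker k)\<close> in \<open>l(X)\<close>, where
  \<open>h = g - pg\<close>, is isomorphic to \<open>X / (ker l + ker k)\<close>, and so is the complement \<open>h'R\<close>
  of \<open>k(ker l)\<close> in \<open>k(X)\<close>.  The isomorphism from \<open>hR\<close> to \<open>h'R\<close> lifts an
  element along \<open>l\<close>, applies \<open>k\<close> and projects; it is left multiplication by \<open>h' k(v)\<close>.  The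
  lemma states that the same construction with \<open>l\<close> and \<open>k\<close> exchanged is a left inverse.
\<close>

lemma butterfly_complement:
  assumes X: "right_module R X" and l: "l \<in> functionals R X" and k: "k \<in> functionals R X"
    and v: "v \<in> carrier X" "l v = g" "g \<odot>\<^bsub>X\<^esub> v = v" "g \<in> carrier R" "g \<otimes> g = g"
    and p: "p \<in> carrier R" "p \<otimes> p = p" "l ` carrier (kernel R X k) = pideal R p"
    and v': "v' \<in> carrier X" "k v' = g'" "g' \<in> carrier R" "g' \<otimes> g' = g'" "k ` carrier X = pideal R g'"
    and p': "p' \<in> carrier R" "k ` carrier (kernel R X l) = pideal R p'"
    and gp: "g \<otimes> p = p"
  shows "((g \<ominus> p \<otimes> g) \<otimes> l v') \<otimes> (((g' \<ominus> p' \<otimes> g') \<otimes> k v) \<otimes> (g \<ominus> p \<otimes> g)) = g \<ominus> p \<otimes> g"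
proof -
  interpret X: right_module R X by fact
  define h where "h = g \<ominus> p \<otimes> g"
  define h' where "h' = g' \<ominus> p' \<otimes> g'"
  note sp = split_idempotent[OF v(4) p(1) v(5) p(2) gp, folded h_def]
  have [simp]: "h \<in> carrier R" "h' \<in> carrier R" using v v' p p' by (simp_all add: h_def h'_def)
  note [simp] = v(1,4) v'(1,3) p(1) p'(1) X.smult_closed
  have lX: "l x \<in> carrier R" if "x \<in> carrier X" for x using rmod_homD(1)[OF l that] by simp
  have kX: "k x \<in> carrier R" if "x \<in> carrier X" for x using rmod_homD(1)[OF k that] by simp
  note [simp] = lX kX
  have ls: "l (r \<odot>\<^bsub>X\<^esub> x) = l x \<otimes> r" if "x \<in> carrier X" "r \<in> carrier R" for x r
    using rmod_homD(3)[OF l] that by simp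
  have ks: "k (r \<odot>\<^bsub>X\<^esub> x) = k x \<otimes> r" if "x \<in> carrier X" "r \<in> carrier R" for x r
    using rmod_homD(3)[OF k] that by simp
  have ld: "l (x \<oplus>\<^bsub>X\<^esub> (\<ominus>\<^bsub>X\<^esub> y)) = l x \<ominus> l y" if "x \<in> carrier X" "y \<in> carrier X" for x y
    using rmod_homD(2)[OF l, of x "\<ominus>\<^bsub>X\<^esub> y"] that ls[of y "\<ominus> \<one>"] X.smult_minus_one
    by (simp add: minus_eq r_minus)
  have kd: "k (x \<oplus>\<^bsub>X\<^esub> (\<ominus>\<^bsub>X\<^esub> y)) = k x \<ominus> k y" if "x \<in> carrier X" "y \<in> carrier X" for x y
    using rmod_homD(2)[OF k, of x "\<ominus>\<^bsub>X\<^esub> y"] that ks[of y "\<ominus> \<one>"] X.smult_minus_one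
    by (simp add: minus_eq r_minus)
  define z where "z = k v \<otimes> h"
  have zc: "z \<in> carrier R" by (simp add: z_def)
  have g'k: "g' \<otimes> k x = k x" if "x \<in> carrier X" for x
  proof -
    have "k x \<in> pideal R g'" using v'(5) that by (metis imageI)
    then obtain r where "r \<in> carrier R" "k x = g' \<otimes> r" by auto
    then show ?thesis using v'(4) by (simp flip: m_assoc)
  qed
  have z: "k (h \<odot>\<^bsub>X\<^esub> v) = z" by (simp add: ks z_def)
  have "p' \<otimes> z \<in> k ` carrier (kernel R X l)" unfolding p'(2) using zc by auto
  then obtain u where u: "u \<in> carrier X" "l u = \<zero>" "k u = p' \<otimes> z" by auto
  \<comment> \<open>Another preimage of \<open>h\<close> under \<open>l\<close>, chosen such that its image under \<open>k\<close> lies in \<open>h'R\<close>.\<close>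
  define m where "m = h \<odot>\<^bsub>X\<^esub> v \<oplus>\<^bsub>X\<^esub> (\<ominus>\<^bsub>X\<^esub> u)"
  have mc: "m \<in> carrier X" using u by (simp add: m_def)
  define s where "s = h' \<otimes> z"
  have sc: "s \<in> carrier R" using zc by (simp add: s_def)
  have km: "k m = s"
  proof -
    have "h' \<otimes> z = g' \<otimes> z \<ominus> p' \<otimes> (g' \<otimes> z)" using zc by (simp add: h'_def ring_simprules)
    also have "g' \<otimes> z = z" using g'k[of "h \<odot>\<^bsub>X\<^esub> v"] z by simp
    finally show ?thesis using u by (simp add: m_def s_def kd z)
  qed
  \<comment> \<open>The difference of two preimages of \<open>s\<close> under \<open>k\<close>; so \<open>l t\<close> is in \<open>pR\<close>, and \<open>h\<close> kills it.\<close>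
  define t where "t = s \<odot>\<^bsub>X\<^esub> v' \<oplus>\<^bsub>X\<^esub> (\<ominus>\<^bsub>X\<^esub> m)"
  have tc: "t \<in> carrier X" using mc sc by (simp add: t_def)
  have "k t = g' \<otimes> s \<ominus> s" using mc sc v'(2) by (simp add: t_def kd ks km)
  then have kt: "k t = \<zero>" using g'k[OF mc] km sc by (simp add: minus_eq r_neg)
  have lm: "l m = h" using u ls[of v h] v(2) sp(8) by (simp add: m_def ld minus_eq)
  have lt: "l t = l v' \<otimes> s \<ominus> h" using mc sc by (simp add: t_def ld ls lm)
  have "l t \<in> pideal R p" unfolding p(3)[symmetric] using tc kt by auto
  then have "h \<otimes> l t = \<zero>" using sp(7) by (auto simp flip: m_assoc)
  then have "h \<otimes> (l v' \<otimes> s) \<ominus> h \<otimes> h = \<zero>" unfolding lt using sc by (simp add: minus_eq r_distr r_minus)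
  then have "h \<otimes> (l v' \<otimes> s) = h" using minus_eq_zeroD[of "h \<otimes> (l v' \<otimes> s)" "h \<otimes> h"] sc sp(3) by simp
  then show ?thesis unfolding h_def[symmetric] h'_def[symmetric] s_def z_def by (simp add: m_assoc)
qed

end

context dimension begin

text \<open>
  The default value makes this total, so that sums of values always lie in \<open>N\<close>.
\<close>

definition ideal_dim :: "'r set \<Rightarrow> 'n" where
  "ideal_dim J = (if \<exists>x\<in>carrier R. J = pideal R x then w (SOME x. x \<in> carrier R \<and> J = pideal R x) else \<one>\<^bsub>N\<^esub>)"

lemma ideal_dim_pideal [simp]:
  assumes x: "x \<in> carrier R"
  shows "ideal_dim (pideal R x) = w x"
proof -
  define y where "y = (SOME y. y \<in> carrier R \<and> pideal R x = pideal R y)"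
  have "y \<in> carrier R \<and> pideal R x = pideal R y" unfolding y_def by (rule someI[of _ x]) (use x in simp)
  then have y: "y \<in> carrier R" "pideal R x = pideal R y" by simp_all
  have "x \<in> pideal R y" "y \<in> pideal R x"
    using generator_in_pideal[OF x] generator_in_pideal[OF y(1)] unfolding y(2) by simp_all
  then obtain a b where "a \<in> carrier R" "x = y \<otimes> a" "b \<in> carrier R" "y = x \<otimes> b" by blast
  then have "w y = w x" using dim_same_ideal[OF y(1) x] by metis
  then show ?thesis using x unfolding ideal_dim_def y_def by auto
qed

lemma ideal_dim_closed [simp]: "ideal_dim J \<in> carrier N"
proof (cases "\<exists>x\<in>carrier R. J = pideal R x")
  case True
  then obtain x where "x \<in> carrier R" "J = pideal R x" by blast
  then show ?thesis by simp
qed (simp add: ideal_dim_def)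

lemma ideal_dim_zero [simp]: "ideal_dim {\<zero>} = \<one>\<^bsub>N\<^esub>"
proof -
  have "pideal R \<zero> = {\<zero>}" by (auto intro: image_eqI[of _ _ \<zero>])
  then show ?thesis using ideal_dim_pideal[of \<zero>] by simp
qed

text \<open>
  Both sides are the dimension of \<open>X / (ker l \<inter> ker k)\<close>, computed from its two filtrations.
\<close>

lemma butterfly:
  assumes X: "right_module R X" and fg: "finitely_generated R X"
    and l: "l \<in> functionals R X" and k: "k \<in> functionals R X"
  shows "ideal_dim (l ` carrier X) \<otimes>\<^bsub>N\<^esub> ideal_dim (k ` carrier (kernel R X l)) =
    ideal_dim (k ` carrier X) \<otimes>\<^bsub>N\<^esub> ideal_dim (l ` carrier (kernel R X k))"
proof -
  note Kl = right_module_kernel[OF X l] finitely_generated_kernel[OF X fg l] functionals_kernel[OF k, of l]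
  note Kk = right_module_kernel[OF X k] finitely_generated_kernel[OF X fg k] functionals_kernel[OF l, of k]
  obtain g v where g: "g \<in> carrier R" "g \<otimes> g = g" "l ` carrier X = pideal R g"
    "v \<in> carrier X" "l v = g" "g \<odot>\<^bsub>X\<^esub> v = v" using functional_image_principal[OF X fg l] by metis
  obtain g' v' where g': "g' \<in> carrier R" "g' \<otimes> g' = g'" "k ` carrier X = pideal R g'"
    "v' \<in> carrier X" "k v' = g'" "g' \<odot>\<^bsub>X\<^esub> v' = v'" using functional_image_principal[OF X fg k] by metis
  obtain p where p: "p \<in> carrier R" "p \<otimes> p = p" "l ` carrier (kernel R X k) = pideal R p"
    using functional_image_principal[OF Kk] by metis
  obtain p' where p': "p' \<in> carrier R" "p' \<otimes> p' = p'" "k ` carrier (kernel R X l) = pideal R p'"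
    using functional_image_principal[OF Kl] by metis
  have absorb: "e \<otimes> q = q" if "pideal R q \<subseteq> pideal R e" "e \<in> carrier R" "e \<otimes> e = e" "q \<in> carrier R" for e q
  proof -
    have "q \<in> pideal R e" using generator_in_pideal[OF that(4)] that(1) by blast
    then obtain r where "r \<in> carrier R" "q = e \<otimes> r" by auto
    then show ?thesis using that by (simp flip: m_assoc)
  qed
  have gp: "g \<otimes> p = p" by (rule absorb) (use g p in \<open>auto simp flip: g(3) p(3)\<close>)
  have gp': "g' \<otimes> p' = p'" by (rule absorb) (use g' p' in \<open>auto simp flip: g'(3) p'(3)\<close>)
  let ?h = "g \<ominus> p \<otimes> g" and ?h' = "g' \<ominus> p' \<otimes> g'"
  have kc: "k v \<in> carrier R" "l v' \<in> carrier R"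
    using rmod_homD(1)[OF k g(4)] rmod_homD(1)[OF l g'(4)] by auto
  have "sim R ?h ?h'" unfolding sim_def
  proof (intro conjI bexI)
    show "(?h' \<otimes> k v) \<otimes> ?h = ?h' \<otimes> (k v \<otimes> ?h)" using kc g(1) g'(1) p(1) p'(1) by (simp add: m_assoc)
    show "(?h \<otimes> l v') \<otimes> ?h' = ?h \<otimes> (l v' \<otimes> ?h')" using kc g(1) g'(1) p(1) p'(1) by (simp add: m_assoc)
    show "(?h \<otimes> l v') \<otimes> ((?h' \<otimes> k v) \<otimes> ?h) = ?h"
      by (rule butterfly_complement[OF X l k g(4,5,6,1,2) p g'(4,5,1,2,3) p'(1,3) gp])
    show "(?h' \<otimes> k v) \<otimes> ((?h \<otimes> l v') \<otimes> ?h') = ?h'"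
      by (rule butterfly_complement[OF X k l g'(4,5,6,1,2) p' g(4,5,1,2,3) p(1,3) gp'])
  qed (use kc g g' p p' in auto)
  then have wh: "w ?h = w ?h'" by (rule dim_sim)
  have "w g \<otimes>\<^bsub>N\<^esub> w p' = w p \<otimes>\<^bsub>N\<^esub> w ?h \<otimes>\<^bsub>N\<^esub> w p'"
    using dim_split_idempotent[OF g(1) p(1) g(2) p(2) gp] by simp
  also have "\<dots> = w p' \<otimes>\<^bsub>N\<^esub> w ?h' \<otimes>\<^bsub>N\<^esub> w p"
    using wh g(1) g'(1) p(1) p'(1) by (simp add: N.m_ac)
  also have "\<dots> = w g' \<otimes>\<^bsub>N\<^esub> w p"
    using dim_split_idempotent[OF g'(1) p'(1) g'(2) p'(2) gp'] by simp
  finally show ?thesis using g(1,3) g'(1,3) p(1,3) p'(1,3) by simp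
qed

text \<open>
  The sum of the dimensions of the factors of the filtration of \<open>K\<close> by the kernels of longer
  and longer initial parts of the list.  What remains after the last functional does
  not contribute, so this measures \<open>K\<close> only if the list separates the elements of \<open>K\<close>.
\<close>

primrec filtered_dim :: "('a \<Rightarrow> 'r) list \<Rightarrow> 'a set \<Rightarrow> 'n" where
  "filtered_dim [] K = \<one>\<^bsub>N\<^esub>"
| "filtered_dim (l # ls) K = ideal_dim (l ` K) \<otimes>\<^bsub>N\<^esub> filtered_dim ls {x \<in> K. l x = \<zero>}"

lemma filtered_dim_closed [simp]: "filtered_dim ls K \<in> carrier N"
  by (induction ls arbitrary: K) auto

lemma filtered_dim_zero:
  assumes "\<And>l. l \<in> set ls \<Longrightarrow> l z = \<zero>"
  shows "filtered_dim ls {z} = \<one>\<^bsub>N\<^esub>"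
  using assms
proof (induction ls)
  case (Cons l ls)
  have lz: "l z = \<zero>" using Cons.prems by simp
  then have "{x \<in> {z}. l x = \<zero>} = {z}" by auto
  moreover have "filtered_dim ls {z} = \<one>\<^bsub>N\<^esub>" using Cons by simp
  ultimately show ?case by (simp add: lz)
qed simp

lemma separating_Nil:
  assumes "right_module R X" "separating R X []"
  shows "carrier X = {\<zero>\<^bsub>X\<^esub>}"
proof -
  interpret X: right_module R X by fact
  show ?thesis using assms(2) X.M.zero_closed by (auto simp: separating_def)
qed

text \<open>
  A further functional may be put in front of the list: the butterfly lemma moves it past each
  entry, and on the zero module that remains at the end it has value \<open>0\<close>.
\<close>

lemma filtered_dim_functional:
  assumes "right_module R X" "finitely_generated R X" "separating R X ls" "k \<in> functionals R X"
  shows "filtered_dim ls (carrier X) = ideal_dim (k ` carrier X) \<otimes>\<^bsub>N\<^esub> filtered_dim ls (carrier (kernel R X k))"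
  using assms
proof (induction ls arbitrary: X)
  case Nil
  then have "carrier X = {\<zero>\<^bsub>X\<^esub>}" using separating_Nil by blast
  then show ?case using rmod_hom_zero[OF Nil(1) right_module_regular Nil(4)] by simp
next
  case (Cons l ls)
  have l: "l \<in> functionals R X" using Cons by (simp add: separating_def)
  have "filtered_dim (l # ls) (carrier X) =
      ideal_dim (l ` carrier X) \<otimes>\<^bsub>N\<^esub> filtered_dim ls (carrier (kernel R X l))" by simp
  also have "filtered_dim ls (carrier (kernel R X l)) =
      ideal_dim (k ` carrier (kernel R X l)) \<otimes>\<^bsub>N\<^esub> filtered_dim ls (carrier (kernel R (kernel R X l) k))"
    by (rule Cons.IH[OF right_module_kernel[OF Cons(2) l] finitely_generated_kernel[OF Cons(2,3) l]
          separating_kernel[OF Cons(4)] functionals_kernel[OF Cons(5)]])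
  also have "carrier (kernel R (kernel R X l) k) = {x \<in> carrier (kernel R X k). l x = \<zero>}" by auto
  also have "ideal_dim (l ` carrier X) \<otimes>\<^bsub>N\<^esub> (ideal_dim (k ` carrier (kernel R X l)) \<otimes>\<^bsub>N\<^esub>
        filtered_dim ls {x \<in> carrier (kernel R X k). l x = \<zero>}) =
      (ideal_dim (l ` carrier X) \<otimes>\<^bsub>N\<^esub> ideal_dim (k ` carrier (kernel R X l))) \<otimes>\<^bsub>N\<^esub>
        filtered_dim ls {x \<in> carrier (kernel R X k). l x = \<zero>}"
    by (rule N.m_assoc[symmetric]) simp_all
  also have "\<dots> = (ideal_dim (k ` carrier X) \<otimes>\<^bsub>N\<^esub> ideal_dim (l ` carrier (kernel R X k))) \<otimes>\<^bsub>N\<^esub>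
        filtered_dim ls {x \<in> carrier (kernel R X k). l x = \<zero>}"
    by (subst butterfly[OF Cons(2,3) l Cons(5)]) (rule refl)
  also have "\<dots> = ideal_dim (k ` carrier X) \<otimes>\<^bsub>N\<^esub> (ideal_dim (l ` carrier (kernel R X k)) \<otimes>\<^bsub>N\<^esub>
        filtered_dim ls {x \<in> carrier (kernel R X k). l x = \<zero>})"
    by (rule N.m_assoc) simp_all
  finally show ?case by simp
qed

text \<open>
  Putting the functionals of the second list in front of the first one exhausts the module before
  the first list is reached.
\<close>

lemma filtered_dim_unique:
  assumes "right_module R X" "finitely_generated R X" "separating R X ls" "separating R X ms"
  shows "filtered_dim ls (carrier X) = filtered_dim ms (carrier X)"
  using assms
proof (induction ms arbitrary: X)
  case Nil
  then have "carrier X = {\<zero>\<^bsub>X\<^esub>}" using separating_Nil by blast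
  moreover have "filtered_dim ls {\<zero>\<^bsub>X\<^esub>} = \<one>\<^bsub>N\<^esub>"
    using Nil rmod_hom_zero[OF Nil(1) right_module_regular] by (intro filtered_dim_zero) (auto simp: separating_def)
  ultimately show ?case by simp
next
  case (Cons m ms)
  have m: "m \<in> functionals R X" using Cons by (simp add: separating_def)
  have "separating R (kernel R X m) ls"
    using Cons(4) functionals_kernel unfolding separating_def by force
  then have "filtered_dim ls (carrier (kernel R X m)) = filtered_dim ms (carrier (kernel R X m))"
    by (intro Cons.IH right_module_kernel finitely_generated_kernel separating_kernel[OF Cons(5)] Cons m)
  then show ?case using filtered_dim_functional[OF Cons(2-4) m] by simp
qed

lemma filtered_dim_image:
  "filtered_dim (map (\<lambda>l x. l (h x)) ls) K = filtered_dim ls (h ` K)"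
proof (induction ls arbitrary: K)
  case (Cons l ls)
  have "h ` {x \<in> K. l (h x) = \<zero>} = {x \<in> h ` K. l x = \<zero>}" by auto
  then show ?case using Cons by (simp add: image_image)
qed simp

lemma filtered_dim_product:
  assumes "a \<in> A" "b \<in> B" "\<And>l. l \<in> set ls \<Longrightarrow> l a = \<zero>" "\<And>m. m \<in> set ms \<Longrightarrow> m b = \<zero>"
  shows "filtered_dim (map (\<lambda>l x. l (fst x)) ls @ map (\<lambda>m x. m (snd x)) ms) (A \<times> B) =
    filtered_dim ls A \<otimes>\<^bsub>N\<^esub> filtered_dim ms B"
  using assms
proof (induction ls arbitrary: A)
  case Nil
  then have "snd ` (A \<times> B) = B" by auto
  then show ?case using filtered_dim_image[of snd ms "A \<times> B"] by simp
next
  case (Cons l ls)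
  have im: "(\<lambda>x. l (fst x)) ` (A \<times> B) = l ` A" using Cons(3) by force
  have eq: "{x \<in> A \<times> B. l (fst x) = \<zero>} = {x \<in> A. l x = \<zero>} \<times> B" by auto
  have "filtered_dim (map (\<lambda>l x. l (fst x)) ls @ map (\<lambda>m x. m (snd x)) ms) ({x \<in> A. l x = \<zero>} \<times> B) =
    filtered_dim ls {x \<in> A. l x = \<zero>} \<otimes>\<^bsub>N\<^esub> filtered_dim ms B"
    by (rule Cons.IH) (use Cons.prems in auto)
  then show ?case by (simp add: im eq N.m_assoc)
qed

definition class_dim :: "('r, nat \<Rightarrow> 'r) module set \<Rightarrow> 'n" where
  "class_dim C = (SOME n. \<exists>X\<in>C. \<exists>ls. separating R X ls \<and> n = filtered_dim ls (carrier X))"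

lemma class_dim_eq:
  assumes X: "represented R X" and ls: "separating R X ls"
  shows "class_dim (iso_class R X) = filtered_dim ls (carrier X)"
proof -
  have *: "filtered_dim ms (carrier Y) = filtered_dim ls (carrier X)"
    if Y: "Y \<in> iso_class R X" and ms: "separating R Y ms" for Y ms
  proof -
    have mY: "right_module R Y" "finitely_generated R Y" and iso: "rmod_isomorphic R Y X"
      using Y by (auto simp: iso_class_def fgp_def)
    have mX: "right_module R X" using X by (simp add: represented_def)
    obtain h k where h: "h \<in> rmod_hom R Y X" "k \<in> rmod_hom R X Y"
      "\<And>x. x \<in> carrier Y \<Longrightarrow> k (h x) = x" "\<And>y. y \<in> carrier X \<Longrightarrow> h (k y) = y"
      using rmod_isomorphicE[OF mY(1) iso] by blast
    have "separating R Y (map (\<lambda>l x. l (h x)) ls)"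
      unfolding separating_def
    proof (intro conjI ballI impI)
      show "set (map (\<lambda>l x. l (h x)) ls) \<subseteq> functionals R Y"
        using ls rmod_hom_comp[OF h(1)] by (auto simp: separating_def)
      fix y assume y: "y \<in> carrier Y" "\<forall>l\<in>set (map (\<lambda>l x. l (h x)) ls). l y = \<zero>"
      then have "h y = \<zero>\<^bsub>X\<^esub>" using ls rmod_homD(1)[OF h(1)] by (auto simp: separating_def)
      then show "y = \<zero>\<^bsub>Y\<^esub>" using h(3)[OF y(1)] rmod_hom_zero[OF mX mY(1) h(2)] by simp
    qed
    from filtered_dim_unique[OF mY ms this]
    have "filtered_dim ms (carrier Y) = filtered_dim ls (h ` carrier Y)" by (simp add: filtered_dim_image)
    moreover have "h ` carrier Y = carrier X"
      using h(4) rmod_homD(1)[OF h(1)] rmod_homD(1)[OF h(2)] by force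
    ultimately show ?thesis by simp
  qed
  obtain Y where Y: "Y \<in> fgp R" "rmod_isomorphic R Y X" using X by (auto simp: represented_def)
  then obtain ms where "separating R Y ms" using fgproj_separating fgp_iff by metis
  moreover have "Y \<in> iso_class R X" using Y by (simp add: iso_class_def)
  ultimately have "\<exists>n. \<exists>Y\<in>iso_class R X. \<exists>ls. separating R Y ls \<and> n = filtered_dim ls (carrier Y)" by blast
  from someI_ex[OF this] obtain Y' ms' where "Y' \<in> iso_class R X" "separating R Y' ms'"
    "class_dim (iso_class R X) = filtered_dim ms' (carrier Y')"
    unfolding class_dim_def by blast
  then show ?thesis using * by simp
qed

lemma class_dim_pclass: 
  assumes "x \<in> carrier R"
  shows "class_dim (pclass R x) = w x"
proof -
  have "separating R (principal_rmod R x) [\<lambda>z. z]"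
    unfolding separating_def using assms by (auto intro!: rmod_homI)
  from class_dim_eq[OF represented_principal[OF assms] this] show ?thesis
    using assms by (simp add: pclass_def)
qed

text \<open>
  The existence part of the universal property; uniqueness is \<open>V_hom_eqI\<close>.
\<close>

lemma class_dim_hom: "class_dim \<in> hom (V R) N"
proof (rule homI)
  fix C assume "C \<in> carrier (V R)"
  then obtain X where X: "X \<in> fgp R" "C = iso_class R X" using V_elem by blast
  obtain ls where ls: "separating R X ls" using fgproj_separating X fgp_iff by metis
  note rX = represented_fgp[OF X(1)]
  have mX: "right_module R X" using X by (simp add: fgp_def)
  show "class_dim C \<in> carrier N" unfolding X using class_dim_eq[OF rX ls] by simp
  fix D assume "D \<in> carrier (V R)"
  then obtain Y where Y: "Y \<in> fgp R" "D = iso_class R Y" using V_elem by blast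
  obtain ms where ms: "separating R Y ms" using fgproj_separating Y fgp_iff by metis
  note rY = represented_fgp[OF Y(1)]
  have mY: "right_module R Y" using Y by (simp add: fgp_def)
  interpret X: right_module R X by fact
  interpret Y: right_module R Y by fact
  let ?zs = "map (\<lambda>l x. l (fst x)) ls @ map (\<lambda>m x. m (snd x)) ms"
  have l0: "l \<zero>\<^bsub>X\<^esub> = \<zero>" if "l \<in> set ls" for l
    using rmod_hom_zero[OF mX right_module_regular, of l] ls that by (auto simp: separating_def)
  have m0: "m \<zero>\<^bsub>Y\<^esub> = \<zero>" if "m \<in> set ms" for m
    using rmod_hom_zero[OF mY right_module_regular, of m] ms that by (auto simp: separating_def)
  have "separating R (direct_sum X Y) ?zs"
    unfolding separating_def
  proof (intro conjI ballI impI)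
    show "set ?zs \<subseteq> functionals R (direct_sum X Y)"
      using ls ms
      by (auto simp: separating_def subset_iff intro: rmod_hom_comp[OF rmod_hom_fst] rmod_hom_comp[OF rmod_hom_snd])
    fix x assume "x \<in> carrier (direct_sum X Y)" "\<forall>l\<in>set ?zs. l x = \<zero>"
    then show "x = \<zero>\<^bsub>direct_sum X Y\<^esub>" using ls ms by (cases x) (auto simp: separating_def ball_Un)
  qed
  from class_dim_eq[OF represented_direct_sum[OF rX rY] this]
  have "class_dim (C \<otimes>\<^bsub>V R\<^esub> D) = filtered_dim ?zs (carrier X \<times> carrier Y)"
    unfolding X Y by (simp add: iso_class_mult rX rY)
  also have "\<dots> = filtered_dim ls (carrier X) \<otimes>\<^bsub>N\<^esub> filtered_dim ms (carrier Y)"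
    using l0 m0 by (intro filtered_dim_product[of "\<zero>\<^bsub>X\<^esub>" _ "\<zero>\<^bsub>Y\<^esub>"]) auto
  finally show "class_dim (C \<otimes>\<^bsub>V R\<^esub> D) = class_dim C \<otimes>\<^bsub>N\<^esub> class_dim D"
    unfolding X Y using class_dim_eq[OF rX ls] class_dim_eq[OF rY ms] by simp
qed

lemma class_dim_one: "class_dim \<one>\<^bsub>V R\<^esub> = \<one>\<^bsub>N\<^esub>"
  by (simp add: V_one class_dim_pclass)

end

section \<open>Functoriality of V\<close>

lemma sim_ring_hom:
  assumes "ring R" "f \<in> ring_hom R S" "sim R x y"
  shows "sim S (f x) (f y)"
proof -
  interpret R: ring R by fact
  obtain c d a b where s: "x \<in> carrier R" "y \<in> carrier R"
    "c \<in> carrier R" "d \<in> carrier R" "a \<in> carrier R" "b \<in> carrier R"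
    "c \<otimes>\<^bsub>R\<^esub> x = y \<otimes>\<^bsub>R\<^esub> a" "d \<otimes>\<^bsub>R\<^esub> y = x \<otimes>\<^bsub>R\<^esub> b"
    "d \<otimes>\<^bsub>R\<^esub> (c \<otimes>\<^bsub>R\<^esub> x) = x" "c \<otimes>\<^bsub>R\<^esub> (d \<otimes>\<^bsub>R\<^esub> y) = y"
    using assms(3) by (rule simE)
  note m = ring_hom_mult[OF assms(2), symmetric] and cl = ring_hom_closed[OF assms(2)]
  show ?thesis
    unfolding sim_def
  proof (intro conjI bexI)
    show "f c \<otimes>\<^bsub>S\<^esub> f x = f y \<otimes>\<^bsub>S\<^esub> f a" "f d \<otimes>\<^bsub>S\<^esub> f y = f x \<otimes>\<^bsub>S\<^esub> f b"
      using s(1-8) by (simp_all add: m)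
    show "f d \<otimes>\<^bsub>S\<^esub> (f c \<otimes>\<^bsub>S\<^esub> f x) = f x"
      using s(9) m[OF s(4) R.m_closed[OF s(3,1)]] m[OF s(3,1)] by simp
    show "f c \<otimes>\<^bsub>S\<^esub> (f d \<otimes>\<^bsub>S\<^esub> f y) = f y"
      using s(10) m[OF s(3) R.m_closed[OF s(4,2)]] m[OF s(4,2)] by simp
  qed (use s cl in auto)
qed

text \<open>
  The description defining \<^const>\<open>V_map\<close> is satisfied by exactly one function: the class of
  \<open>f(x)S\<close> is a dimension function of \<open>x\<close>.
\<close>

lemma V_map_char:
  assumes R: "vn_regular R" and S: "vn_regular S" and f: "f \<in> ring_hom R S"
  shows V_map_hom: "V_map R S f \<in> hom (V R) (V S)"
    and V_map_one: "V_map R S f \<one>\<^bsub>V R\<^esub> = \<one>\<^bsub>V S\<^esub>"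
    and V_map_pclass: "x \<in> carrier R \<Longrightarrow> V_map R S f (pclass R x) = pclass S (f x)"
proof -
  interpret R: vn_regular R by fact
  interpret S: vn_regular S by fact
  interpret VS: comm_monoid "V S" by (rule S.comm_monoid_V)
  have f0: "f \<zero>\<^bsub>R\<^esub> = \<zero>\<^bsub>S\<^esub>" by (rule ring_hom_zero[OF f R.ring_axioms S.ring_axioms])
  note cl = ring_hom_closed[OF f]
  interpret D: dimension R "V S" "\<lambda>x. pclass S (f x)"
  proof
    show "pclass S (f \<zero>\<^bsub>R\<^esub>) = \<one>\<^bsub>V S\<^esub>" by (simp add: f0 S.V_one)
    show "pclass S (f x) = pclass S (f y)" if "sim R x y" for x y
      by (rule S.pclass_sim[OF sim_ring_hom[OF R.ring_axioms f that]])
    show "pclass S (f (x \<oplus>\<^bsub>R\<^esub> y)) = pclass S (f x) \<otimes>\<^bsub>V S\<^esub> pclass S (f y)"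
      if "x \<in> carrier R" "y \<in> carrier R" "x \<otimes>\<^bsub>R\<^esub> x = x" "y \<otimes>\<^bsub>R\<^esub> y = y"
        "x \<otimes>\<^bsub>R\<^esub> y = \<zero>\<^bsub>R\<^esub>" "y \<otimes>\<^bsub>R\<^esub> x = \<zero>\<^bsub>R\<^esub>" for x y
      unfolding ring_hom_add[OF f that(1,2)]
      by (rule S.pclass_add) (use that f0 cl in \<open>auto simp flip: ring_hom_mult[OF f]\<close>)
  qed (use cl in auto)
  let ?P = "\<lambda>h. h \<in> extensional (carrier (V R)) \<and> h \<in> hom (V R) (V S) \<and> h \<one>\<^bsub>V R\<^esub> = \<one>\<^bsub>V S\<^esub> \<and>
    (\<forall>x\<in>carrier R. h (pclass R x) = pclass S (f x))"
  have one: "\<one>\<^bsub>V R\<^esub> \<in> carrier (V R)" by (simp add: R.V_one)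
  interpret VR: comm_monoid "V R" by (rule R.comm_monoid_V)
  have "?P (restrict D.class_dim (carrier (V R)))"
    using D.class_dim_hom D.class_dim_one D.class_dim_pclass one
    by (auto simp: hom_def Pi_iff)
  moreover have "h = k" if "?P h" "?P k" for h k
  proof
    fix C
    show "h C = k C"
    proof (cases "C \<in> carrier (V R)")
      case True
      show ?thesis
        by (rule R.V_hom_eqI[OF S.comm_monoid_V _ _ _ _ True]) (simp_all add: that)
    next
      case False
      then show ?thesis using that by (auto simp: extensional_def)
    qed
  qed
  ultimately have "\<exists>!h. ?P h" by blast
  from theI'[OF this] have "?P (V_map R S f)" unfolding V_map_def pclass_def .
  then show "V_map R S f \<in> hom (V R) (V S)" "V_map R S f \<one>\<^bsub>V R\<^esub> = \<one>\<^bsub>V S\<^esub>"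
    "x \<in> carrier R \<Longrightarrow> V_map R S f (pclass R x) = pclass S (f x)" by auto
qed

section \<open>Direct limits of quotient rings\<close>

text \<open>
  If \<open>'r\<close> is infinite, then it is as large as \<open>nat \<times> 'r\<close>, which maps onto the union.  If it is
  finite, then the members of the sequence have bounded size, and every finite subset of the union is
  contained in one of them.
\<close>

lemma increasing_union_injection:
  fixes c :: "nat \<Rightarrow> 'r \<Rightarrow> 'q"
  assumes mono: "\<And>n. c n ` S n \<subseteq> c (Suc n) ` S (Suc n)"
  shows "\<exists>j :: 'q \<Rightarrow> 'r. inj_on j (\<Union>n. c n ` S n)"
proof (cases "finite (UNIV :: 'r set)")
  case True
  define A where "A n = c n ` S n" for n
  have mono': "A n \<subseteq> A m" if "n \<le> m" for n m
    using lift_Suc_mono_le[of A, OF _ that] mono by (simp add: A_def)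
  have bd: "card G \<le> card (UNIV :: 'r set)" if "finite G" "G \<subseteq> (\<Union>n. A n)" for G
  proof -
    have "\<exists>n. G \<subseteq> A n"
      using that
    proof (induction G)
      case (insert q G)
      then obtain n m where nm: "G \<subseteq> A n" "q \<in> A m" by auto
      have "A n \<subseteq> A (max n m)" "A m \<subseteq> A (max n m)" by (simp_all add: mono')
      then have "insert q G \<subseteq> A (max n m)" using nm by blast
      then show ?case by blast
    qed simp
    then obtain n where n: "G \<subseteq> c n ` S n" unfolding A_def by blast
    have fS: "finite (S n)" by (rule finite_subset[OF subset_UNIV True])
    have "card G \<le> card (c n ` S n)" using n fS by (intro card_mono) auto
    also have "\<dots> \<le> card (S n)" using fS by (rule card_image_le)
    also have "\<dots> \<le> card (UNIV :: 'r set)" using True by (intro card_mono) auto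
    finally show ?thesis .
  qed
  have "finite (\<Union>n. c n ` S n) \<and> card (\<Union>n. c n ` S n) \<le> card (UNIV :: 'r set)"
    by (rule finite_if_finite_subsets_card_bdd) (use bd A_def in auto)
  then obtain f :: "'q \<Rightarrow> 'r" where "inj_on f (\<Union>n. c n ` S n)" using card_le_inj[OF _ True] by metis
  then show ?thesis by blast
next
  case False
  have "(card_of (UNIV :: nat set), card_of (UNIV :: 'r set)) \<in> ordLeq"
    using False by (simp add: infinite_iff_card_of_nat)
  then have prod: "(card_of ((UNIV :: nat set) \<times> (UNIV :: 'r set)), card_of (UNIV :: 'r set)) \<in> ordIso"
    by (rule conjunct2[OF card_of_Times_infinite[OF False UNIV_not_empty]])
  have "(\<Union>n. c n ` S n) \<subseteq> (\<lambda>(n, x). c n x) ` (UNIV \<times> UNIV)"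
  proof
    fix q assume "q \<in> (\<Union>n. c n ` S n)"
    then obtain n x where "q = c n x" by blast
    then show "q \<in> (\<lambda>(n, x). c n x) ` (UNIV \<times> UNIV)" by (intro image_eqI[of _ _ "(n, x)"]) simp_all
  qed
  then have "(card_of (\<Union>n. c n ` S n), card_of ((UNIV :: nat set) \<times> (UNIV :: 'r set))) \<in> ordLeq"
    by (rule surj_imp_ordLeq)
  then have "(card_of (\<Union>n. c n ` S n), card_of (UNIV :: 'r set)) \<in> ordLeq"
    by (rule ordLeq_ordIso_trans[OF _ prod])
  then show ?thesis unfolding card_of_ordLeq[symmetric] by blast
qed

lemma ring_hom_diff:
  assumes "ring R" "ring S" "f \<in> ring_hom R S" "x \<in> carrier R" "y \<in> carrier R"
  shows "f (x \<ominus>\<^bsub>R\<^esub> y) = f x \<ominus>\<^bsub>S\<^esub> f y"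
proof -
  interpret R: ring R by fact
  interpret S: ring S by fact
  have "f (\<ominus>\<^bsub>R\<^esub> y) \<oplus>\<^bsub>S\<^esub> f y = \<zero>\<^bsub>S\<^esub>"
    using assms ring_hom_add[OF assms(3), of "\<ominus>\<^bsub>R\<^esub> y" y] ring_hom_zero[OF assms(3,1,2)] by (simp add: R.l_neg)
  then have "\<ominus>\<^bsub>S\<^esub> f y = f (\<ominus>\<^bsub>R\<^esub> y)"
    using ring_hom_closed[OF assms(3)] assms(5) by (intro S.minus_equality) auto
  then show ?thesis using ring_hom_add[OF assms(3), of x "\<ominus>\<^bsub>R\<^esub> y"] assms by (simp add: R.minus_eq S.minus_eq)
qed

text \<open>
  The last condition makes the induced maps \<open>E\<^sub>n / I\<^sub>n \<rightarrow> E\<^sub>m / I\<^sub>m\<close> well-defined and one-to-one.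
\<close>

locale ring_sequence =
  fixes E :: "nat \<Rightarrow> 'r ring" and e :: "nat \<Rightarrow> nat \<Rightarrow> 'r \<Rightarrow> 'r" and I :: "nat \<Rightarrow> 'r set"
  assumes E_ring: "ring (E n)"
    and e_hom: "n \<le> m \<Longrightarrow> e n m \<in> ring_hom (E n) (E m)"
    and e_id: "x \<in> carrier (E n) \<Longrightarrow> e n n x = x"
    and e_comp: "n \<le> m \<Longrightarrow> m \<le> k \<Longrightarrow> x \<in> carrier (E n) \<Longrightarrow> e m k (e n m x) = e n k x"
    and I_ideal: "ideal (I n) (E n)"
    and I_iff: "n \<le> m \<Longrightarrow> x \<in> carrier (E n) \<Longrightarrow> e n m x \<in> I m \<longleftrightarrow> x \<in> I n"
begin

lemma e_closed: "n \<le> m \<Longrightarrow> x \<in> carrier (E n) \<Longrightarrow> e n m x \<in> carrier (E m)"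
  using ring_hom_closed[OF e_hom] .

definition elements :: "(nat \<times> 'r) set" where
  "elements = (SIGMA n:UNIV. carrier (E n))"

text \<open>
  The limit of the quotients is constructed in one step from the disjoint union of the \<open>E\<^sub>n\<close>.
\<close>

definition limit_rel :: "((nat \<times> 'r) \<times> (nat \<times> 'r)) set" where
  "limit_rel = {((n, x), (m, y)). x \<in> carrier (E n) \<and> y \<in> carrier (E m) \<and>
    e n (max n m) x \<ominus>\<^bsub>E (max n m)\<^esub> e m (max n m) y \<in> I (max n m)}"

lemma limit_rel_iff:
  assumes "x \<in> carrier (E n)" "y \<in> carrier (E m)" "n \<le> k" "m \<le> k"
  shows "((n, x), (m, y)) \<in> limit_rel \<longleftrightarrow> e n k x \<ominus>\<^bsub>E k\<^esub> e m k y \<in> I k"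
proof -
  let ?l = "max n m"
  interpret l: ring "E ?l" by (rule E_ring)
  have c: "e n ?l x \<in> carrier (E ?l)" "e m ?l y \<in> carrier (E ?l)" using assms e_closed by auto
  have "e n k x \<ominus>\<^bsub>E k\<^esub> e m k y = e ?l k (e n ?l x \<ominus>\<^bsub>E ?l\<^esub> e m ?l y)"
    using ring_hom_diff[OF E_ring E_ring e_hom c, of k] assms e_comp[of n ?l k x] e_comp[of m ?l k y] by simp
  moreover have "e ?l k (e n ?l x \<ominus>\<^bsub>E ?l\<^esub> e m ?l y) \<in> I k \<longleftrightarrow> e n ?l x \<ominus>\<^bsub>E ?l\<^esub> e m ?l y \<in> I ?l"
    using c assms by (intro I_iff) auto
  ultimately show ?thesis using assms by (simp add: limit_rel_def)
qed

lemma I_sub: "x \<in> I n \<Longrightarrow> y \<in> I n \<Longrightarrow> x \<oplus>\<^bsub>E n\<^esub> y \<in> I n"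
  "x \<in> I n \<Longrightarrow> \<ominus>\<^bsub>E n\<^esub> x \<in> I n" "\<zero>\<^bsub>E n\<^esub> \<in> I n" "x \<in> I n \<Longrightarrow> x \<in> carrier (E n)"
  using additive_subgroup.a_closed[OF ideal.axioms(1)[OF I_ideal]]
    additive_subgroup.zero_closed[OF ideal.axioms(1)[OF I_ideal]]
    additive_subgroup.a_Hcarr[OF ideal.axioms(1)[OF I_ideal]]
    additive_subgroup.a_inv_closed[OF ideal.axioms(1)[OF I_ideal]]
  by auto

lemma limit_rel_equiv: "equiv elements limit_rel"
proof (rule equivI)
  show "refl_on elements limit_rel"
  proof (rule refl_onI)
    fix a assume "a \<in> elements"
    then obtain n x where a: "a = (n, x)" "x \<in> carrier (E n)" by (auto simp: elements_def)
    interpret ring "E n" by (rule E_ring)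
    show "(a, a) \<in> limit_rel" using a e_id I_sub(3)[of n] by (simp add: limit_rel_def minus_eq r_neg)
  qed
  show "sym limit_rel"
  proof (rule symI)
    fix a b assume ab: "(a, b) \<in> limit_rel"
    then obtain n x m y where a: "a = (n, x)" "b = (m, y)" "x \<in> carrier (E n)" "y \<in> carrier (E m)"
      by (auto simp: limit_rel_def)
    let ?k = "max n m"
    interpret ring "E ?k" by (rule E_ring)
    have c: "e n ?k x \<in> carrier (E ?k)" "e m ?k y \<in> carrier (E ?k)" using a e_closed by auto
    have "e m ?k y \<ominus>\<^bsub>E ?k\<^esub> e n ?k x = \<ominus>\<^bsub>E ?k\<^esub> (e n ?k x \<ominus>\<^bsub>E ?k\<^esub> e m ?k y)"
      using c by (simp add: minus_eq minus_add a_comm)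
    then show "(b, a) \<in> limit_rel"
      using ab a limit_rel_iff[of x n y m ?k] limit_rel_iff[of y m x n ?k] I_sub(2) by simp
  qed
  show "trans limit_rel"
  proof (rule transI)
    fix a b c assume ab: "(a, b) \<in> limit_rel" and bc: "(b, c) \<in> limit_rel"
    obtain n x m y where a: "a = (n, x)" "b = (m, y)" "x \<in> carrier (E n)" "y \<in> carrier (E m)"
      using ab by (auto simp: limit_rel_def)
    obtain p z where c: "c = (p, z)" "z \<in> carrier (E p)" using bc by (auto simp: limit_rel_def)
    let ?k = "max n (max m p)"
    interpret ring "E ?k" by (rule E_ring)
    have cl: "e n ?k x \<in> carrier (E ?k)" "e m ?k y \<in> carrier (E ?k)" "e p ?k z \<in> carrier (E ?k)"
      using a c e_closed by auto
    have "e n ?k x \<ominus>\<^bsub>E ?k\<^esub> e p ?k z =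
        (e n ?k x \<ominus>\<^bsub>E ?k\<^esub> e m ?k y) \<oplus>\<^bsub>E ?k\<^esub> (e m ?k y \<ominus>\<^bsub>E ?k\<^esub> e p ?k z)"
      using cl by (simp add: ring_simprules)
    then show "(a, c) \<in> limit_rel"
      using ab bc a c limit_rel_iff[of x n y m ?k] limit_rel_iff[of y m z p ?k] limit_rel_iff[of x n z p ?k] I_sub(1)
      by simp
  qed
qed (auto simp: limit_rel_def elements_def)

lemma colimit_maps_exist:
  "\<exists>\<eta> :: nat \<Rightarrow> 'r \<Rightarrow> 'r. \<forall>n m k x y. x \<in> carrier (E n) \<longrightarrow> y \<in> carrier (E m) \<longrightarrow> n \<le> k \<longrightarrow> m \<le> k \<longrightarrow>
    (\<eta> n x = \<eta> m y \<longleftrightarrow> e n k x \<ominus>\<^bsub>E k\<^esub> e m k y \<in> I k)"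
proof -
  define c where "c n x = limit_rel `` {(n, x)}" for n x
  have ceq: "c n x = c m y \<longleftrightarrow> ((n, x), (m, y)) \<in> limit_rel" if "x \<in> carrier (E n)" "y \<in> carrier (E m)" for n m x y
    unfolding c_def using that by (intro eq_equiv_class_iff[OF limit_rel_equiv]) (auto simp: elements_def)
  have "c n ` carrier (E n) \<subseteq> c (Suc n) ` carrier (E (Suc n))" for n
  proof
    fix q assume "q \<in> c n ` carrier (E n)"
    then obtain x where x: "x \<in> carrier (E n)" "q = c n x" by blast
    interpret ring "E (Suc n)" by (rule E_ring)
    have x': "e n (Suc n) x \<in> carrier (E (Suc n))" using x e_closed by simp
    have "((n, x), (Suc n, e n (Suc n) x)) \<in> limit_rel"
      using limit_rel_iff[OF x(1) x', of "Suc n"] x' e_id[OF x'] I_sub(3)[of "Suc n"] by (simp add: minus_eq r_neg)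
    then have "q = c (Suc n) (e n (Suc n) x)" using ceq x x' by simp
    then show "q \<in> c (Suc n) ` carrier (E (Suc n))" using x' by blast
  qed
  from increasing_union_injection[of c, OF this]
  obtain j :: "(nat \<times> 'r) set \<Rightarrow> 'r" where j: "inj_on j (\<Union>n. c n ` carrier (E n))" by blast
  have "j (c n x) = j (c m y) \<longleftrightarrow> ((n, x), (m, y)) \<in> limit_rel"
    if "x \<in> carrier (E n)" "y \<in> carrier (E m)" for n m x y
    using inj_on_eq_iff[OF j, of "c n x" "c m y"] that ceq by blast
  then show ?thesis using limit_rel_iff by (intro exI[of _ "\<lambda>n x. j (c n x)"]) auto
qed

definition eta :: "nat \<Rightarrow> 'r \<Rightarrow> 'r" where
  "eta = (SOME \<eta>. \<forall>n m k x y. x \<in> carrier (E n) \<longrightarrow> y \<in> carrier (E m) \<longrightarrow> n \<le> k \<longrightarrow> m \<le> k \<longrightarrow>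
    (\<eta> n x = \<eta> m y \<longleftrightarrow> e n k x \<ominus>\<^bsub>E k\<^esub> e m k y \<in> I k))"

lemma eta_eq_iff:
  assumes "x \<in> carrier (E n)" "y \<in> carrier (E m)" "n \<le> k" "m \<le> k"
  shows "eta n x = eta m y \<longleftrightarrow> e n k x \<ominus>\<^bsub>E k\<^esub> e m k y \<in> I k"
  using someI_ex[OF colimit_maps_exist] assms unfolding eta_def by blast

lemma eta_eq_iff_same:
  assumes "x \<in> carrier (E n)" "y \<in> carrier (E n)"
  shows "eta n x = eta n y \<longleftrightarrow> x \<ominus>\<^bsub>E n\<^esub> y \<in> I n"
  using eta_eq_iff[OF assms, of n] e_id assms by simp

lemma eta_e:
  assumes "n \<le> m" "x \<in> carrier (E n)"
  shows "eta m (e n m x) = eta n x"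
proof -
  interpret ring "E m" by (rule E_ring)
  have "e n m x \<in> carrier (E m)" using assms e_closed by simp
  then show ?thesis using eta_eq_iff[of "e n m x" m x n m] assms e_id[of "e n m x" m] I_sub(3)[of m]
    by (simp add: minus_eq r_neg)
qed

text \<open>
  The elements are the values of the canonical maps \<open>eta n\<close>; operations are performed at any stage at
  which both arguments are present.
\<close>

definition limit_ring :: "'r ring" where
  "limit_ring = \<lparr>carrier = (\<Union>n. eta n ` carrier (E n)),
    monoid.mult = (\<lambda>a b. THE c. \<exists>n. \<exists>x\<in>carrier (E n). \<exists>y\<in>carrier (E n).
      a = eta n x \<and> b = eta n y \<and> c = eta n (x \<otimes>\<^bsub>E n\<^esub> y)),
    one = eta 0 \<one>\<^bsub>E 0\<^esub>, zero = eta 0 \<zero>\<^bsub>E 0\<^esub>,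
    add = (\<lambda>a b. THE c. \<exists>n. \<exists>x\<in>carrier (E n). \<exists>y\<in>carrier (E n).
      a = eta n x \<and> b = eta n y \<and> c = eta n (x \<oplus>\<^bsub>E n\<^esub> y))\<rparr>"

lemma eta_cong:
  assumes x: "x \<in> carrier (E n)" "y \<in> carrier (E n)" and x': "x' \<in> carrier (E m)" "y' \<in> carrier (E m)"
    and eq: "eta n x = eta m x'" "eta n y = eta m y'"
  shows "eta n (x \<oplus>\<^bsub>E n\<^esub> y) = eta m (x' \<oplus>\<^bsub>E m\<^esub> y')" "eta n (x \<otimes>\<^bsub>E n\<^esub> y) = eta m (x' \<otimes>\<^bsub>E m\<^esub> y')"
proof -
  define k where "k = max n m"
  have k: "n \<le> k" "m \<le> k" by (auto simp: k_def)
  interpret n: ring "E n" by (rule E_ring)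
  interpret m: ring "E m" by (rule E_ring)
  interpret k: ring "E k" by (rule E_ring)
  interpret I: ideal "I k" "E k" by (rule I_ideal)
  let ?x = "e n k x" and ?y = "e n k y" and ?x' = "e m k x'" and ?y' = "e m k y'"
  have c: "?x \<in> carrier (E k)" "?y \<in> carrier (E k)" "?x' \<in> carrier (E k)" "?y' \<in> carrier (E k)"
    using x x' k e_closed by auto
  have 1: "?x \<ominus>\<^bsub>E k\<^esub> ?x' \<in> I k" using eta_eq_iff[OF x(1) x'(1) k] eq(1) by simp
  have 2: "?y \<ominus>\<^bsub>E k\<^esub> ?y' \<in> I k" using eta_eq_iff[OF x(2) x'(2) k] eq(2) by simp
  have "(?x \<oplus>\<^bsub>E k\<^esub> ?y) \<ominus>\<^bsub>E k\<^esub> (?x' \<oplus>\<^bsub>E k\<^esub> ?y') = (?x \<ominus>\<^bsub>E k\<^esub> ?x') \<oplus>\<^bsub>E k\<^esub> (?y \<ominus>\<^bsub>E k\<^esub> ?y')"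
    using c by (simp add: k.ring_simprules)
  then have "(?x \<oplus>\<^bsub>E k\<^esub> ?y) \<ominus>\<^bsub>E k\<^esub> (?x' \<oplus>\<^bsub>E k\<^esub> ?y') \<in> I k" using 1 2 I_sub(1) by simp
  then show "eta n (x \<oplus>\<^bsub>E n\<^esub> y) = eta m (x' \<oplus>\<^bsub>E m\<^esub> y')"
    using eta_eq_iff[of "x \<oplus>\<^bsub>E n\<^esub> y" n "x' \<oplus>\<^bsub>E m\<^esub> y'" m k] x x' k
      ring_hom_add[OF e_hom[OF k(1)]] ring_hom_add[OF e_hom[OF k(2)]] by simp
  have "(?x \<otimes>\<^bsub>E k\<^esub> ?y) \<ominus>\<^bsub>E k\<^esub> (?x' \<otimes>\<^bsub>E k\<^esub> ?y') =
      (?x \<ominus>\<^bsub>E k\<^esub> ?x') \<otimes>\<^bsub>E k\<^esub> ?y \<oplus>\<^bsub>E k\<^esub> ?x' \<otimes>\<^bsub>E k\<^esub> (?y \<ominus>\<^bsub>E k\<^esub> ?y')"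
    using c by (simp add: k.minus_eq k.l_distr k.r_distr k.l_minus k.r_minus k.a_assoc k.r_neg1)
  moreover have "(?x \<ominus>\<^bsub>E k\<^esub> ?x') \<otimes>\<^bsub>E k\<^esub> ?y \<in> I k" "?x' \<otimes>\<^bsub>E k\<^esub> (?y \<ominus>\<^bsub>E k\<^esub> ?y') \<in> I k"
    using 1 2 c I.I_l_closed I.I_r_closed by auto
  ultimately have "(?x \<otimes>\<^bsub>E k\<^esub> ?y) \<ominus>\<^bsub>E k\<^esub> (?x' \<otimes>\<^bsub>E k\<^esub> ?y') \<in> I k" using I_sub(1) by simp
  then show "eta n (x \<otimes>\<^bsub>E n\<^esub> y) = eta m (x' \<otimes>\<^bsub>E m\<^esub> y')"
    using eta_eq_iff[of "x \<otimes>\<^bsub>E n\<^esub> y" n "x' \<otimes>\<^bsub>E m\<^esub> y'" m k] x x' k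
      ring_hom_mult[OF e_hom[OF k(1)]] ring_hom_mult[OF e_hom[OF k(2)]] by simp
qed

lemma eta_add:
  assumes "x \<in> carrier (E n)" "y \<in> carrier (E n)"
  shows "eta n x \<oplus>\<^bsub>limit_ring\<^esub> eta n y = eta n (x \<oplus>\<^bsub>E n\<^esub> y)"
proof -
  have "(THE c. \<exists>m. \<exists>x'\<in>carrier (E m). \<exists>y'\<in>carrier (E m).
      eta n x = eta m x' \<and> eta n y = eta m y' \<and> c = eta m (x' \<oplus>\<^bsub>E m\<^esub> y')) = eta n (x \<oplus>\<^bsub>E n\<^esub> y)"
  proof (rule the_equality)
    show "\<exists>m. \<exists>x'\<in>carrier (E m). \<exists>y'\<in>carrier (E m). eta n x = eta m x' \<and> eta n y = eta m y' \<and>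
        eta n (x \<oplus>\<^bsub>E n\<^esub> y) = eta m (x' \<oplus>\<^bsub>E m\<^esub> y')"
      using assms by (intro exI[of _ n] bexI[of _ x] bexI[of _ y]) simp_all
    fix c assume "\<exists>m. \<exists>x'\<in>carrier (E m). \<exists>y'\<in>carrier (E m).
      eta n x = eta m x' \<and> eta n y = eta m y' \<and> c = eta m (x' \<oplus>\<^bsub>E m\<^esub> y')"
    then obtain m x' y' where "x' \<in> carrier (E m)" "y' \<in> carrier (E m)"
      "eta n x = eta m x'" "eta n y = eta m y'" "c = eta m (x' \<oplus>\<^bsub>E m\<^esub> y')" by blast
    then show "c = eta n (x \<oplus>\<^bsub>E n\<^esub> y)" using eta_cong(1)[OF assms, of x' m y'] by simp
  qed
  then show ?thesis by (simp add: limit_ring_def)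
qed

lemma eta_mult:
  assumes "x \<in> carrier (E n)" "y \<in> carrier (E n)"
  shows "eta n x \<otimes>\<^bsub>limit_ring\<^esub> eta n y = eta n (x \<otimes>\<^bsub>E n\<^esub> y)"
proof -
  have "(THE c. \<exists>m. \<exists>x'\<in>carrier (E m). \<exists>y'\<in>carrier (E m).
      eta n x = eta m x' \<and> eta n y = eta m y' \<and> c = eta m (x' \<otimes>\<^bsub>E m\<^esub> y')) = eta n (x \<otimes>\<^bsub>E n\<^esub> y)"
  proof (rule the_equality)
    show "\<exists>m. \<exists>x'\<in>carrier (E m). \<exists>y'\<in>carrier (E m). eta n x = eta m x' \<and> eta n y = eta m y' \<and>
        eta n (x \<otimes>\<^bsub>E n\<^esub> y) = eta m (x' \<otimes>\<^bsub>E m\<^esub> y')"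
      using assms by (intro exI[of _ n] bexI[of _ x] bexI[of _ y]) simp_all
    fix c assume "\<exists>m. \<exists>x'\<in>carrier (E m). \<exists>y'\<in>carrier (E m).
      eta n x = eta m x' \<and> eta n y = eta m y' \<and> c = eta m (x' \<otimes>\<^bsub>E m\<^esub> y')"
    then obtain m x' y' where "x' \<in> carrier (E m)" "y' \<in> carrier (E m)"
      "eta n x = eta m x'" "eta n y = eta m y'" "c = eta m (x' \<otimes>\<^bsub>E m\<^esub> y')" by blast
    then show "c = eta n (x \<otimes>\<^bsub>E n\<^esub> y)" using eta_cong(2)[OF assms, of x' m y'] by simp
  qed
  then show ?thesis by (simp add: limit_ring_def)
qed

lemma eta_closed: "x \<in> carrier (E n) \<Longrightarrow> eta n x \<in> carrier limit_ring"
  by (auto simp: limit_ring_def)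

lemma eta_zero: "eta n \<zero>\<^bsub>E n\<^esub> = \<zero>\<^bsub>limit_ring\<^esub>"
proof -
  interpret E0: ring "E 0" by (rule E_ring)
  show ?thesis
    using eta_e[of 0 n "\<zero>\<^bsub>E 0\<^esub>"] ring_hom_zero[OF e_hom[of 0 n] E_ring E_ring] by (simp add: limit_ring_def)
qed

lemma eta_one: "eta n \<one>\<^bsub>E n\<^esub> = \<one>\<^bsub>limit_ring\<^esub>"
proof -
  interpret E0: ring "E 0" by (rule E_ring)
  show ?thesis
    using eta_e[of 0 n "\<one>\<^bsub>E 0\<^esub>"] ring_hom_one[OF e_hom[of 0 n]] by (simp add: limit_ring_def)
qed

lemma limit_finite_subset:
  assumes "finite A" "A \<subseteq> carrier limit_ring"
  obtains n where "A \<subseteq> eta n ` carrier (E n)"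
proof -
  define U where "U n = eta n ` carrier (E n)" for n
  have mono: "U n \<subseteq> U m" if nm: "n \<le> m" for n m
  proof
    fix a assume "a \<in> U n"
    then obtain x where x: "x \<in> carrier (E n)" "a = eta n x" by (auto simp: U_def)
    then have "a = eta m (e n m x)" "e n m x \<in> carrier (E m)" using nm eta_e e_closed by simp_all
    then show "a \<in> U m" unfolding U_def by blast
  qed
  have "\<exists>n. A \<subseteq> U n"
    using assms
  proof (induction A)
    case (insert a A)
    then obtain n m where nm: "A \<subseteq> U n" "a \<in> U m" by (auto simp: limit_ring_def U_def)
    have "U n \<subseteq> U (max n m)" "U m \<subseteq> U (max n m)" by (simp_all add: mono)
    then have "insert a A \<subseteq> U (max n m)" using nm by blast
    then show ?case by blast
  qed simp
  then show thesis using that unfolding U_def by blast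
qed

lemma limit_elem2:
  assumes "a \<in> carrier limit_ring" "b \<in> carrier limit_ring"
  obtains n x y where "x \<in> carrier (E n)" "y \<in> carrier (E n)" "a = eta n x" "b = eta n y"
proof -
  have "finite {a, b}" "{a, b} \<subseteq> carrier limit_ring" using assms by simp_all
  then obtain n where "{a, b} \<subseteq> eta n ` carrier (E n)" by (rule limit_finite_subset)
  then have a: "a \<in> eta n ` carrier (E n)" and b: "b \<in> eta n ` carrier (E n)" by simp_all
  show thesis by (rule imageE[OF a], rule imageE[OF b], rule that)
qed

lemma limit_elem3:
  assumes "a \<in> carrier limit_ring" "b \<in> carrier limit_ring" "c \<in> carrier limit_ring"
  obtains n x y z where "x \<in> carrier (E n)" "y \<in> carrier (E n)" "z \<in> carrier (E n)"
    "a = eta n x" "b = eta n y" "c = eta n z"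
proof -
  have "finite {a, b, c}" "{a, b, c} \<subseteq> carrier limit_ring" using assms by simp_all
  then obtain n where "{a, b, c} \<subseteq> eta n ` carrier (E n)" by (rule limit_finite_subset)
  then have a: "a \<in> eta n ` carrier (E n)" and b: "b \<in> eta n ` carrier (E n)"
    and c: "c \<in> eta n ` carrier (E n)" by simp_all
  show thesis by (rule imageE[OF a], rule imageE[OF b], rule imageE[OF c], rule that)
qed

lemma limit_elem1:
  assumes "a \<in> carrier limit_ring"
  obtains n x where "x \<in> carrier (E n)" "a = eta n x"
  using assms by (auto simp: limit_ring_def)

lemma limit_ring: "ring limit_ring"
proof (rule ringI)
  show "abelian_group limit_ring"
  proof (rule abelian_groupI)
    fix a b assume ab: "a \<in> carrier limit_ring" "b \<in> carrier limit_ring"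
    then obtain n x y where x: "x \<in> carrier (E n)" "y \<in> carrier (E n)" "a = eta n x" "b = eta n y"
      by (rule limit_elem2)
    interpret ring "E n" by (rule E_ring)
    show "a \<oplus>\<^bsub>limit_ring\<^esub> b \<in> carrier limit_ring" using x by (simp add: eta_add eta_closed)
    show "a \<oplus>\<^bsub>limit_ring\<^esub> b = b \<oplus>\<^bsub>limit_ring\<^esub> a" using x by (simp add: eta_add a_comm)
  next
    fix a b c assume "a \<in> carrier limit_ring" "b \<in> carrier limit_ring" "c \<in> carrier limit_ring"
    then obtain n x y z where x: "x \<in> carrier (E n)" "y \<in> carrier (E n)" "z \<in> carrier (E n)"
      "a = eta n x" "b = eta n y" "c = eta n z" by (rule limit_elem3)
    interpret ring "E n" by (rule E_ring)
    show "a \<oplus>\<^bsub>limit_ring\<^esub> b \<oplus>\<^bsub>limit_ring\<^esub> c = a \<oplus>\<^bsub>limit_ring\<^esub> (b \<oplus>\<^bsub>limit_ring\<^esub> c)"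
      using x by (simp add: eta_add a_assoc)
  next
    interpret ring "E 0" by (rule E_ring)
    show "\<zero>\<^bsub>limit_ring\<^esub> \<in> carrier limit_ring" using eta_closed[of "\<zero>\<^bsub>E 0\<^esub>" 0] eta_zero[of 0] by simp
  next
    fix a assume "a \<in> carrier limit_ring"
    then obtain n x where x: "x \<in> carrier (E n)" "a = eta n x" by (rule limit_elem1)
    interpret ring "E n" by (rule E_ring)
    show "\<zero>\<^bsub>limit_ring\<^esub> \<oplus>\<^bsub>limit_ring\<^esub> a = a" using x by (simp add: eta_add flip: eta_zero[of n])
    show "\<exists>y\<in>carrier limit_ring. y \<oplus>\<^bsub>limit_ring\<^esub> a = \<zero>\<^bsub>limit_ring\<^esub>"
      using x by (intro bexI[of _ "eta n (\<ominus>\<^bsub>E n\<^esub> x)"]) (simp_all add: eta_add l_neg eta_zero eta_closed)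
  qed
  show "monoid limit_ring"
  proof (rule monoidI)
    fix a b assume ab: "a \<in> carrier limit_ring" "b \<in> carrier limit_ring"
    then obtain n x y where x: "x \<in> carrier (E n)" "y \<in> carrier (E n)" "a = eta n x" "b = eta n y"
      by (rule limit_elem2)
    interpret ring "E n" by (rule E_ring)
    show "a \<otimes>\<^bsub>limit_ring\<^esub> b \<in> carrier limit_ring" using x by (simp add: eta_mult eta_closed)
  next
    fix a b c assume "a \<in> carrier limit_ring" "b \<in> carrier limit_ring" "c \<in> carrier limit_ring"
    then obtain n x y z where x: "x \<in> carrier (E n)" "y \<in> carrier (E n)" "z \<in> carrier (E n)"
      "a = eta n x" "b = eta n y" "c = eta n z" by (rule limit_elem3)
    interpret ring "E n" by (rule E_ring)
    show "a \<otimes>\<^bsub>limit_ring\<^esub> b \<otimes>\<^bsub>limit_ring\<^esub> c = a \<otimes>\<^bsub>limit_ring\<^esub> (b \<otimes>\<^bsub>limit_ring\<^esub> c)"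
      using x by (simp add: eta_mult m_assoc)
  next
    interpret ring "E 0" by (rule E_ring)
    show "\<one>\<^bsub>limit_ring\<^esub> \<in> carrier limit_ring" using eta_closed[of "\<one>\<^bsub>E 0\<^esub>" 0] eta_one[of 0] by simp
  next
    fix a assume "a \<in> carrier limit_ring"
    then obtain n x where x: "x \<in> carrier (E n)" "a = eta n x" by (rule limit_elem1)
    interpret ring "E n" by (rule E_ring)
    show "\<one>\<^bsub>limit_ring\<^esub> \<otimes>\<^bsub>limit_ring\<^esub> a = a" "a \<otimes>\<^bsub>limit_ring\<^esub> \<one>\<^bsub>limit_ring\<^esub> = a"
      using x by (simp_all add: eta_mult flip: eta_one[of n])
  qed
next
  fix a b c assume "a \<in> carrier limit_ring" "b \<in> carrier limit_ring" "c \<in> carrier limit_ring"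
  then obtain n x y z where x: "x \<in> carrier (E n)" "y \<in> carrier (E n)" "z \<in> carrier (E n)"
    "a = eta n x" "b = eta n y" "c = eta n z" by (rule limit_elem3)
  interpret ring "E n" by (rule E_ring)
  show "(a \<oplus>\<^bsub>limit_ring\<^esub> b) \<otimes>\<^bsub>limit_ring\<^esub> c =
      a \<otimes>\<^bsub>limit_ring\<^esub> c \<oplus>\<^bsub>limit_ring\<^esub> b \<otimes>\<^bsub>limit_ring\<^esub> c"
    "c \<otimes>\<^bsub>limit_ring\<^esub> (a \<oplus>\<^bsub>limit_ring\<^esub> b) =
      c \<otimes>\<^bsub>limit_ring\<^esub> a \<oplus>\<^bsub>limit_ring\<^esub> c \<otimes>\<^bsub>limit_ring\<^esub> b"
    using x by (simp_all add: eta_mult eta_add l_distr r_distr)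
qed

lemma eta_hom: "eta n \<in> ring_hom (E n) limit_ring"
  by (rule ring_hom_memI) (simp_all add: eta_closed eta_mult eta_add eta_one)

lemma eta_zero_iff:
  assumes "x \<in> carrier (E n)"
  shows "eta n x = \<zero>\<^bsub>limit_ring\<^esub> \<longleftrightarrow> x \<in> I n"
proof -
  interpret ring "E n" by (rule E_ring)
  show ?thesis using eta_eq_iff_same[OF assms zero_closed] assms by (simp add: eta_zero minus_eq)
qed

lemma limit_ring_regular:
  assumes "\<And>n. vn_regular (E n)"
  shows "vn_regular limit_ring"
proof -
  interpret ring limit_ring by (rule limit_ring)
  show ?thesis
  proof
    fix a assume "a \<in> carrier limit_ring"
    then obtain n x where x: "x \<in> carrier (E n)" "a = eta n x" by (rule limit_elem1)
    interpret E: vn_regular "E n" by fact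
    obtain y where "y \<in> carrier (E n)" "x \<otimes>\<^bsub>E n\<^esub> y \<otimes>\<^bsub>E n\<^esub> x = x" using E.quasi_inverse[OF x(1)] by blast
    then show "\<exists>y\<in>carrier limit_ring. a \<otimes>\<^bsub>limit_ring\<^esub> y \<otimes>\<^bsub>limit_ring\<^esub> a = a"
      using x by (intro bexI[of _ "eta n y"]) (simp_all add: eta_mult eta_closed)
  qed
qed

end

section \<open>Monoid homomorphisms\<close>

lemma ou_homD:
  assumes "h \<in> ou_hom A B"
  shows "h \<in> hom A B" "h \<one>\<^bsub>A\<^esub> = \<one>\<^bsub>B\<^esub>" "h (ounit A) = ounit B"
    "x \<in> carrier A \<Longrightarrow> h x \<in> carrier B"
    "x \<in> carrier A \<Longrightarrow> y \<in> carrier A \<Longrightarrow> h (x \<otimes>\<^bsub>A\<^esub> y) = h x \<otimes>\<^bsub>B\<^esub> h y"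
  using assms by (auto simp: ou_hom_def hom_def)

lemma ou_homI:
  assumes "\<And>x. x \<in> carrier A \<Longrightarrow> h x \<in> carrier B"
    and "\<And>x y. x \<in> carrier A \<Longrightarrow> y \<in> carrier A \<Longrightarrow> h (x \<otimes>\<^bsub>A\<^esub> y) = h x \<otimes>\<^bsub>B\<^esub> h y"
    and "h \<one>\<^bsub>A\<^esub> = \<one>\<^bsub>B\<^esub>" "h (ounit A) = ounit B"
  shows "h \<in> ou_hom A B"
  using assms by (auto simp: ou_hom_def hom_def)

lemma ou_hom_comp:
  "h \<in> ou_hom A B \<Longrightarrow> k \<in> ou_hom B C \<Longrightarrow> (\<lambda>x. k (h x)) \<in> ou_hom A C"
  by (rule ou_homI) (simp_all add: ou_homD)

lemma ou_isoE:
  assumes "h \<in> ou_iso A B" "comm_monoid A" "ounit A \<in> carrier A"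
  obtains k where "h \<in> ou_hom A B" "k \<in> ou_hom B A"
    "\<And>x. x \<in> carrier A \<Longrightarrow> k (h x) = x" "\<And>y. y \<in> carrier B \<Longrightarrow> h (k y) = y"
proof -
  interpret A: comm_monoid A by fact
  have h: "h \<in> ou_hom A B" and inj: "inj_on h (carrier A)" and im: "h ` carrier A = carrier B"
    using assms(1) by (auto simp: ou_iso_def bij_betw_def)
  let ?k = "inv_into (carrier A) h"
  have k: "?k y \<in> carrier A" "h (?k y) = y" if "y \<in> carrier B" for y
    using that im by (auto simp: inv_into_into f_inv_into_f)
  have kk: "?k (h x) = x" if "x \<in> carrier A" for x using inj that by simp
  show thesis
  proof (rule that[OF h _ kk k(2)])
    show "?k \<in> ou_hom B A"
    proof (rule ou_homI)
      show "?k (x \<otimes>\<^bsub>B\<^esub> y) = ?k x \<otimes>\<^bsub>A\<^esub> ?k y" if "x \<in> carrier B" "y \<in> carrier B" for x y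
        using kk[of "?k x \<otimes>\<^bsub>A\<^esub> ?k y"] ou_homD(5)[OF h, of "?k x" "?k y"] that k by simp
      show "?k \<one>\<^bsub>B\<^esub> = \<one>\<^bsub>A\<^esub>" using kk[of "\<one>\<^bsub>A\<^esub>"] ou_homD(2)[OF h] by simp
      show "?k (ounit B) = ounit A" using kk[OF assms(3)] ou_homD(3)[OF h] by simp
    qed (use k in auto)
  qed
qed

lemma ou_isomorphic_sym:
  assumes "ou_isomorphic A B" "comm_monoid A" "ounit A \<in> carrier A"
  shows "ou_isomorphic B A"
proof -
  obtain h where "h \<in> ou_iso A B" using assms(1) by (auto simp: ou_isomorphic_def)
  then obtain k where k: "h \<in> ou_hom A B" "k \<in> ou_hom B A"
    "\<And>x. x \<in> carrier A \<Longrightarrow> k (h x) = x" "\<And>y. y \<in> carrier B \<Longrightarrow> h (k y) = y"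
    using ou_isoE[OF _ assms(2,3)] by metis
  then have "bij_betw k (carrier B) (carrier A)"
    by (intro bij_betwI[of _ _ _ h]) (auto simp: ou_homD(4))
  then show ?thesis using k(2) unfolding ou_isomorphic_def ou_iso_def by blast
qed

text \<open>
  A section reflects the algebraic quasi-ordering because its retraction preserves it.
\<close>

lemma ou_embedding_retraction:
  assumes h: "h \<in> ou_hom A B" and r: "r \<in> ou_hom B A" and rh: "\<And>x. x \<in> carrier A \<Longrightarrow> r (h x) = x"
  shows "ou_embedding A B h"
  unfolding ou_embedding_def
proof (intro conjI ballI)
  show "inj_on h (carrier A)" by (rule inj_on_inverseI[of _ r]) (rule rh)
  fix x y assume x: "x \<in> carrier A" and y: "y \<in> carrier A"
  show "alg_le B (h x) (h y) \<longleftrightarrow> alg_le A x y"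
  proof
    assume "alg_le B (h x) (h y)"
    then obtain z where z: "z \<in> carrier B" "h x \<otimes>\<^bsub>B\<^esub> z = h y" by (auto simp: alg_le_def)
    have "x \<otimes>\<^bsub>A\<^esub> r z = r (h x \<otimes>\<^bsub>B\<^esub> z)" using ou_homD(4,5)[OF h] ou_homD(5)[OF r] x z(1) rh by simp
    also have "\<dots> = y" using z(2) rh y by simp
    finally show "alg_le A x y" using ou_homD(4)[OF r z(1)] by (auto simp: alg_le_def)
  next
    assume "alg_le A x y"
    then obtain z where "z \<in> carrier A" "x \<otimes>\<^bsub>A\<^esub> z = y" by (auto simp: alg_le_def)
    then show "alg_le B (h x) (h y)" using ou_homD(4,5)[OF h] x by (auto simp: alg_le_def)
  qed
qed (rule h)

lemma crm_objD:
  assumes "crm_obj A"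
  shows "comm_monoid A" "ounit A \<in> carrier A" "conical A"
  using assms by (auto simp: crm_obj_def order_unit_def)

section \<open>V of a limit of quotients\<close>

lemma (in conical_dimension) ker_ideal: "ideal ker R"
proof (rule idealI)
  show "ring R" by (rule ring_axioms)
  show "subgroup ker (add_monoid R)"
    by (rule subgroup.intro) (use ker_closed ker_zero ker_add ker_minus in \<open>auto simp: a_inv_def\<close>)
qed (auto intro: ker_left_mult ker_right_mult)

lemma dimension_pclass:
  assumes R: "vn_regular R" and N: "comm_monoid N"
    and h: "h \<in> hom (V R) N" "h \<one>\<^bsub>V R\<^esub> = \<one>\<^bsub>N\<^esub>"
  shows "dimension R N (\<lambda>x. h (pclass R x))"
proof -
  interpret vn_regular R by fact
  interpret N: comm_monoid N by fact
  show ?thesis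
  proof
    show "h (pclass R \<zero>\<^bsub>R\<^esub>) = \<one>\<^bsub>N\<^esub>" using h(2) by (simp add: V_one)
    show "h (pclass R x) = h (pclass R y)" if "sim R x y" for x y using pclass_sim[OF that] by simp
    show "h (pclass R (x \<oplus>\<^bsub>R\<^esub> y)) = h (pclass R x) \<otimes>\<^bsub>N\<^esub> h (pclass R y)"
      if "x \<in> carrier R" "y \<in> carrier R" "x \<otimes>\<^bsub>R\<^esub> x = x" "y \<otimes>\<^bsub>R\<^esub> y = y"
        "x \<otimes>\<^bsub>R\<^esub> y = \<zero>\<^bsub>R\<^esub>" "y \<otimes>\<^bsub>R\<^esub> x = \<zero>\<^bsub>R\<^esub>" for x y
      using that by (simp add: pclass_add hom_mult[OF h(1)])
  qed (use hom_in_carrier[OF h(1)] in auto)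
qed

lemma V_map_comp:
  assumes R: "vn_regular R" and S: "vn_regular S" and T: "vn_regular T"
    and f: "f \<in> ring_hom R S" and g: "g \<in> ring_hom S T" and h: "h \<in> ring_hom R T"
    and eq: "\<And>x. x \<in> carrier R \<Longrightarrow> g (f x) = h x" and C: "C \<in> carrier (V R)"
  shows "V_map S T g (V_map R S f C) = V_map R T h C"
proof -
  interpret R: vn_regular R by fact
  interpret S: vn_regular S by fact
  interpret T: vn_regular T by fact
  note Vf = V_map_hom[OF R S f] V_map_one[OF R S f] V_map_pclass[OF R S f]
  note Vg = V_map_hom[OF S T g] V_map_one[OF S T g] V_map_pclass[OF S T g]
  note Vh = V_map_hom[OF R T h] V_map_one[OF R T h] V_map_pclass[OF R T h]
  have "(\<lambda>C. V_map S T g (V_map R S f C)) \<in> hom (V R) (V T)"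
    using Vf(1) Vg(1) by (auto simp: hom_def Pi_iff)
  then show ?thesis
    by (rule R.V_hom_eqI[OF T.comm_monoid_V _ Vh(1) _ _ C])
      (use Vf Vg Vh ring_hom_closed[OF f] eq in auto)
qed

text \<open>
  A cone from the monoids \<open>V(E\<^sub>n)\<close> to \<open>M\<close> which exhibits \<open>M\<close> as the limit of the
  \<open>V(E\<^sub>n)\<close> modulo the elements of value \<open>0\<close>.
\<close>

locale V_cone =
  fixes E :: "nat \<Rightarrow> 'r ring" and e :: "nat \<Rightarrow> nat \<Rightarrow> 'r \<Rightarrow> 'r" and M :: "'m ou_monoid"
    and \<psi> :: "nat \<Rightarrow> ('r, nat \<Rightarrow> 'r) module set \<Rightarrow> 'm"
  assumes E_regular: "vn_regular (E n)"
    and e_hom: "n \<le> m \<Longrightarrow> e n m \<in> ring_hom (E n) (E m)"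
    and e_id: "x \<in> carrier (E n) \<Longrightarrow> e n n x = x"
    and e_comp: "n \<le> m \<Longrightarrow> m \<le> k \<Longrightarrow> x \<in> carrier (E n) \<Longrightarrow> e m k (e n m x) = e n k x"
    and M_monoid: "comm_monoid M" and M_conical: "conical M"
    and psi_hom: "\<psi> n \<in> hom (V (E n)) M" and psi_one: "\<psi> n \<one>\<^bsub>V (E n)\<^esub> = \<one>\<^bsub>M\<^esub>"
    and psi_ounit: "\<psi> n (ounit (V (E n))) = ounit M"
    and psi_compat: "n \<le> m \<Longrightarrow> C \<in> carrier (V (E n)) \<Longrightarrow> \<psi> m (V_map (E n) (E m) (e n m) C) = \<psi> n C"
    and psi_onto: "a \<in> carrier M \<Longrightarrow> \<exists>n. \<exists>C\<in>carrier (V (E n)). \<psi> n C = a"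
    and psi_eq: "C \<in> carrier (V (E n)) \<Longrightarrow> D \<in> carrier (V (E n)) \<Longrightarrow> \<psi> n C = \<psi> n D \<Longrightarrow>
      \<exists>m\<ge>n. \<exists>A\<in>carrier (V (E m)). \<exists>B\<in>carrier (V (E m)). \<psi> m A = \<one>\<^bsub>M\<^esub> \<and> \<psi> m B = \<one>\<^bsub>M\<^esub> \<and>
        V_map (E n) (E m) (e n m) C \<otimes>\<^bsub>V (E m)\<^esub> A = V_map (E n) (E m) (e n m) D \<otimes>\<^bsub>V (E m)\<^esub> B"
begin

sublocale M: comm_monoid M by (rule M_monoid)

definition dim :: "nat \<Rightarrow> 'r \<Rightarrow> 'm" where
  "dim n x = \<psi> n (pclass (E n) x)"

lemma conical_dimension_dim: "conical_dimension (E n) M (dim n)"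
  using dimension_pclass[OF E_regular M_monoid psi_hom psi_one] M_conical
  unfolding dim_def by (intro conical_dimension.intro conical_dimension_axioms.intro)

abbreviation I :: "nat \<Rightarrow> 'r set" where
  "I n \<equiv> conical_dimension.ker (E n) M (dim n)"

lemma dim_e:
  assumes "n \<le> m" "x \<in> carrier (E n)"
  shows "dim m (e n m x) = dim n x"
proof -
  interpret n: vn_regular "E n" by (rule E_regular)
  show ?thesis
    using psi_compat[OF assms(1) n.pclass_closed[OF assms(2)]]
      V_map_pclass[OF E_regular E_regular e_hom[OF assms(1)] assms(2)] by (simp add: dim_def)
qed

sublocale ring_sequence E e I
proof (rule ring_sequence.intro)
  fix n m :: nat and x :: 'r
  show "ring (E n)" by (rule vn_regular.axioms(1)[OF E_regular])
  show "ideal (I n) (E n)" by (rule conical_dimension.ker_ideal[OF conical_dimension_dim])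
  show "e n m x \<in> I m \<longleftrightarrow> x \<in> I n" if "n \<le> m" "x \<in> carrier (E n)"
    using that dim_e[OF that] ring_hom_closed[OF e_hom[OF that(1)] that(2)]
    by (simp add: conical_dimension.ker_def[OF conical_dimension_dim])
qed (use e_hom e_id e_comp in auto)

lemma limit_regular: "vn_regular limit_ring"
  by (rule limit_ring_regular[OF E_regular])

lemma eta_eq_dim:
  assumes "x \<in> carrier (E n)" "y \<in> carrier (E m)" "eta n x = eta m y"
  shows "dim n x = dim m y"
proof -
  let ?k = "max n m"
  interpret k: conical_dimension "E ?k" M "dim ?k" by (rule conical_dimension_dim)
  have "k.cong_ker (e n ?k x) (e m ?k y)"
    using eta_eq_iff[OF assms(1,2), of ?k] assms e_closed by (simp add: k.cong_ker_def)
  from k.dim_cong[OF this] show ?thesis using dim_e assms(1,2) by simp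
qed

definition limit_dim :: "'r \<Rightarrow> 'm" where
  "limit_dim a = (SOME v. \<exists>n. \<exists>x\<in>carrier (E n). a = eta n x \<and> v = dim n x)"

lemma limit_dim_eta:
  assumes "x \<in> carrier (E n)"
  shows "limit_dim (eta n x) = dim n x"
proof -
  have "\<exists>v. \<exists>m. \<exists>y\<in>carrier (E m). eta n x = eta m y \<and> v = dim m y" using assms by blast
  from someI_ex[OF this] obtain m y where "y \<in> carrier (E m)" "eta n x = eta m y" "limit_dim (eta n x) = dim m y"
    unfolding limit_dim_def by blast
  then show ?thesis using eta_eq_dim[OF assms] by simp
qed

text \<open>
  The finitely many elements of the limit involved in an instance of the axioms
  come from one ring \<open>E\<^sub>n\<close>, where the relations between them hold modulo the ideal \<open>I\<^sub>n\<close>.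
\<close>

lemma dimension_limit: "dimension limit_ring M limit_dim"
proof -
  interpret L: vn_regular limit_ring by (rule limit_regular)
  have cong: "conical_dimension.cong_ker (E n) M (dim n) x y"
    if "eta n x = eta n y" "x \<in> carrier (E n)" "y \<in> carrier (E n)" for n x y
    using that eta_eq_iff_same[of x n y] by (simp add: conical_dimension.cong_ker_def[OF conical_dimension_dim])
  show ?thesis
  proof
    show "limit_dim a \<in> carrier M" if a: "a \<in> carrier limit_ring" for a
    proof -
      obtain n x where x: "x \<in> carrier (E n)" "a = eta n x" using a by (rule limit_elem1)
      interpret conical_dimension "E n" M "dim n" by (rule conical_dimension_dim)
      show ?thesis using x by (simp add: limit_dim_eta)
    qed
    interpret E0: conical_dimension "E 0" M "dim 0" by (rule conical_dimension_dim)
    show "limit_dim \<zero>\<^bsub>limit_ring\<^esub> = \<one>\<^bsub>M\<^esub>"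
      using limit_dim_eta[of "\<zero>\<^bsub>E 0\<^esub>" 0] by (simp add: eta_zero)
  next
    fix a b assume "sim limit_ring a b"
    then obtain c d a' b' where s: "a \<in> carrier limit_ring" "b \<in> carrier limit_ring"
      "c \<in> carrier limit_ring" "d \<in> carrier limit_ring" "a' \<in> carrier limit_ring" "b' \<in> carrier limit_ring"
      "c \<otimes>\<^bsub>limit_ring\<^esub> a = b \<otimes>\<^bsub>limit_ring\<^esub> a'" "d \<otimes>\<^bsub>limit_ring\<^esub> b = a \<otimes>\<^bsub>limit_ring\<^esub> b'"
      "d \<otimes>\<^bsub>limit_ring\<^esub> (c \<otimes>\<^bsub>limit_ring\<^esub> a) = a" "c \<otimes>\<^bsub>limit_ring\<^esub> (d \<otimes>\<^bsub>limit_ring\<^esub> b) = b"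
      by (rule simE)
    have "finite {a, b, c, d, a', b'}" "{a, b, c, d, a', b'} \<subseteq> carrier limit_ring" using s by simp_all
    then obtain n where "{a, b, c, d, a', b'} \<subseteq> eta n ` carrier (E n)" by (rule limit_finite_subset)
    then obtain x y p q u v where x: "x \<in> carrier (E n)" "y \<in> carrier (E n)" "p \<in> carrier (E n)"
      "q \<in> carrier (E n)" "u \<in> carrier (E n)" "v \<in> carrier (E n)"
      "a = eta n x" "b = eta n y" "c = eta n p" "d = eta n q" "a' = eta n u" "b' = eta n v"
      by (auto simp: image_iff)
    interpret conical_dimension "E n" M "dim n" by (rule conical_dimension_dim)
    have "dim n x = dim n y"
      by (rule dim_sim_cong[OF x(1-6)]; rule cong) (use s(7-10) in \<open>simp_all add: x(1-6) flip: eta_mult x(7-12)\<close>)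
    then show "limit_dim a = limit_dim b" using x limit_dim_eta by simp
  next
    fix a b assume a: "a \<in> carrier limit_ring" "b \<in> carrier limit_ring"
      "a \<otimes>\<^bsub>limit_ring\<^esub> a = a" "b \<otimes>\<^bsub>limit_ring\<^esub> b = b"
      "a \<otimes>\<^bsub>limit_ring\<^esub> b = \<zero>\<^bsub>limit_ring\<^esub>" "b \<otimes>\<^bsub>limit_ring\<^esub> a = \<zero>\<^bsub>limit_ring\<^esub>"
    obtain n x y where x: "x \<in> carrier (E n)" "y \<in> carrier (E n)" "a = eta n x" "b = eta n y"
      by (rule limit_elem2[OF a(1,2)])
    interpret conical_dimension "E n" M "dim n" by (rule conical_dimension_dim)
    have "dim n (x \<oplus>\<^bsub>E n\<^esub> y) = dim n x \<otimes>\<^bsub>M\<^esub> dim n y"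
      by (rule dim_add_cong[OF x(1,2)]; rule cong) (use a(3-6) x in \<open>simp_all add: eta_mult eta_zero\<close>)
    then show "limit_dim (a \<oplus>\<^bsub>limit_ring\<^esub> b) = limit_dim a \<otimes>\<^bsub>M\<^esub> limit_dim b"
      using x by (simp add: eta_add limit_dim_eta)
  qed
qed

abbreviation V_eta :: "nat \<Rightarrow> ('r, nat \<Rightarrow> 'r) module set \<Rightarrow> ('r, nat \<Rightarrow> 'r) module set" where
  "V_eta n \<equiv> V_map (E n) limit_ring (eta n)"

lemmas V_eta_hom = V_map_hom[OF E_regular limit_regular eta_hom]
  and V_eta_one = V_map_one[OF E_regular limit_regular eta_hom]
  and V_eta_pclass = V_map_pclass[OF E_regular limit_regular eta_hom]

lemma V_eta_e:
  assumes "n \<le> m" "C \<in> carrier (V (E n))"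
  shows "V_eta m (V_map (E n) (E m) (e n m) C) = V_eta n C"
  by (rule V_map_comp[OF E_regular E_regular limit_regular e_hom[OF assms(1)] eta_hom eta_hom eta_e[OF assms(1)] assms(2)])

lemma V_e_closed:
  assumes "n \<le> m" "C \<in> carrier (V (E n))"
  shows "V_map (E n) (E m) (e n m) C \<in> carrier (V (E m))"
  using hom_in_carrier[OF V_map_hom[OF E_regular E_regular e_hom[OF assms(1)]] assms(2)] .

lemma V_eta_onto:
  assumes "C \<in> carrier (V limit_ring)"
  shows "\<exists>n. \<exists>D\<in>carrier (V (E n)). C = V_eta n D"
proof -
  interpret L: vn_regular limit_ring by (rule limit_regular)
  show ?thesis
    using assms
  proof (induction rule: L.V_induct)
    case one
    interpret E0: vn_regular "E 0" by (rule E_regular)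
    interpret V0: comm_monoid "V (E 0)" by (rule E0.comm_monoid_V)
    show ?case by (rule exI[of _ 0], rule bexI[of _ "\<one>\<^bsub>V (E 0)\<^esub>"]) (simp_all add: V_eta_one)
  next
    case (principal a)
    obtain n x where x: "x \<in> carrier (E n)" "a = eta n x" using principal by (rule limit_elem1)
    interpret En: vn_regular "E n" by (rule E_regular)
    show ?case unfolding x(2)
      by (rule exI[of _ n], rule bexI[of _ "pclass (E n) x"]) (simp_all add: V_eta_pclass x(1))
  next
    case (mult A B)
    obtain n C where C: "C \<in> carrier (V (E n))" "A = V_eta n C" using mult by blast
    obtain m D where D: "D \<in> carrier (V (E m))" "B = V_eta m D" using mult by blast
    let ?k = "max n m"
    interpret k: vn_regular "E ?k" by (rule E_regular)
    interpret Vk: comm_monoid "V (E ?k)" by (rule k.comm_monoid_V)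
    let ?C = "V_map (E n) (E ?k) (e n ?k) C" and ?D = "V_map (E m) (E ?k) (e m ?k) D"
    have c: "?C \<in> carrier (V (E ?k))" "?D \<in> carrier (V (E ?k))" using V_e_closed C D by simp_all
    have "V_eta ?k (?C \<otimes>\<^bsub>V (E ?k)\<^esub> ?D) = V_eta ?k ?C \<otimes>\<^bsub>V limit_ring\<^esub> V_eta ?k ?D"
      by (rule hom_mult[OF V_eta_hom c])
    also have "\<dots> = A \<otimes>\<^bsub>V limit_ring\<^esub> B" using C D V_eta_e[of n ?k] V_eta_e[of m ?k] by simp
    finally have "A \<otimes>\<^bsub>V limit_ring\<^esub> B = V_eta ?k (?C \<otimes>\<^bsub>V (E ?k)\<^esub> ?D)" by (rule sym)
    then show ?case by (intro exI[of _ ?k] bexI[OF _ Vk.m_closed[OF c]])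
  qed
qed

text \<open>
  Write \<open>C\<close> as a sum of classes of principal right ideals.  As \<open>M\<close> is conical, all of
  them have value \<open>0\<close>, so their generators become \<open>0\<close> in the limit.
\<close>

lemma V_eta_ker:
  assumes "C \<in> carrier (V (E n))" "\<psi> n C = \<one>\<^bsub>M\<^esub>"
  shows "V_eta n C = \<one>\<^bsub>V limit_ring\<^esub>"
proof -
  interpret En: conical_dimension "E n" M "dim n" by (rule conical_dimension_dim)
  interpret L: vn_regular limit_ring by (rule limit_regular)
  interpret VL: comm_monoid "V limit_ring" by (rule L.comm_monoid_V)
  show ?thesis
    using assms
  proof (induction rule: En.V_induct)
    case one
    show ?case by (rule V_eta_one)
  next
    case (principal x)
    then have "x \<in> I n" by (simp add: En.ker_def dim_def)
    then have "eta n x = \<zero>\<^bsub>limit_ring\<^esub>" using principal eta_zero_iff by simp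
    then show ?case using principal by (simp add: L.V_one V_eta_pclass)
  next
    case (mult A B)
    have eq: "\<psi> n A \<otimes>\<^bsub>M\<^esub> \<psi> n B = \<one>\<^bsub>M\<^esub>" using mult hom_mult[OF psi_hom] by simp
    have c: "\<psi> n A \<in> carrier M" "\<psi> n B \<in> carrier M" using mult hom_in_carrier[OF psi_hom] by simp_all
    have "\<psi> n A = \<one>\<^bsub>M\<^esub>" "\<psi> n B = \<one>\<^bsub>M\<^esub>"
      using M_conical c eq unfolding conical_def by blast+
    then show ?case using mult hom_mult[OF V_eta_hom, of A n B] by simp
  qed
qed

text \<open>
  The isomorphism is the extension of the dimension function \<open>limit_dim\<close> to \<open>V\<close> of the limit.
  Composed with the maps induced by \<open>eta n\<close> it gives back the cone, so it is onto; and two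
  elements with the same value come from elements of some \<open>V(E\<^sub>l)\<close> which differ by elements of
  value \<open>0\<close>, and these vanish in the limit.
\<close>

theorem V_limit_isomorphic: "ou_isomorphic M (V limit_ring)"
proof -
  interpret L: dimension limit_ring M limit_dim by (rule dimension_limit)
  interpret VL: comm_monoid "V limit_ring" by (rule L.comm_monoid_V)
  let ?\<Theta> = "L.class_dim"
  have Theta_eta: "?\<Theta> (V_eta n C) = \<psi> n C" if "C \<in> carrier (V (E n))" for n C
  proof -
    interpret En: vn_regular "E n" by (rule E_regular)
    have "(\<lambda>C. ?\<Theta> (V_eta n C)) \<in> hom (V (E n)) M"
      using L.class_dim_hom V_eta_hom[of n] by (auto simp: hom_def Pi_iff)
    then show ?thesis
      by (rule En.V_hom_eqI[OF M_monoid _ psi_hom _ _ that])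
        (simp_all add: V_eta_one L.class_dim_one psi_one V_eta_pclass L.class_dim_pclass eta_closed limit_dim_eta dim_def)
  qed
  have onto: "?\<Theta> ` carrier (V limit_ring) = carrier M"
  proof
    show "?\<Theta> ` carrier (V limit_ring) \<subseteq> carrier M" using hom_in_carrier[OF L.class_dim_hom] by blast
    show "carrier M \<subseteq> ?\<Theta> ` carrier (V limit_ring)"
    proof
      fix a assume "a \<in> carrier M"
      then obtain n C where C: "C \<in> carrier (V (E n))" "\<psi> n C = a" using psi_onto by blast
      then show "a \<in> ?\<Theta> ` carrier (V limit_ring)"
        using Theta_eta[OF C(1)] hom_in_carrier[OF V_eta_hom C(1)]
        by (intro image_eqI[of _ _ "V_eta n C"]) simp_all
    qed
  qed
  have inj: "inj_on ?\<Theta> (carrier (V limit_ring))"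
  proof (rule inj_onI)
    fix A B assume A: "A \<in> carrier (V limit_ring)" and B: "B \<in> carrier (V limit_ring)" and eq: "?\<Theta> A = ?\<Theta> B"
    obtain n C where C: "C \<in> carrier (V (E n))" "A = V_eta n C" using V_eta_onto[OF A] by blast
    obtain m D where D: "D \<in> carrier (V (E m))" "B = V_eta m D" using V_eta_onto[OF B] by blast
    define k where "k = max n m"
    have nm: "n \<le> k" "m \<le> k" by (auto simp: k_def)
    define C' where "C' = V_map (E n) (E k) (e n k) C"
    define D' where "D' = V_map (E m) (E k) (e m k) D"
    have C': "C' \<in> carrier (V (E k))" "A = V_eta k C'"
      using V_e_closed[OF nm(1) C(1)] V_eta_e[OF nm(1) C(1)] C(2) by (simp_all add: C'_def)
    have D': "D' \<in> carrier (V (E k))" "B = V_eta k D'"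
      using V_e_closed[OF nm(2) D(1)] V_eta_e[OF nm(2) D(1)] D(2) by (simp_all add: D'_def)
    have "\<psi> k C' = \<psi> k D'" using eq Theta_eta[OF C'(1)] Theta_eta[OF D'(1)] C'(2) D'(2) by simp
    then obtain l X Y where l: "k \<le> l" "X \<in> carrier (V (E l))" "Y \<in> carrier (V (E l))"
      "\<psi> l X = \<one>\<^bsub>M\<^esub>" "\<psi> l Y = \<one>\<^bsub>M\<^esub>"
      "V_map (E k) (E l) (e k l) C' \<otimes>\<^bsub>V (E l)\<^esub> X = V_map (E k) (E l) (e k l) D' \<otimes>\<^bsub>V (E l)\<^esub> Y"
      using psi_eq[OF C'(1) D'(1)] by blast
    have *: "V_eta l (V_map (E k) (E l) (e k l) F \<otimes>\<^bsub>V (E l)\<^esub> Z) = V_eta k F"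
      if "F \<in> carrier (V (E k))" "Z \<in> carrier (V (E l))" "\<psi> l Z = \<one>\<^bsub>M\<^esub>" for F Z
      using that hom_mult[OF V_eta_hom V_e_closed[OF l(1) that(1)] that(2)] V_eta_e[OF l(1) that(1)]
        V_eta_ker[OF that(2,3)] hom_in_carrier[OF V_eta_hom that(1)] by simp
    show "A = B" using *[OF C'(1) l(2,4)] *[OF D'(1) l(3,5)] l(6) C'(2) D'(2) by simp
  qed
  have bij: "bij_betw ?\<Theta> (carrier (V limit_ring)) (carrier M)" using inj onto by (simp add: bij_betw_def)
  have unit: "?\<Theta> (ounit (V limit_ring)) = ounit M"
  proof -
    interpret E0: vn_regular "E 0" by (rule E_regular)
    have "?\<Theta> (ounit (V limit_ring)) = limit_dim (eta 0 \<one>\<^bsub>E 0\<^esub>)"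
      by (simp add: L.V_ounit L.class_dim_pclass eta_one)
    also have "\<dots> = ounit M" using psi_ounit[of 0] by (simp add: limit_dim_eta dim_def E0.V_ounit)
    finally show ?thesis .
  qed
  have "?\<Theta> \<in> ou_iso (V limit_ring) M"
    using bij unit L.class_dim_hom L.class_dim_one by (simp add: ou_iso_def ou_hom_def)
  then show ?thesis
    by (intro ou_isomorphic_sym[OF _ VL.comm_monoid_axioms]) (auto simp: ou_isomorphic_def L.V_ounit)
qed

end

section \<open>Colimits of sequences of monoids\<close>

locale ou_sequence =
  fixes A :: "nat \<Rightarrow> 'a ou_monoid" and f :: "nat \<Rightarrow> nat \<Rightarrow> 'a \<Rightarrow> 'a"
  assumes diagram: "ou_diagram A f"
begin

lemma obj: "crm_obj (A n)"
  and f_hom: "n \<le> m \<Longrightarrow> f n m \<in> ou_hom (A n) (A m)"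
  and f_id: "x \<in> carrier (A n) \<Longrightarrow> f n n x = x"
  and f_comp: "n \<le> m \<Longrightarrow> m \<le> k \<Longrightarrow> x \<in> carrier (A n) \<Longrightarrow> f m k (f n m x) = f n k x"
  using diagram by (auto simp: ou_diagram_def)

definition cls :: "nat \<Rightarrow> 'a \<Rightarrow> (nat \<times> 'a) set" where
  "cls n x = colim_rel A f `` {(n, x)}"

lemma colim_rel_iff: "((m, x), (n, y)) \<in> colim_rel A f \<longleftrightarrow>
    x \<in> carrier (A m) \<and> y \<in> carrier (A n) \<and> (\<exists>k. m \<le> k \<and> n \<le> k \<and> f m k x = f n k y)"
  by (simp add: colim_rel_def)

lemma f_eq_mono:
  assumes "f m k x = f n k y" "m \<le> k" "n \<le> k" "k \<le> l" "x \<in> carrier (A m)" "y \<in> carrier (A n)"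
  shows "f m l x = f n l y"
  using assms f_comp by metis

lemma colim_equiv: "equiv (SIGMA n:UNIV. carrier (A n)) (colim_rel A f)"
proof (rule equivI)
  show "refl_on (SIGMA n:UNIV. carrier (A n)) (colim_rel A f)"
    by (rule refl_onI) (auto simp: colim_rel_iff)
  show "sym (colim_rel A f)"
  proof (rule symI)
    fix p q assume "(p, q) \<in> colim_rel A f"
    then show "(q, p) \<in> colim_rel A f" by (cases p; cases q) (auto simp: colim_rel_iff intro: sym)
  qed
  show "trans (colim_rel A f)"
  proof (rule transI)
    fix p q r assume pq: "(p, q) \<in> colim_rel A f" and qr: "(q, r) \<in> colim_rel A f"
    obtain m x n y l z where e: "p = (m, x)" "q = (n, y)" "r = (l, z)" by (metis surj_pair)
    obtain k where k: "x \<in> carrier (A m)" "y \<in> carrier (A n)" "m \<le> k" "n \<le> k" "f m k x = f n k y"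
      using pq by (auto simp: e colim_rel_iff)
    obtain k' where k': "z \<in> carrier (A l)" "n \<le> k'" "l \<le> k'" "f n k' y = f l k' z"
      using qr by (auto simp: e colim_rel_iff)
    have "f m (max k k') x = f n (max k k') y" by (rule f_eq_mono[OF k(5,3,4)]) (use k in auto)
    moreover have "f n (max k k') y = f l (max k k') z" by (rule f_eq_mono[OF k'(4,2,3)]) (use k k' in auto)
    ultimately show "(p, r) \<in> colim_rel A f" using k k' unfolding e colim_rel_iff
      by (intro conjI exI[of _ "max k k'"]) auto
  qed
qed (auto simp: colim_rel_def)

lemma cls_eq_iff:
  assumes "x \<in> carrier (A m)" "y \<in> carrier (A n)"
  shows "cls m x = cls n y \<longleftrightarrow> (\<exists>k. m \<le> k \<and> n \<le> k \<and> f m k x = f n k y)"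
  unfolding cls_def
  using eq_equiv_class_iff[OF colim_equiv, of "(m, x)" "(n, y)"] assms by (simp add: colim_rel_iff)

lemma cls_f:
  assumes "n \<le> m" "x \<in> carrier (A n)"
  shows "cls m (f n m x) = cls n x"
proof -
  have c: "f n m x \<in> carrier (A m)" using ou_homD(4)[OF f_hom[OF assms(1)] assms(2)] .
  show ?thesis unfolding cls_eq_iff[OF c assms(2)] using assms f_id[OF c] by (intro exI[of _ m]) simp
qed

lemma carrier_colim: "carrier (omega_colim A f) = (\<Union>n. cls n ` carrier (A n))"
  by (auto simp: omega_colim_def quotient_def cls_def)

lemma one_colim: "\<one>\<^bsub>omega_colim A f\<^esub> = cls n \<one>\<^bsub>A n\<^esub>"
proof -
  interpret comm_monoid "A 0" by (rule crm_objD[OF obj])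
  show ?thesis
    using cls_f[of 0 n "\<one>\<^bsub>A 0\<^esub>"] ou_homD(2)[OF f_hom[of 0 n]] by (simp add: omega_colim_def cls_def)
qed

lemma ounit_colim: "ounit (omega_colim A f) = cls n (ounit (A n))"
  using cls_f[of 0 n "ounit (A 0)"] ou_homD(3)[OF f_hom[of 0 n]] crm_objD(2)[OF obj[of 0]]
  by (simp add: omega_colim_def cls_def)

lemma cls_mult:
  assumes a: "a \<in> carrier (A n)" and b: "b \<in> carrier (A n)"
  shows "cls n a \<otimes>\<^bsub>omega_colim A f\<^esub> cls n b = cls n (a \<otimes>\<^bsub>A n\<^esub> b)"
proof -
  interpret An: comm_monoid "A n" by (rule crm_objD[OF obj])
  have ab: "a \<otimes>\<^bsub>A n\<^esub> b \<in> carrier (A n)" using a b by simp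
  have *: "cls (max m p) (f m (max m p) x \<otimes>\<^bsub>A (max m p)\<^esub> f p (max m p) y) = cls n (a \<otimes>\<^bsub>A n\<^esub> b)"
    if x: "(m, x) \<in> cls n a" and y: "(p, y) \<in> cls n b" for m x p y
  proof -
    let ?q = "max m p"
    obtain k where k: "x \<in> carrier (A m)" "n \<le> k" "m \<le> k" "f n k a = f m k x"
      using x by (auto simp: cls_def colim_rel_iff)
    obtain l where l: "y \<in> carrier (A p)" "n \<le> l" "p \<le> l" "f n l b = f p l y"
      using y by (auto simp: cls_def colim_rel_iff)
    let ?r = "max k l"
    have ax: "f n ?r a = f m ?r x" by (rule f_eq_mono[OF k(4,2,3)]) (use k a in auto)
    have ay: "f n ?r b = f p ?r y" by (rule f_eq_mono[OF l(4,2,3)]) (use l b in auto)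
    have q: "?q \<le> ?r" "n \<le> ?r" using k l by auto
    interpret q: comm_monoid "A ?q" by (rule crm_objD[OF obj])
    have c: "f m ?q x \<in> carrier (A ?q)" "f p ?q y \<in> carrier (A ?q)"
      using ou_homD(4)[OF f_hom] k l by auto
    have "f ?q ?r (f m ?q x \<otimes>\<^bsub>A ?q\<^esub> f p ?q y) = f m ?r x \<otimes>\<^bsub>A ?r\<^esub> f p ?r y"
      using ou_homD(5)[OF f_hom[OF q(1)] c] f_comp[of m ?q ?r x] f_comp[of p ?q ?r y] k l q(1) by simp
    also have "\<dots> = f n ?r (a \<otimes>\<^bsub>A n\<^esub> b)" using ou_homD(5)[OF f_hom[OF q(2)] a b] ax ay by simp
    finally show ?thesis
      unfolding cls_eq_iff[OF q.m_closed[OF c] ab] using q by blast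
  qed
  have "(n, a) \<in> cls n a" "(n, b) \<in> cls n b"
    using a b by (auto simp: cls_def colim_rel_iff)
  then have "cls n a \<noteq> {}" "cls n b \<noteq> {}" by blast+
  moreover have "cls n a \<otimes>\<^bsub>omega_colim A f\<^esub> cls n b = (\<Union>(m, x)\<in>cls n a. \<Union>(p, y)\<in>cls n b.
      cls (max m p) (f m (max m p) x \<otimes>\<^bsub>A (max m p)\<^esub> f p (max m p) y))"
    by (simp add: omega_colim_def cls_def)
  moreover have "\<dots> = (\<Union>z\<in>cls n a. \<Union>z'\<in>cls n b. cls n (a \<otimes>\<^bsub>A n\<^esub> b))"
    by (intro SUP_cong refl) (use * in auto)
  ultimately show ?thesis by simp
qed

end

section \<open>Replacing retractions by embeddings\<close>

lemma carrier_ou_product [simp]: "carrier (ou_product I A) = (\<Pi>\<^sub>E i\<in>I. carrier (A i))"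
  and mult_ou_product [simp]: "x \<otimes>\<^bsub>ou_product I A\<^esub> y = (\<lambda>i\<in>I. x i \<otimes>\<^bsub>A i\<^esub> y i)"
  and one_ou_product [simp]: "\<one>\<^bsub>ou_product I A\<^esub> = (\<lambda>i\<in>I. \<one>\<^bsub>A i\<^esub>)"
  and ounit_ou_product [simp]: "ounit (ou_product I A) = (\<lambda>i\<in>I. ounit (A i))"
  by (simp_all add: ou_product_def monoid.extend_def product_group_def)

text \<open>
  The retracts \<open>A n\<close> of the \<open>B n\<close> form a sequence with limit \<open>M\<close>.
\<close>

locale retract_sequence = ou_sequence A f
  for A :: "nat \<Rightarrow> 'm ou_monoid" and f +
  fixes B :: "nat \<Rightarrow> 'm ou_monoid" and \<epsilon> \<mu> :: "nat \<Rightarrow> 'm \<Rightarrow> 'm"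
    and M :: "'m ou_monoid" and \<iota> :: "(nat \<times> 'm) set \<Rightarrow> 'm"
  assumes B_obj: "crm_obj (B n)"
    and eps_hom: "\<epsilon> n \<in> ou_hom (A n) (B n)"
    and mu_hom: "\<mu> n \<in> ou_hom (B n) (A n)"
    and mu_eps: "x \<in> carrier (A n) \<Longrightarrow> \<mu> n (\<epsilon> n x) = x"
    and M_obj: "crm_obj M"
    and iota: "\<iota> \<in> ou_iso (omega_colim A f) M"
begin

definition tau :: "nat \<Rightarrow> 'm \<Rightarrow> 'm" where
  "tau n x = \<iota> (cls n x)"

lemma iota_hom: "\<iota> \<in> ou_hom (omega_colim A f) M"
  using iota by (simp add: ou_iso_def)

lemma cls_closed: "x \<in> carrier (A n) \<Longrightarrow> cls n x \<in> carrier (omega_colim A f)"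
  by (auto simp: carrier_colim)

lemma tau_hom: "tau n \<in> ou_hom (A n) M"
  by (rule ou_homI)
    (simp_all add: tau_def ou_homD[OF iota_hom] cls_closed flip: cls_mult one_colim ounit_colim)

lemma tau_f: "n \<le> m \<Longrightarrow> x \<in> carrier (A n) \<Longrightarrow> tau m (f n m x) = tau n x"
  by (simp add: tau_def cls_f)

lemma tau_eq:
  assumes "x \<in> carrier (A n)" "y \<in> carrier (A n)" "tau n x = tau n y"
  shows "\<exists>k\<ge>n. f n k x = f n k y"
proof -
  have "inj_on \<iota> (carrier (omega_colim A f))" using iota by (auto simp: ou_iso_def bij_betw_def)
  then have "cls n x = cls n y" using assms cls_closed unfolding tau_def by (meson inj_onD)
  then show ?thesis using cls_eq_iff[OF assms(1,2)] by blast
qed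

lemma tau_onto:
  assumes "a \<in> carrier M"
  shows "\<exists>n. \<exists>x\<in>carrier (A n). tau n x = a"
proof -
  have "\<iota> ` carrier (omega_colim A f) = carrier M" using iota by (auto simp: ou_iso_def bij_betw_def)
  then obtain X where X: "X \<in> carrier (omega_colim A f)" "a = \<iota> X" using assms by blast
  then obtain n x where "x \<in> carrier (A n)" "X = cls n x" unfolding carrier_colim by blast
  then show ?thesis using X unfolding tau_def by blast
qed

abbreviation P :: "nat \<Rightarrow> (nat \<Rightarrow> 'm) ou_monoid" where
  "P n \<equiv> ou_product {..<Suc n} B"

text \<open>
  All new coordinates are images of the last coordinate \<open>x n\<close>, transported inside the retracts.
  Adding them one at a time gives the same tuple, because \<open>\<mu>\<close> is a retraction.
\<close>

definition extend_tuple :: "nat \<Rightarrow> nat \<Rightarrow> (nat \<Rightarrow> 'm) \<Rightarrow> nat \<Rightarrow> 'm" where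
  "extend_tuple n m x = (\<lambda>i\<in>{..<Suc m}. if i \<le> n then x i else \<epsilon> i (f n i (\<mu> n (x n))))"

lemma P_coord: "x \<in> carrier (P n) \<Longrightarrow> i \<le> n \<Longrightarrow> x i \<in> carrier (B i)"
  by (auto simp: PiE_iff)

lemma P_eqI:
  assumes "x \<in> carrier (P n)" "y \<in> carrier (P n)" "\<And>i. i \<le> n \<Longrightarrow> x i = y i"
  shows "x = y"
  using assms by (intro PiE_ext[of x "{..<Suc n}" _ y]) auto

lemma mu_closed: "x \<in> carrier (P n) \<Longrightarrow> \<mu> n (x n) \<in> carrier (A n)"
  using ou_homD(4)[OF mu_hom] P_coord by blast

lemma extend_tuple_hom:
  assumes "n \<le> m"
  shows "extend_tuple n m \<in> ou_hom (P n) (P m)"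
proof (rule ou_homI)
  note fh = ou_homD[OF f_hom] and eh = ou_homD[OF eps_hom] and mh = ou_homD[OF mu_hom]
  show "extend_tuple n m x \<in> carrier (P m)" if x: "x \<in> carrier (P n)" for x
    using P_coord[OF x] fh(4)[OF _ mu_closed[OF x]] eh(4) assms by (auto simp: extend_tuple_def)
  show "extend_tuple n m (x \<otimes>\<^bsub>P n\<^esub> y) = extend_tuple n m x \<otimes>\<^bsub>P m\<^esub> extend_tuple n m y"
    if x: "x \<in> carrier (P n)" and y: "y \<in> carrier (P n)" for x y
  proof
    fix i
    show "extend_tuple n m (x \<otimes>\<^bsub>P n\<^esub> y) i = (extend_tuple n m x \<otimes>\<^bsub>P m\<^esub> extend_tuple n m y) i"
      using mu_closed[OF x] mu_closed[OF y] P_coord[OF x, of n] P_coord[OF y, of n]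
      by (simp add: extend_tuple_def mh(4,5) fh(4,5) eh(5))
  qed
  show "extend_tuple n m \<one>\<^bsub>P n\<^esub> = \<one>\<^bsub>P m\<^esub>" "extend_tuple n m (ounit (P n)) = ounit (P m)"
    by (auto simp: extend_tuple_def mh(2,3) fh(2,3) eh(2,3) fun_eq_iff)
qed

lemma extend_tuple_id: "x \<in> carrier (P n) \<Longrightarrow> extend_tuple n n x = x"
  by (rule P_eqI[OF ou_homD(4)[OF extend_tuple_hom]]) (auto simp: extend_tuple_def)

lemma extend_tuple_comp:
  assumes "n \<le> m" "m \<le> k" "x \<in> carrier (P n)"
  shows "extend_tuple m k (extend_tuple n m x) = extend_tuple n k x"
proof
  fix i
  show "extend_tuple m k (extend_tuple n m x) i = extend_tuple n k x i"
  proof (cases "m = n")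
    case True
    then show ?thesis using extend_tuple_id assms by simp
  next
    case False
    note c = mu_closed[OF assms(3)]
    have "\<mu> m (\<epsilon> m (f n m (\<mu> n (x n)))) = f n m (\<mu> n (x n))"
      using mu_eps ou_homD(4)[OF f_hom[OF assms(1)] c] by simp
    then show ?thesis using False assms f_comp[OF assms(1) _ c] by (auto simp: extend_tuple_def)
  qed
qed

lemma restrict_hom:
  assumes "n \<le> m"
  shows "(\<lambda>x. restrict x {..<Suc n}) \<in> ou_hom (P m) (P n)"
proof (rule ou_homI)
  show "restrict x {..<Suc n} \<in> carrier (P n)" if x: "x \<in> carrier (P m)" for x
    using P_coord[OF x] assms by simp
  show "restrict (x \<otimes>\<^bsub>P m\<^esub> y) {..<Suc n} = restrict x {..<Suc n} \<otimes>\<^bsub>P n\<^esub> restrict y {..<Suc n}" for x y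
    by (rule ext) (use assms in simp)
qed (rule ext, use assms in simp)+

lemma restrict_extend_tuple:
  assumes "n \<le> m" "x \<in> carrier (P n)"
  shows "restrict (extend_tuple n m x) {..<Suc n} = x"
proof (rule P_eqI[of _ n])
  show "restrict (extend_tuple n m x) {..<Suc n} \<in> carrier (P n)"
    by (rule ou_homD(4)[OF restrict_hom[OF assms(1)] ou_homD(4)[OF extend_tuple_hom[OF assms(1)] assms(2)]])
qed (use assms in \<open>auto simp: extend_tuple_def\<close>)

definition proj :: "nat \<Rightarrow> (nat \<Rightarrow> 'm) \<Rightarrow> 'm" where
  "proj n x = tau n (\<mu> n (x n))"

lemma proj_hom: "proj n \<in> ou_hom (P n) M"
  using ou_homD[OF tau_hom] ou_homD[OF mu_hom] P_coord[of _ n n]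
  by (intro ou_homI) (simp_all add: proj_def)

lemma proj_extend_tuple:
  assumes "n \<le> m" "x \<in> carrier (P n)"
  shows "proj m (extend_tuple n m x) = proj n x"
proof (cases "m = n")
  case True
  then show ?thesis using extend_tuple_id assms by simp
next
  case False
  note c = mu_closed[OF assms(2)]
  have "proj m (extend_tuple n m x) = tau m (f n m (\<mu> n (x n)))"
    using False assms(1) mu_eps ou_homD(4)[OF f_hom[OF assms(1)] c] by (simp add: proj_def extend_tuple_def)
  then show ?thesis using tau_f[OF assms(1) c] by (simp add: proj_def)
qed

lemma proj_onto:
  assumes "a \<in> carrier M"
  shows "\<exists>n. \<exists>x\<in>carrier (P n). proj n x = a"
proof -
  obtain n b where b: "b \<in> carrier (A n)" "tau n b = a" using tau_onto[OF assms] by blast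
  \<comment> \<open>The coordinates before the last one are arbitrary.\<close>
  let ?x = "\<lambda>i\<in>{..<Suc n}. if i = n then \<epsilon> n b else ounit (B i)"
  have "?x \<in> carrier (P n)" using ou_homD(4)[OF eps_hom b(1)] crm_objD(2)[OF B_obj] by auto
  moreover have "proj n ?x = a" using b mu_eps by (simp add: proj_def)
  ultimately show ?thesis by blast
qed

text \<open>
  At a stage \<open>m > n\<close> where the images of \<open>x\<close> and \<open>y\<close> in the retracts agree, the last
  coordinates of the extended tuples are equal.  The tuple \<open>u\<close> consists of the other coordinates of \<open>y\<close>,
  and \<open>v\<close> of those of \<open>x\<close>, so that both sums have coordinates \<open>x\<^sub>i + y\<^sub>i\<close> for \<open>i < m\<close>.
\<close>

lemma proj_eq:
  assumes x: "x \<in> carrier (P n)" and y: "y \<in> carrier (P n)" and eq: "proj n x = proj n y"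
  shows "\<exists>m\<ge>n. \<exists>u\<in>carrier (P m). \<exists>v\<in>carrier (P m). proj m u = \<one>\<^bsub>M\<^esub> \<and> proj m v = \<one>\<^bsub>M\<^esub> \<and>
    extend_tuple n m x \<otimes>\<^bsub>P m\<^esub> u = extend_tuple n m y \<otimes>\<^bsub>P m\<^esub> v"
proof -
  note cx = mu_closed[OF x] and cy = mu_closed[OF y]
  obtain k where k: "n \<le> k" "f n k (\<mu> n (x n)) = f n k (\<mu> n (y n))"
    using tau_eq[OF cx cy] eq unfolding proj_def by blast
  \<comment> \<open>One more step makes the last coordinate a new one, also in the case \<open>k = n\<close>.\<close>
  define m where "m = Suc k"
  have m: "n < m" "n \<le> m" using k by (auto simp: m_def)
  have fm: "f n m (\<mu> n (x n)) = f n m (\<mu> n (y n))"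
    by (rule f_eq_mono[OF k(2)]) (use k cx cy in \<open>auto simp: m_def\<close>)
  define u where "u = (\<lambda>i\<in>{..<Suc m}. if i < m then extend_tuple n m y i else \<one>\<^bsub>B i\<^esub>)"
  define v where "v = (\<lambda>i\<in>{..<Suc m}. if i < m then extend_tuple n m x i else \<one>\<^bsub>B i\<^esub>)"
  have tx: "extend_tuple n m x \<in> carrier (P m)" and ty: "extend_tuple n m y \<in> carrier (P m)"
    using ou_homD(4)[OF extend_tuple_hom[OF m(2)]] x y by auto
  have B: "comm_monoid (B i)" for i by (rule crm_objD[OF B_obj])
  have one: "\<one>\<^bsub>B i\<^esub> \<in> carrier (B i)" for i using B by (simp add: comm_monoid.axioms(1) monoid.one_closed)
  have "u \<in> carrier (P m)" "v \<in> carrier (P m)"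
    using P_coord[OF tx] P_coord[OF ty] one by (auto simp: u_def v_def)
  moreover have "proj m u = \<one>\<^bsub>M\<^esub>" "proj m v = \<one>\<^bsub>M\<^esub>"
    using ou_homD(2)[OF mu_hom] ou_homD(2)[OF tau_hom] by (simp_all add: proj_def u_def v_def)
  moreover have "extend_tuple n m x \<otimes>\<^bsub>P m\<^esub> u = extend_tuple n m y \<otimes>\<^bsub>P m\<^esub> v"
  proof
    fix i
    consider "i < m" | "i = m" | "m < i" by linarith
    then show "(extend_tuple n m x \<otimes>\<^bsub>P m\<^esub> u) i = (extend_tuple n m y \<otimes>\<^bsub>P m\<^esub> v) i"
    proof cases
      case 1
      interpret comm_monoid "B i" by (rule B)
      show ?thesis using 1 P_coord[OF tx, of i] P_coord[OF ty, of i] by (simp add: u_def v_def m_comm)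
    next
      case 2
      have "extend_tuple n m x m = extend_tuple n m y m" using m fm by (simp add: extend_tuple_def)
      then show ?thesis using 2 by (simp add: u_def v_def)
    qed simp
  qed
  ultimately show ?thesis using m(2) by blast
qed

end

section \<open>Realization of M\<close>

theorem proposition8p2:
  fixes M :: "'m ou_monoid" and \<M>' :: "'m ou_monoid set"
  assumes "crm_obj M"
    and "\<forall>A\<in>\<M>'. crm_obj A"
    and "closed_finite_products \<M>'"
    and "\<forall>(D :: nat \<times> nat \<Rightarrow> 'm ou_monoid) d.
      ou_diagram D d \<and> (\<forall>p. D p \<in> \<M>') \<and> (\<forall>p q. p \<le> q \<longrightarrow> ou_embedding (D p) (D q) (d p q)) \<longrightarrow>
      (\<exists>(E :: nat \<times> nat \<Rightarrow> 'r ring) e. V_lifting E e D d)"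
    and "\<exists>(A :: nat \<Rightarrow> 'm ou_monoid) B \<epsilon> \<mu> f g.
      retr_diagram \<M>' A B \<epsilon> \<mu> f g \<and>
      (\<forall>n. ou_embedding (A n) (A (Suc n)) (f n (Suc n)) \<and>
        ou_embedding (B n) (B (Suc n)) (g n (Suc n))) \<and>
      ou_isomorphic (omega_colim A f) M"
  shows "\<exists>R :: 'r ring. regular_ring R \<and> ou_isomorphic M (V R)"
proof -
  obtain A B :: "nat \<Rightarrow> 'm ou_monoid" and \<epsilon> \<mu> :: "nat \<Rightarrow> 'm \<Rightarrow> 'm" and f g
    where retr: "retr_diagram \<M>' A B \<epsilon> \<mu> f g" and colim: "ou_isomorphic (omega_colim A f) M"
    using assms(5) by blast
  obtain \<iota> where \<iota>: "\<iota> \<in> ou_iso (omega_colim A f) M" using colim unfolding ou_isomorphic_def by blast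
  have obj: "retr_obj \<M>' (A n, B n, \<epsilon> n, \<mu> n)" for n using retr unfolding retr_diagram_def by blast
  have BM: "B n \<in> \<M>'" for n using obj[of n] by (simp add: retr_obj_def)
  interpret retract_sequence A f B \<epsilon> \<mu> M \<iota>
  proof
    show "ou_diagram A f" using retr by (simp add: retr_diagram_def)
    show "crm_obj (B n)" for n using BM assms(2) by blast
    show "\<epsilon> n \<in> ou_hom (A n) (B n)" "\<mu> n \<in> ou_hom (B n) (A n)" for n
      using obj[of n] by (auto simp: retr_obj_def)
    show "\<mu> n (\<epsilon> n x) = x" if "x \<in> carrier (A n)" for n x
      using obj[of n] that by (auto simp: retr_obj_def)
  qed fact+

  have "\<exists>C\<in>\<M>'. ou_isomorphic C (P n)" for n
    using assms(3) BM unfolding closed_finite_products_def by blast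
  then obtain C where CM: "\<And>n. C n \<in> \<M>'" and "\<And>n. ou_isomorphic (C n) (P n)" by metis
  then have "\<exists>\<sigma>. \<sigma> \<in> ou_iso (C n) (P n)" for n unfolding ou_isomorphic_def by blast
  then obtain \<sigma> where "\<And>n. \<sigma> n \<in> ou_iso (C n) (P n)" by metis
  moreover have C_obj: "crm_obj (C n)" for n using CM assms(2) by blast
  ultimately have "\<exists>\<rho>. \<sigma> n \<in> ou_hom (C n) (P n) \<and> \<rho> \<in> ou_hom (P n) (C n) \<and>
      (\<forall>x\<in>carrier (C n). \<rho> (\<sigma> n x) = x) \<and> (\<forall>y\<in>carrier (P n). \<sigma> n (\<rho> y) = y)" for n
    using ou_isoE[OF _ crm_objD(1,2)[OF C_obj], of "\<sigma> n" n "P n"] by metis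
  then obtain \<rho> where \<sigma>: "\<And>n. \<sigma> n \<in> ou_hom (C n) (P n)" and \<rho>: "\<And>n. \<rho> n \<in> ou_hom (P n) (C n)"
    and \<rho>\<sigma>: "\<And>n x. x \<in> carrier (C n) \<Longrightarrow> \<rho> n (\<sigma> n x) = x"
    and \<sigma>\<rho>: "\<And>n y. y \<in> carrier (P n) \<Longrightarrow> \<sigma> n (\<rho> n y) = y" by metis
  note \<sigma>_closed = ou_homD(4)[OF \<sigma>] and \<rho>_closed = ou_homD(4)[OF \<rho>]
  note extend_tuple_closed = ou_homD(4)[OF extend_tuple_hom]

  \<comment> \<open>The sequence of products, as a diagram that is constant in the second coordinate.\<close>
  define D :: "nat \<times> nat \<Rightarrow> 'm ou_monoid" where "D p = C (fst p)" for p
  define d where "d p q x = \<rho> (fst q) (extend_tuple (fst p) (fst q) (\<sigma> (fst p) x))" for p q :: "nat \<times> nat" and x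
  have fst_mono: "fst p \<le> fst q" if "p \<le> q" for p q :: "nat \<times> nat"
    using that by (simp add: less_eq_prod_def)
  have d_hom: "d p q \<in> ou_hom (D p) (D q)" if "p \<le> q" for p q
    unfolding d_def D_def using fst_mono[OF that] by (intro ou_hom_comp[OF ou_hom_comp[OF \<sigma> extend_tuple_hom] \<rho>])
  have D_diagram: "ou_diagram D d"
    unfolding ou_diagram_def
  proof (intro conjI allI impI ballI)
    show "crm_obj (D p)" for p by (simp add: D_def C_obj)
    show "d p q \<in> ou_hom (D p) (D q)" if "p \<le> q" for p q by (rule d_hom[OF that])
    show "d p p x = x" if "x \<in> carrier (D p)" for p x
      using that extend_tuple_id[OF \<sigma>_closed] \<rho>\<sigma> by (simp add: d_def D_def)
    show "d q r (d p q x) = d p r x" if pq: "p \<le> q \<and> q \<le> r" and x: "x \<in> carrier (D p)" for p q r x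
    proof -
      have le: "fst p \<le> fst q" "fst q \<le> fst r" using pq fst_mono by auto
      have sx: "\<sigma> (fst p) x \<in> carrier (P (fst p))" using \<sigma>_closed x by (simp add: D_def)
      show ?thesis unfolding d_def using \<sigma>\<rho>[OF extend_tuple_closed[OF le(1) sx]] extend_tuple_comp[OF le sx] by simp
    qed
  qed
  have D_emb: "ou_embedding (D p) (D q) (d p q)" if pq: "p \<le> q" for p q
  proof (rule ou_embedding_retraction[OF d_hom[OF pq]])
    \<comment> \<open>Dropping the added coordinates is a retraction.\<close>
    let ?r = "\<lambda>y. \<rho> (fst p) (restrict (\<sigma> (fst q) y) {..<Suc (fst p)})"
    show "?r \<in> ou_hom (D q) (D p)"
      unfolding D_def using fst_mono[OF pq] by (intro ou_hom_comp[OF ou_hom_comp[OF \<sigma> restrict_hom] \<rho>])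
    show "?r (d p q x) = x" if "x \<in> carrier (D p)" for x
    proof -
      have x: "x \<in> carrier (C (fst p))" using that by (simp add: D_def)
      note sx = \<sigma>_closed[OF x]
      show ?thesis unfolding d_def
        using \<sigma>\<rho>[OF extend_tuple_closed[OF fst_mono[OF pq] sx]] restrict_extend_tuple[OF fst_mono[OF pq] sx] \<rho>\<sigma>[OF x] by simp
    qed
  qed
  have D_mem: "D p \<in> \<M>'" for p by (simp add: D_def CM)
  have "\<exists>(E :: nat \<times> nat \<Rightarrow> 'r ring) e. V_lifting E e D d"
    by (rule assms(4)[rule_format]) (use D_diagram D_emb D_mem in blast)
  then obtain E' :: "nat \<times> nat \<Rightarrow> 'r ring" and e' where "V_lifting E' e' D d" by blast
  then obtain \<phi> where lift: "regular_ring_diagram E' e'"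
    and \<phi>: "\<And>p. \<phi> p \<in> ou_iso (V (E' p)) (D p)"
    and \<phi>_nat: "\<And>p q a. p \<le> q \<Longrightarrow> a \<in> carrier (V (E' p)) \<Longrightarrow> \<phi> q (V_map (E' p) (E' q) (e' p q) a) = d p q (\<phi> p a)"
    unfolding V_lifting_def by blast

  \<comment> \<open>The lifting of the sequence is read off from the row \<open>0\<close> of the lifted diagram.\<close>
  define E where "E n = E' (n, 0)" for n
  define e where "e n m = e' (n, 0) (m, 0)" for n m
  define \<theta> where "\<theta> n a = \<sigma> n (\<phi> (n, 0) a)" for n a
  have E: "vn_regular (E n)" for n
    using lift by (simp add: E_def vn_regular_iff regular_ring_diagram_def)
  have VE: "comm_monoid (V (E n))" "ounit (V (E n)) \<in> carrier (V (E n))" for n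
  proof -
    interpret vn_regular "E n" by (rule E)
    show "comm_monoid (V (E n))" by (rule comm_monoid_V)
    show "ounit (V (E n)) \<in> carrier (V (E n))" by (simp add: V_ounit)
  qed
  have "\<exists>\<phi>'. \<phi> (n, 0) \<in> ou_hom (V (E n)) (C n) \<and> \<phi>' \<in> ou_hom (C n) (V (E n)) \<and>
      (\<forall>x\<in>carrier (V (E n)). \<phi>' (\<phi> (n, 0) x) = x) \<and> (\<forall>y\<in>carrier (C n). \<phi> (n, 0) (\<phi>' y) = y)" for n
    using ou_isoE[OF _ VE, of "\<phi> (n, 0)" n "C n"] \<phi>[of "(n, 0)"] unfolding E_def D_def by (metis fst_conv)
  then obtain \<phi>' where \<phi>h: "\<And>n. \<phi> (n, 0) \<in> ou_hom (V (E n)) (C n)" and \<phi>'h: "\<And>n. \<phi>' n \<in> ou_hom (C n) (V (E n))"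
    and \<phi>'\<phi>: "\<And>n x. x \<in> carrier (V (E n)) \<Longrightarrow> \<phi>' n (\<phi> (n, 0) x) = x"
    and \<phi>\<phi>': "\<And>n y. y \<in> carrier (C n) \<Longrightarrow> \<phi> (n, 0) (\<phi>' n y) = y" by metis
  have \<theta>_hom: "\<theta> n \<in> ou_hom (V (E n)) (P n)" for n
    unfolding \<theta>_def by (rule ou_hom_comp[OF \<phi>h \<sigma>])
  have \<theta>_inj: "a = b" if "\<theta> n a = \<theta> n b" "a \<in> carrier (V (E n))" "b \<in> carrier (V (E n))" for n a b
    using that \<rho>\<sigma> \<phi>'\<phi> ou_homD(4)[OF \<phi>h] unfolding \<theta>_def by metis
  have \<theta>_onto: "\<exists>a\<in>carrier (V (E n)). \<theta> n a = x" if x: "x \<in> carrier (P n)" for n x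
    using \<sigma>\<rho>[OF x] \<phi>\<phi>'[OF \<rho>_closed[OF x]] ou_homD(4)[OF \<phi>'h \<rho>_closed[OF x]] unfolding \<theta>_def by metis
  have \<theta>_nat: "\<theta> m (V_map (E n) (E m) (e n m) a) = extend_tuple n m (\<theta> n a)"
    if nm: "n \<le> m" and a: "a \<in> carrier (V (E n))" for n m a
  proof -
    have "\<phi> (m, 0) (V_map (E n) (E m) (e n m) a) = d (n, 0) (m, 0) (\<phi> (n, 0) a)"
      using \<phi>_nat[of "(n, 0)" "(m, 0)" a] nm a by (simp add: E_def e_def less_eq_prod_def)
    then show ?thesis
      using \<sigma>\<rho>[OF extend_tuple_closed[OF nm \<sigma>_closed[OF ou_homD(4)[OF \<phi>h a]]]] by (simp add: \<theta>_def d_def)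
  qed
  have \<psi>_hom: "(\<lambda>a. proj n (\<theta> n a)) \<in> ou_hom (V (E n)) M" for n
    by (rule ou_hom_comp[OF \<theta>_hom proj_hom])
  interpret V_cone E e M "\<lambda>n a. proj n (\<theta> n a)"
  proof (rule V_cone.intro)
    fix n m k :: nat
    show "vn_regular (E n)" by (rule E)
    show "e n m \<in> ring_hom (E n) (E m)" if "n \<le> m"
      using lift that by (simp add: E_def e_def regular_ring_diagram_def less_eq_prod_def)
    show "e n n x = x" if "x \<in> carrier (E n)" for x
      using lift that by (simp add: E_def e_def regular_ring_diagram_def)
    show "e m k (e n m x) = e n k x" if "n \<le> m" "m \<le> k" "x \<in> carrier (E n)" for x
    proof -
      have "(n, 0 :: nat) \<le> (m, 0) \<and> (m, 0 :: nat) \<le> (k, 0)" using that by (simp add: less_eq_prod_def)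
      then show ?thesis using lift that(3) unfolding E_def e_def regular_ring_diagram_def by blast
    qed
    show "comm_monoid M" "conical M" using crm_objD[OF assms(1)] by auto
    show "(\<lambda>a. proj n (\<theta> n a)) \<in> hom (V (E n)) M" "proj n (\<theta> n \<one>\<^bsub>V (E n)\<^esub>) = \<one>\<^bsub>M\<^esub>"
      "proj n (\<theta> n (ounit (V (E n)))) = ounit M" by (rule ou_homD[OF \<psi>_hom])+
    show "proj m (\<theta> m (V_map (E n) (E m) (e n m) a)) = proj n (\<theta> n a)"
      if "n \<le> m" "a \<in> carrier (V (E n))" for a
      using \<theta>_nat[OF that] proj_extend_tuple[OF that(1) ou_homD(4)[OF \<theta>_hom that(2)]] by simp
    show "\<exists>n. \<exists>a\<in>carrier (V (E n)). proj n (\<theta> n a) = b" if "b \<in> carrier M" for b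
      using proj_onto[OF that] \<theta>_onto by metis
    show "\<exists>m\<ge>n. \<exists>u\<in>carrier (V (E m)). \<exists>v\<in>carrier (V (E m)). proj m (\<theta> m u) = \<one>\<^bsub>M\<^esub> \<and>
        proj m (\<theta> m v) = \<one>\<^bsub>M\<^esub> \<and> V_map (E n) (E m) (e n m) a \<otimes>\<^bsub>V (E m)\<^esub> u =
          V_map (E n) (E m) (e n m) b \<otimes>\<^bsub>V (E m)\<^esub> v"
      if a: "a \<in> carrier (V (E n))" and b: "b \<in> carrier (V (E n))" and eq: "proj n (\<theta> n a) = proj n (\<theta> n b)" for a b
    proof -
      obtain m x y where m: "n \<le> m" "x \<in> carrier (P m)" "y \<in> carrier (P m)"
        "proj m x = \<one>\<^bsub>M\<^esub>" "proj m y = \<one>\<^bsub>M\<^esub>"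
        "extend_tuple n m (\<theta> n a) \<otimes>\<^bsub>P m\<^esub> x = extend_tuple n m (\<theta> n b) \<otimes>\<^bsub>P m\<^esub> y"
        using proj_eq[OF ou_homD(4)[OF \<theta>_hom a] ou_homD(4)[OF \<theta>_hom b] eq] by blast
      obtain u where u: "u \<in> carrier (V (E m))" "\<theta> m u = x" using \<theta>_onto[OF m(2)] by blast
      obtain v where v: "v \<in> carrier (V (E m))" "\<theta> m v = y" using \<theta>_onto[OF m(3)] by blast
      interpret Vm: comm_monoid "V (E m)" by (rule VE)
      let ?h = "V_map (E n) (E m) (e n m)"
      have "e n m \<in> ring_hom (E n) (E m)"
        using lift m(1) by (simp add: E_def e_def regular_ring_diagram_def less_eq_prod_def)
      note h = hom_in_carrier[OF V_map_hom[OF E E this]]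
      have "?h a \<otimes>\<^bsub>V (E m)\<^esub> u = ?h b \<otimes>\<^bsub>V (E m)\<^esub> v"
      proof (rule \<theta>_inj)
        show "\<theta> m (?h a \<otimes>\<^bsub>V (E m)\<^esub> u) = \<theta> m (?h b \<otimes>\<^bsub>V (E m)\<^esub> v)"
          using m(6) ou_homD(5)[OF \<theta>_hom h[OF a] u(1)] ou_homD(5)[OF \<theta>_hom h[OF b] v(1)]
            \<theta>_nat[OF m(1) a] \<theta>_nat[OF m(1) b] u(2) v(2) by simp
      qed (use h a b u v in auto)
      then show ?thesis using m u v by blast
    qed
  qed
  show ?thesis
    using limit_regular V_limit_isomorphic vn_regular_iff by blast
qed

end
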